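(* The spectrum of the truncated Fourier–Plancherel operator $\mathscr{F}_{\mathbb{R}^{+}}$ on $L^2(\mathbb{R}^{+})$ is the segment $$\sigma(\mathscr{F}_{\mathbb{R}^{+}})=\Big[-e^{i\pi/4}\tfrac{1}{\sqrt2},\,e^{i\pi/4}\tfrac{1}{\sqrt2}\Big]=\{(1-\tau)(-e^{i\pi/4}/\sqrt2)+\tau e^{i\pi/4}/\sqrt2:\tau\in[0,1]\}.$$
   Context: $\mathbb{R}^{+}=(0,\infty)$. The truncated Fourier–Plancherel operator is $\mathscr{F}_{\mathbb{R}^{+}}=P_{\mathbb{R}^{+}}\mathscr{F}|_{L^2(\mathbb{R}^{+})}$, where $\mathscr{F}$ is the unitary Fourier–Plancherel operator on $L^2(\mathbb{R})$, $(\mathscr{F}x)(t)=\frac{1}{\sqrt{2\pi}}\int_{\mathbb{R}}x(\xi)e^{it\xi}d\xi$, $L^2(\mathbb{R}^{+})$ is identified with the functions in $L^2(\mathbb{R})$ vanishing on $(-\infty,0]$, and $P_{\mathbb{R}^{+}}$ is multiplication by the indicator of $\mathbb{R}^{+}$. For integrable $x$, $(\mathscr{F}_{\mathbb{R}^{+}}x)(t)=\frac{1}{\sqrt{2\pi}}\int_{\mathbb{R}^{+}}x(\xi)e^{it\xi}d\xi$, $t>0$. *)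

theory Defs
  imports "HOL-Analysis.Analysis"
begin

text \<open>L^2(R+), identified with square-integrable (Borel measurable) functions on R
  vanishing on (-infinity,0]; elements are compared almost everywhere.\<close>
definition L2plus :: "(real \<Rightarrow> complex) set" where
  "L2plus = {f. f \<in> borel_measurable lborel \<and> (\<forall>t\<le>0. f t = 0) \<and>
                 integrable lborel (\<lambda>t. (cmod (f t))^2)}"

definition L2norm :: "(real \<Rightarrow> complex) \<Rightarrow> real" where
  "L2norm f = sqrt (LINT t|lborel. (cmod (f t))^2)"

definition FRplus_trunc :: "real \<Rightarrow> (real \<Rightarrow> complex) \<Rightarrow> real \<Rightarrow> complex" where
  "FRplus_trunc N x t = of_real (indicator {0<..} t / sqrt (2 * pi)) *
      (LINT \<xi>|lborel. indicator {0<..N} \<xi> *\<^sub>R (x \<xi> * exp (\<i> * of_real (t * \<xi>))))"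

text \<open>Graph of the truncated Fourier-Plancherel operator: y = F_{R+} x, where the
  Plancherel transform is the L^2-limit of the truncated integrals.\<close>
definition FRplus :: "(real \<Rightarrow> complex) \<Rightarrow> (real \<Rightarrow> complex) \<Rightarrow> bool" where
  "FRplus x y \<longleftrightarrow> x \<in> L2plus \<and> y \<in> L2plus \<and>
     ((\<lambda>N. L2norm (\<lambda>t. FRplus_trunc N x t - y t)) \<longlongrightarrow> 0) at_top"

definition FRplus_resolvent :: "complex set" where
  "FRplus_resolvent = {z.
     (\<forall>g\<in>L2plus. \<exists>f y. FRplus f y \<and> (AE t in lborel. y t - z * f t = g t)) \<and>
     (\<forall>f y. FRplus f y \<and> (AE t in lborel. y t - z * f t = 0) \<longrightarrow> (AE t in lborel. f t = 0)) \<and>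
     (\<exists>C. \<forall>f y. FRplus f y \<longrightarrow> L2norm f \<le> C * L2norm (\<lambda>t. y t - z * f t))}"

definition FRplus_spectrum :: "complex set" where
  "FRplus_spectrum = - FRplus_resolvent"

end

theory Submission
  imports Defs
begin

text \<open>
  Write \<open>T\<close> for the truncated Fourier-Plancherel operator. Integrating
  \<open>exp (\<i> t (\<xi> + \<eta>) - \<epsilon> t)\<close> over \<open>t > 0\<close> and letting \<open>\<epsilon>\<close> tend to \<open>0\<close> gives
  \<open>T\<^sup>2 = (\<i> / 2\<pi>) H\<close>, where \<open>H\<close> is the Carleman operator with kernel \<open>1 / (\<xi> + \<eta>)\<close>.
  This kernel is positive (it is the Gram kernel of the Laplace transform) and its norm is
  at most \<open>\<pi>\<close> (Schur test with weight \<open>\<xi>\<^bsup>-1/2\<^esup>\<close>), so the numerical range of \<open>T\<^sup>2\<close> lies in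
  the segment from \<open>0\<close> to \<open>\<i>/2\<close>; if \<open>z\<^sup>2\<close> is off this segment, a contraction argument
  inverts \<open>T\<^sup>2 - z\<^sup>2 = (T - z) (T + z)\<close>.

  Conversely \<open>u\<^bsup>-1/2+\<i>\<mu>\<^esup>\<close> is a generalised eigenfunction of \<open>H / \<pi>\<close>, whose eigenvalue
  \<open>w(\<mu>)\<close> is continuous in \<open>\<mu>\<close>, equals \<open>1\<close> at \<open>0\<close> and tends to \<open>0\<close> at infinity. Cutting it off to
  \<open>(\<delta>, 1)\<close> gives \<open>g\<close> such that \<open>(T\<^sup>2 - \<i> w(\<mu>) / 2) g\<close> stays bounded while the norm of \<open>g\<close> tends to
  infinity as \<open>\<delta>\<close> tends to \<open>0\<close>. As \<open>\<langle>T g, g\<rangle>\<close> stays bounded, the vectors \<open>(T + z) g\<close> with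
  \<open>z\<^sup>2 = \<i> w(\<mu>) / 2\<close> form a Weyl sequence for both choices of the square root \<open>z\<close>.
\<close>

section \<open>The Hilbert space of square-integrable functions\<close>

text \<open>Spectral information about the square determines T only up to sign: if (T^2 - z^2) g is
  small relative to g, then z or -z is in the spectrum, and nothing yet says which. Bounded <T g, g>
  settles this, because (T + z) g then cannot be small for either root. This requirement shapes the
  test functions: they need a bounded L1 norm, which makes T g bounded, together with an unbounded
  L2 norm. A second obstacle is that T x need not be integrable when x is, so T (T x) is not
  directly an iterated integral. It is reached through the form of T x against T y without
  conjugation: the kernel is symmetric, so T is its own transpose, and one factor can be moved to
  the other side. The eigenvalue curve w never reaches 0, so the point 0 of the spectrum is obtained
  by perturbation from nearby points. That w is real follows from the numerical range of T^2. The
  Hilbert space is real, with multiplication by the imaginary unit as a separate operator that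
  commutes with T.\<close>

lemma L2plus_D:
  assumes "f \<in> L2plus"
  shows "f \<in> borel_measurable borel" "t \<le> 0 \<Longrightarrow> f t = 0" "integrable lborel (\<lambda>t. (cmod (f t))\<^sup>2)"
  using assms by (auto simp: L2plus_def)

lemma L2plus_I:
  assumes "f \<in> borel_measurable borel" "\<And>t. t \<le> 0 \<Longrightarrow> f t = 0" "integrable lborel (\<lambda>t. (cmod (f t))\<^sup>2)"
  shows "f \<in> L2plus"
  using assms by (auto simp: L2plus_def)

lemma L2plus_dominated:
  assumes "f \<in> borel_measurable borel" "\<And>t. t \<le> 0 \<Longrightarrow> f t = 0"
    and "integrable lborel h" "\<And>t. (cmod (f t))\<^sup>2 \<le> h t"
  shows "f \<in> L2plus"
proof (rule L2plus_I[OF assms(1,2)])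
  note [measurable] = assms(1)
  show "integrable lborel (\<lambda>t. (cmod (f t))\<^sup>2)"
    by (rule Bochner_Integration.integrable_bound[OF assms(3)])
       (use order_trans[OF assms(4) abs_ge_self] in auto)
qed

lemma L2plus_zero: "(\<lambda>_. 0) \<in> L2plus"
  by (rule L2plus_I) auto

lemma L2plus_add:
  assumes "f \<in> L2plus" "g \<in> L2plus"
  shows "(\<lambda>t. f t + g t) \<in> L2plus"
proof (rule L2plus_dominated)
  note [measurable] = L2plus_D(1)[OF assms(1)] L2plus_D(1)[OF assms(2)]
  show "(\<lambda>t. f t + g t) \<in> borel_measurable borel" by measurable
  show "integrable lborel (\<lambda>t. 2 * (cmod (f t))\<^sup>2 + 2 * (cmod (g t))\<^sup>2)"
    using L2plus_D(3)[OF assms(1)] L2plus_D(3)[OF assms(2)] by auto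
  fix t
  have "(cmod (f t + g t))\<^sup>2 \<le> (cmod (f t) + cmod (g t))\<^sup>2"
    by (intro power_mono norm_triangle_ineq) auto
  also have "\<dots> \<le> 2 * (cmod (f t))\<^sup>2 + 2 * (cmod (g t))\<^sup>2"
    using sum_squares_bound[of "cmod (f t)" "cmod (g t)"] by (simp add: power2_sum)
  finally show "(cmod (f t + g t))\<^sup>2 \<le> 2 * (cmod (f t))\<^sup>2 + 2 * (cmod (g t))\<^sup>2" .
qed (use L2plus_D(2)[OF assms(1)] L2plus_D(2)[OF assms(2)] in auto)

lemma L2plus_mult_bounded:
  assumes "f \<in> L2plus" "k \<in> borel_measurable borel" "\<And>t. cmod (k t) \<le> C"
  shows "(\<lambda>t. k t * f t) \<in> L2plus"
proof (rule L2plus_dominated)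
  note [measurable] = L2plus_D(1)[OF assms(1)] assms(2)
  show "(\<lambda>t. k t * f t) \<in> borel_measurable borel" by measurable
  show "integrable lborel (\<lambda>t. C\<^sup>2 * (cmod (f t))\<^sup>2)"
    using L2plus_D(3)[OF assms(1)] by auto
  show "(cmod (k t * f t))\<^sup>2 \<le> C\<^sup>2 * (cmod (f t))\<^sup>2" for t
    using assms(3) by (auto simp: norm_mult power_mult_distrib intro!: mult_right_mono power_mono)
qed (use L2plus_D(2)[OF assms(1)] in auto)

lemma L2plus_cmult: "f \<in> L2plus \<Longrightarrow> (\<lambda>t. c * f t) \<in> L2plus"
  by (rule L2plus_mult_bounded[of f "\<lambda>_. c" "cmod c"]) auto

lemma L2plus_scaleR: "f \<in> L2plus \<Longrightarrow> (\<lambda>t. r *\<^sub>R f t) \<in> L2plus"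
  unfolding scaleR_conv_of_real by (rule L2plus_cmult)

lemma L2plus_uminus: "f \<in> L2plus \<Longrightarrow> (\<lambda>t. - f t) \<in> L2plus"
  using L2plus_cmult[of f "-1"] by simp

lemma L2plus_diff: "f \<in> L2plus \<Longrightarrow> g \<in> L2plus \<Longrightarrow> (\<lambda>t. f t - g t) \<in> L2plus"
  using L2plus_add[of f "\<lambda>t. - g t"] L2plus_uminus[of g] by simp

lemma L2plus_cnj: "f \<in> L2plus \<Longrightarrow> (\<lambda>t. cnj (f t)) \<in> L2plus"
  using L2plus_D[of f]
  by (intro L2plus_I) (auto intro!: borel_measurable_continuous_on[of cnj f] continuous_intros)

text \<open>Truncated functions are integrable, so the Fourier integral is available for them, and
  they are dense; most identities are proved for them and extended by continuity.\<close>

definition cutoff :: "real \<Rightarrow> (real \<Rightarrow> complex) \<Rightarrow> real \<Rightarrow> complex" where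
  "cutoff N f = (\<lambda>t. indicator {0<..N} t * f t)"

lemma L2plus_cutoff: "f \<in> L2plus \<Longrightarrow> cutoff N f \<in> L2plus"
  unfolding cutoff_def by (rule L2plus_mult_bounded[where C=1]) (auto simp: indicator_def)

lemma L2plus_mult_integrable:
  assumes "f \<in> L2plus" "g \<in> L2plus"
  shows "integrable lborel (\<lambda>t. f t * g t)"
proof (rule Bochner_Integration.integrable_bound)
  note [measurable] = L2plus_D(1)[OF assms(1)] L2plus_D(1)[OF assms(2)]
  show "(\<lambda>t. f t * g t) \<in> borel_measurable lborel" by measurable
  show "integrable lborel (\<lambda>t. (cmod (f t))\<^sup>2 + (cmod (g t))\<^sup>2)"
    using L2plus_D(3)[OF assms(1)] L2plus_D(3)[OF assms(2)] by auto
  have "cmod (f t) * cmod (g t) \<le> (cmod (f t))\<^sup>2 + (cmod (g t))\<^sup>2" for t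
    using sum_squares_bound[of "cmod (f t)" "cmod (g t)"]
    mult_nonneg_nonneg[of "cmod (f t)" "cmod (g t)"] by (auto simp del: mult_nonneg_nonneg)
  then show "AE t in lborel. norm (f t * g t) \<le> norm ((cmod (f t))\<^sup>2 + (cmod (g t))\<^sup>2)"
    by (auto simp: norm_mult)
qed

lemma L2plus_mult_cnj_integrable:
  "f \<in> L2plus \<Longrightarrow> g \<in> L2plus \<Longrightarrow> integrable lborel (\<lambda>t. f t * cnj (g t))"
  by (rule L2plus_mult_integrable[OF _ L2plus_cnj])

text \<open>The relation is partial, reflexive exactly on \<open>L2plus\<close>; the quotient thus
  carries the restriction to the space and the identification of functions almost everywhere at
  once.\<close>

definition L2rel :: "(real \<Rightarrow> complex) \<Rightarrow> (real \<Rightarrow> complex) \<Rightarrow> bool" where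
  "L2rel f g \<longleftrightarrow> f \<in> L2plus \<and> g \<in> L2plus \<and> (AE t in lborel. f t = g t)"

lemma part_equivp_L2rel: "part_equivp L2rel"
proof (rule part_equivpI)
  show "\<exists>x. L2rel x x" using L2plus_zero by (auto simp: L2rel_def)
  show "symp L2rel" by (auto simp: symp_def L2rel_def)
  show "transp L2rel" by (auto simp: transp_def L2rel_def)
qed

quotient_type l2 = "real \<Rightarrow> complex" / partial: L2rel
  by (rule part_equivp_L2rel)

lemma borel_measurable_cnj [measurable (raw)]:
  "f \<in> borel_measurable M \<Longrightarrow> (\<lambda>x. cnj (f x)) \<in> borel_measurable M"
  by (rule borel_measurable_continuous_on[of cnj f]) (auto intro: continuous_intros)

lemma AE_eq_pointwise2:
  assumes "AE t in M. f t = f' t" "AE t in M. g t = g' t"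
  shows "AE t in M. h (f t) (g t) = h (f' t) (g' t)"
  using assms by eventually_elim auto

instantiation l2 :: real_inner
begin

lift_definition zero_l2 :: l2 is "\<lambda>_. 0"
  by (simp add: L2rel_def L2plus_zero)

lift_definition plus_l2 :: "l2 \<Rightarrow> l2 \<Rightarrow> l2" is "\<lambda>f g t. f t + g t"
  by (auto simp: L2rel_def L2plus_add intro: AE_eq_pointwise2[where h="(+)"])

lift_definition minus_l2 :: "l2 \<Rightarrow> l2 \<Rightarrow> l2" is "\<lambda>f g t. f t - g t"
  by (auto simp: L2rel_def L2plus_diff intro: AE_eq_pointwise2[where h="(-)"])

lift_definition uminus_l2 :: "l2 \<Rightarrow> l2" is "\<lambda>f t. - f t"
  by (auto simp: L2rel_def L2plus_uminus)

lift_definition scaleR_l2 :: "real \<Rightarrow> l2 \<Rightarrow> l2" is "\<lambda>r f t. r *\<^sub>R f t"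
  by (auto simp: L2rel_def L2plus_scaleR)

text \<open>The type is a real Hilbert space, so this is the real part of the complex product. The
  imaginary part of the product of x and y is \<open>inner x (imul y)\<close>, with
  \<open>imul\<close> multiplication by the imaginary unit; hence later estimates often come in
  pairs.\<close>

lift_definition inner_l2 :: "l2 \<Rightarrow> l2 \<Rightarrow> real" is "\<lambda>f g. Re (LINT t|lborel. f t * cnj (g t))"
proof -
  fix f f' g g' :: "real \<Rightarrow> complex"
  assume r: "L2rel f f'" "L2rel g g'"
  then have [measurable]: "f \<in> borel_measurable borel" "f' \<in> borel_measurable borel"
    "g \<in> borel_measurable borel" "g' \<in> borel_measurable borel"
    by (auto simp: L2rel_def L2plus_def)
  have "(LINT t|lborel. f t * cnj (g t)) = (LINT t|lborel. f' t * cnj (g' t))"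
    using r by (intro integral_cong_AE AE_eq_pointwise2[where h="\<lambda>a b. a * cnj b"])
      (auto simp: L2rel_def)
  then show "Re (LINT t|lborel. f t * cnj (g t)) = Re (LINT t|lborel. f' t * cnj (g' t))" by simp
qed

definition norm_l2 :: "l2 \<Rightarrow> real" where "norm_l2 x = sqrt (inner x x)"
definition sgn_l2 :: "l2 \<Rightarrow> l2" where "sgn_l2 x = inverse (norm x) *\<^sub>R x"
definition dist_l2 :: "l2 \<Rightarrow> l2 \<Rightarrow> real" where "dist_l2 x y = norm (x - y)"
definition uniformity_l2 :: "(l2 \<times> l2) filter" where
  "uniformity_l2 = (INF e\<in>{0<..}. principal {(x, y). dist x y < e})"
definition open_l2 :: "l2 set \<Rightarrow> bool" where
  "open_l2 U = (\<forall>x\<in>U. eventually (\<lambda>(x', y). x' = x \<longrightarrow> y \<in> U) uniformity)"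

lemma inner_self_eq: "(LINT t|lborel. f t * cnj (f t)) = of_real (LINT t|lborel. (cmod (f t))\<^sup>2)"
  by (simp only: integral_complex_of_real[symmetric] complex_norm_square)

instance
proof
  fix x y z :: l2 and r s :: real
  show "x + y + z = x + (y + z)" by transfer (auto simp: L2rel_def L2plus_add add.assoc)
  show "x + y = y + x" by transfer (auto simp: L2rel_def L2plus_add add.commute)
  show "0 + x = x" by transfer (auto simp: L2rel_def)
  show "- x + x = 0" by transfer (auto simp: L2rel_def L2plus_zero)
  show "x - y = x + - y" by transfer (auto simp: L2rel_def L2plus_diff)
  show "r *\<^sub>R (x + y) = r *\<^sub>R x + r *\<^sub>R y"
    by transfer (auto simp: L2rel_def L2plus_scaleR L2plus_add scaleR_add_right simp del: scaleR_conv_of_real)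
  show "(r + s) *\<^sub>R x = r *\<^sub>R x + s *\<^sub>R x"
    by transfer (auto simp: L2rel_def L2plus_scaleR L2plus_add scaleR_add_left simp del: scaleR_conv_of_real)
  show "r *\<^sub>R s *\<^sub>R x = (r * s) *\<^sub>R x"
    by transfer (auto simp: L2rel_def L2plus_scaleR)
  show "1 *\<^sub>R x = x" by transfer (auto simp: L2rel_def)
  show "sgn x = inverse (norm x) *\<^sub>R x" by (simp add: sgn_l2_def)
  show "dist x y = norm (x - y)" by (rule dist_l2_def)
  show "uniformity = (INF e\<in>{0<..}. principal {(x::l2, y). dist x y < e})" by (rule uniformity_l2_def)
  show "open U = (\<forall>x\<in>U. \<forall>\<^sub>F (x', y) in uniformity. x' = x \<longrightarrow> y \<in> U)" for U :: "l2 set" by (rule open_l2_def)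
  show "inner x y = inner y x"
  proof transfer
    fix x y assume "L2rel x x" "L2rel y y"
    have "(LINT t|lborel. x t * cnj (y t)) = (LINT t|lborel. cnj (y t * cnj (x t)))"
      by (simp add: mult.commute)
    also have "\<dots> = cnj (LINT t|lborel. y t * cnj (x t))" by (rule Bochner_Integration.integral_cnj)
    finally show "Re (LINT t|lborel. x t * cnj (y t)) = Re (LINT t|lborel. y t * cnj (x t))" by simp
  qed
  show "inner (x + y) z = inner x z + inner y z"
    by transfer (simp add: L2rel_def L2plus_mult_cnj_integrable distrib_right)
  show "inner (r *\<^sub>R x) y = r * inner x y"
    by transfer simp
  show "0 \<le> inner x x"
    by transfer (simp add: inner_self_eq)
  show "inner x x = 0 \<longleftrightarrow> x = 0"
  proof transfer
    fix x assume "L2rel x x"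
    then have x: "x \<in> L2plus" by (simp add: L2rel_def)
    have "((LINT t|lborel. (cmod (x t))\<^sup>2) = 0) = (AE t in lborel. (cmod (x t))\<^sup>2 = 0)"
      by (rule integral_nonneg_eq_0_iff_AE) (use L2plus_D[OF x] in auto)
    then show "(Re (LINT t|lborel. x t * cnj (x t)) = 0) = L2rel x (\<lambda>_. 0)"
      using x by (simp add: inner_self_eq L2rel_def L2plus_zero)
  qed
  show "norm x = sqrt (inner x x)" by (rule norm_l2_def)
qed

end

abbreviation cls :: "(real \<Rightarrow> complex) \<Rightarrow> l2" where "cls \<equiv> abs_l2"

lemma cls_eq_iff: "f \<in> L2plus \<Longrightarrow> g \<in> L2plus \<Longrightarrow> cls f = cls g \<longleftrightarrow> (AE t in lborel. f t = g t)"
  using Quotient3_rel[OF Quotient3_l2, of f g] by (auto simp: L2rel_def)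

lemma cls_cases: obtains f where "f \<in> L2plus" "x = cls f"
  by (induct x rule: l2.abs_induct) (auto simp: L2rel_def)

lemma cls_add: "f \<in> L2plus \<Longrightarrow> g \<in> L2plus \<Longrightarrow> cls f + cls g = cls (\<lambda>t. f t + g t)"
  by (simp add: plus_l2.abs_eq L2rel_def)

lemma cls_diff: "f \<in> L2plus \<Longrightarrow> g \<in> L2plus \<Longrightarrow> cls f - cls g = cls (\<lambda>t. f t - g t)"
  by (simp add: minus_l2.abs_eq L2rel_def)

lemma cls_scaleR: "f \<in> L2plus \<Longrightarrow> r *\<^sub>R cls f = cls (\<lambda>t. r *\<^sub>R f t)"
  by (simp add: scaleR_l2.abs_eq L2rel_def)

lemma inner_cls: "f \<in> L2plus \<Longrightarrow> g \<in> L2plus \<Longrightarrow>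
    inner (cls f) (cls g) = Re (LINT t|lborel. f t * cnj (g t))"
  by (simp add: inner_l2.abs_eq L2rel_def)

lemma norm_cls: "f \<in> L2plus \<Longrightarrow> norm (cls f) = L2norm f"
  by (simp add: norm_l2_def inner_cls L2norm_def inner_self_eq)

lift_definition imul :: "l2 \<Rightarrow> l2" is "\<lambda>f t. \<i> * f t"
  by (auto simp: L2rel_def L2plus_cmult)

lemma imul_cls: "f \<in> L2plus \<Longrightarrow> imul (cls f) = cls (\<lambda>t. \<i> * f t)"
  by (simp add: imul.abs_eq L2rel_def)

lemma imul_imul: "imul (imul x) = - x"
  by transfer (auto simp: L2rel_def L2plus_uminus L2plus_cmult)

lemma inner_imul: "inner (imul x) (imul y) = inner x y"
  by transfer (simp add: mult_ac)

lemma norm_imul: "norm (imul x) = norm x"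
  by (simp add: norm_eq_sqrt_inner inner_imul)

lemma bounded_linear_imul: "bounded_linear imul"
proof (rule bounded_linear_intro[where K=1])
  show "imul (x + y) = imul x + imul y" for x y
    by transfer (auto simp: L2rel_def L2plus_add L2plus_cmult algebra_simps)
  show "imul (r *\<^sub>R x) = r *\<^sub>R imul x" for r x
    by transfer (auto simp: L2rel_def L2plus_scaleR L2plus_cmult)
qed (simp add: norm_imul)

section \<open>Completeness of the space\<close>

lemma nn_integral_L2norm:
  assumes "f \<in> L2plus"
  shows "(\<integral>\<^sup>+t. ennreal ((cmod (f t))\<^sup>2) \<partial>lborel) = ennreal ((norm (cls f))\<^sup>2)"
proof -
  have "0 \<le> (LINT t|lborel. (cmod (f t))\<^sup>2)" by simp
  then show ?thesis
    using L2plus_D(3)[OF assms] by (simp add: norm_cls[OF assms] L2norm_def nn_integral_eq_integral)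
qed

text \<open>Fatou and Tonelli deliver bounds for the nonnegative integral before any integrability
  is known; this turns such a bound into membership and a norm estimate.\<close>

lemma L2plus_nn_integral_bound:
  assumes "f \<in> borel_measurable borel" "\<And>t. t \<le> 0 \<Longrightarrow> f t = 0"
    and le: "(\<integral>\<^sup>+t. ennreal ((cmod (f t))\<^sup>2) \<partial>lborel) \<le> ennreal (K\<^sup>2)" and K: "0 \<le> K"
  shows "f \<in> L2plus" "norm (cls f) \<le> K"
proof -
  note [measurable] = assms(1)
  show f: "f \<in> L2plus"
  proof (rule L2plus_I[OF assms(1,2)])
    show "integrable lborel (\<lambda>t. (cmod (f t))\<^sup>2)"
      by (rule integrableI_nonneg) (use le in \<open>auto intro: le_less_trans\<close>)
  qed
  have "(norm (cls f))\<^sup>2 \<le> K\<^sup>2"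
    using le unfolding nn_integral_L2norm[OF f] by simp
  then show "norm (cls f) \<le> K" using K by (rule power2_le_imp_le)
qed

text \<open>Weighting the squared increments by 2^k leaves a finite total integral, since 2^k times
  4^(-k) is summable, so the weighted sum is finite almost everywhere. There the elementary bound |D
  k t| <= 2^k |D k t|^2 + 2^(-k) makes the increments absolutely summable.\<close>

lemma AE_convergent_of_L2_summable:
  assumes f: "\<And>k. f k \<in> L2plus"
    and d: "\<And>k. norm (cls (f (Suc k)) - cls (f k)) \<le> (1/2) ^ k"
  shows "AE t in lborel. convergent (\<lambda>k. f k t)"
proof -
  define D where "D k t = f (Suc k) t - f k t" for k t
  have D: "D k \<in> L2plus" for k
    unfolding D_def by (intro L2plus_diff f)
  note [measurable] = L2plus_D(1)[OF D]
  have "(\<integral>\<^sup>+t. (\<Sum>k. ennreal (2 ^ k * (cmod (D k t))\<^sup>2)) \<partial>lborel)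
      = (\<Sum>k. \<integral>\<^sup>+t. ennreal (2 ^ k * (cmod (D k t))\<^sup>2) \<partial>lborel)"
    by (rule nn_integral_suminf) measurable
  also have "\<dots> = (\<Sum>k. ennreal (2 ^ k * (norm (cls (D k)))\<^sup>2))"
    by (simp add: ennreal_mult nn_integral_cmult nn_integral_L2norm[OF D])
  also have "\<dots> \<le> (\<Sum>k. ennreal ((1/2) ^ k))"
  proof (intro suminf_le ennreal_leI)
    fix k :: nat
    have "norm (cls (D k)) \<le> (1/2) ^ k" using d[of k] by (simp add: cls_diff f D_def[abs_def])
    then have "2 ^ k * (norm (cls (D k)))\<^sup>2 \<le> 2 ^ k * ((1/2) ^ k)\<^sup>2"
      by (intro mult_left_mono power_mono) auto
    also have "\<dots> = (1/2) ^ k" by (simp add: power2_eq_square field_simps)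
    finally show "2 ^ k * (norm (cls (D k)))\<^sup>2 \<le> (1/2) ^ k" .
  qed auto
  also have "\<dots> = ennreal (\<Sum>k. (1/2) ^ k)"
    by (rule suminf_ennreal2) auto
  also have "\<dots> < \<infinity>" by simp
  finally have "AE t in lborel. (\<Sum>k. ennreal (2 ^ k * (cmod (D k t))\<^sup>2)) \<noteq> \<infinity>"
    by (intro nn_integral_noteq_infinite) auto
  then show ?thesis
  proof eventually_elim
    case (elim t)
    have "summable (\<lambda>k. 2 ^ k * (cmod (D k t))\<^sup>2)"
      by (rule summable_suminf_not_top) (use elim in auto)
    then have s: "summable (\<lambda>k. 2 ^ k * (cmod (D k t))\<^sup>2 + (1/2) ^ k)"
      by (intro summable_add summable_geometric) auto
    have "norm (D k t) \<le> 2 ^ k * (cmod (D k t))\<^sup>2 + (1/2) ^ k" for k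
    proof -
      define a where "a = (2::real) ^ k"
      have a: "a > 0" by (simp add: a_def)
      have "2 * (a * cmod (D k t)) \<le> (a * cmod (D k t))\<^sup>2 + 1"
        using sum_squares_bound[of "a * cmod (D k t)" 1] by simp
      moreover have "0 \<le> a * cmod (D k t)" using a by simp
      ultimately have "a * cmod (D k t) \<le> (a * cmod (D k t))\<^sup>2 + 1" by linarith
      then have "cmod (D k t) \<le> a * (cmod (D k t))\<^sup>2 + 1 / a"
        using a by (simp add: field_simps power2_eq_square)
      then show ?thesis by (simp add: a_def power_one_over)
    qed
    then have "summable (\<lambda>k. D k t)"
      by (intro summable_comparison_test[OF _ s]) auto
    then have "convergent (\<lambda>n. \<Sum>k<n. D k t)" by (simp add: summable_iff_convergent)
    then have "convergent (\<lambda>n. f n t - f 0 t)" by (simp add: D_def sum_lessThan_telescope[of "\<lambda>k. f k t"])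
    then have "convergent (\<lambda>n. (f n t - f 0 t) + f 0 t)" by (intro convergent_add convergent_const)
    then show ?case by simp
  qed
qed

text \<open>Fatou, applied to |f m - f k|^2 as m grows, bounds the distance from the pointwise limit
  to f k by 2^(-k). This gives membership of the limit in \<open>L2plus\<close> as well as
  convergence in norm.\<close>

lemma rapidly_Cauchy_converges:
  assumes f: "\<And>k. f k \<in> L2plus"
    and d: "\<And>k m. k \<le> m \<Longrightarrow> norm (cls (f m) - cls (f k)) \<le> (1/2) ^ k"
  shows "\<exists>x. (\<lambda>k. cls (f k)) \<longlonglongrightarrow> x"
proof -
  define F where "F t = lim (\<lambda>k. f k t)" for t
  note f_meas [measurable] = L2plus_D(1)[OF f]
  have F_meas [measurable]: "F \<in> borel_measurable borel"
    unfolding F_def by (rule borel_measurable_lim_metric) (rule f_meas)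
  have F0: "t \<le> 0 \<Longrightarrow> F t = 0" for t
    using L2plus_D(2)[OF f] by (simp add: F_def)
  have lim: "AE t in lborel. (\<lambda>k. f k t) \<longlonglongrightarrow> F t"
    using AE_convergent_of_L2_summable[OF f] d by (simp add: F_def convergent_LIMSEQ_iff)
  have bound: "(\<lambda>t. F t - f k t) \<in> L2plus" "norm (cls (\<lambda>t. F t - f k t)) \<le> (1/2) ^ k" for k
  proof -
    have "(\<integral>\<^sup>+t. ennreal ((cmod (F t - f k t))\<^sup>2) \<partial>lborel)
        = (\<integral>\<^sup>+t. liminf (\<lambda>m. ennreal ((cmod (f m t - f k t))\<^sup>2)) \<partial>lborel)"
    proof (rule nn_integral_cong_AE, use lim in eventually_elim)
      case (elim t)
      have "(\<lambda>m. ennreal ((cmod (f m t - f k t))\<^sup>2)) \<longlonglongrightarrow> ennreal ((cmod (F t - f k t))\<^sup>2)"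
        by (intro tendsto_intros elim)
      then show ?case by (rule lim_imp_Liminf[OF sequentially_bot, symmetric])
    qed
    also have "\<dots> \<le> liminf (\<lambda>m. \<integral>\<^sup>+t. ennreal ((cmod (f m t - f k t))\<^sup>2) \<partial>lborel)"
      by (rule nn_integral_liminf) measurable
    also have "\<dots> \<le> ennreal (((1/2) ^ k)\<^sup>2)"
    proof (rule Liminf_le)
      show "\<forall>\<^sub>F m in sequentially. (\<integral>\<^sup>+t. ennreal ((cmod (f m t - f k t))\<^sup>2) \<partial>lborel) \<le> ennreal (((1/2) ^ k)\<^sup>2)"
        using eventually_ge_at_top[of k]
      proof eventually_elim
        case (elim m)
        have "(norm (cls (\<lambda>t. f m t - f k t)))\<^sup>2 \<le> ((1/2) ^ k)\<^sup>2"
          using d[OF elim] by (intro power_mono) (auto simp: cls_diff f)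
        then show ?case
          by (simp only: nn_integral_L2norm[OF L2plus_diff[OF f f]] ennreal_leI)
      qed
    qed simp
    finally have *: "(\<integral>\<^sup>+t. ennreal ((cmod (F t - f k t))\<^sup>2) \<partial>lborel) \<le> ennreal (((1/2) ^ k)\<^sup>2)" .
    show "(\<lambda>t. F t - f k t) \<in> L2plus" "norm (cls (\<lambda>t. F t - f k t)) \<le> (1/2) ^ k"
      by (rule L2plus_nn_integral_bound[OF _ _ *]; use F0 L2plus_D(2)[OF f] in simp)+
  qed
  have F: "F \<in> L2plus" using L2plus_add[OF bound(1)[of 0] f[of 0]] by simp
  have "(\<lambda>k. (1/2::real) ^ k) \<longlonglongrightarrow> 0" by (rule LIMSEQ_realpow_zero) auto
  then have "(\<lambda>k. cls F - cls (f k)) \<longlonglongrightarrow> 0"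
    by (rule Lim_null_comparison[rotated]) (use bound in \<open>simp add: cls_diff F f\<close>)
  then have "(\<lambda>k. cls F - (cls F - cls (f k))) \<longlonglongrightarrow> cls F - 0" by (intro tendsto_intros)
  then show ?thesis by auto
qed

instance l2 :: complete_space
proof
  fix X :: "nat \<Rightarrow> l2" assume X: "Cauchy X"
  have "\<exists>N. \<forall>m\<ge>N. \<forall>n\<ge>N. dist (X m) (X n) < (1/2) ^ k" for k
    by (rule metric_CauchyD[OF X]) simp
  then obtain N where N: "\<And>k m n. N k \<le> m \<Longrightarrow> N k \<le> n \<Longrightarrow> dist (X m) (X n) < (1/2) ^ k" by metis
  \<comment> \<open>The sum dominates every \<open>N k\<close>, and the additional \<open>k\<close>
    makes the index strictly increasing even where \<open>N\<close> vanishes.\<close>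
  define r where "r k = (\<Sum>j\<le>k. N j) + k" for k
  have r: "strict_mono r" by (rule strict_monoI_Suc) (simp add: r_def)
  have rN: "N k \<le> r k" for k unfolding r_def by (rule trans_le_add1, rule member_le_sum) auto
  have "\<exists>f. f \<in> L2plus \<and> X (r k) = cls f" for k
    by (rule cls_cases[of "X (r k)"]) blast
  then obtain f where f: "\<And>k. f k \<in> L2plus \<and> X (r k) = cls (f k)" by metis
  have "\<exists>x. (\<lambda>k. cls (f k)) \<longlonglongrightarrow> x"
  proof (rule rapidly_Cauchy_converges)
    fix k m :: nat assume km: "k \<le> m"
    have "N k \<le> r m" using rN[of k] strict_mono_less_eq[OF r, of k m] km by simp
    then show "norm (cls (f m) - cls (f k)) \<le> (1/2) ^ k"
      using N[of k "r m" "r k"] rN[of k] f by (simp add: dist_norm)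
  qed (use f in blast)
  then obtain x where "(X \<circ> r) \<longlonglongrightarrow> x" using f by (auto simp: comp_def)
  then show "convergent X"
    using Cauchy_converges_subseq[OF X r] by (auto simp: convergent_def comp_def)
qed

section \<open>Coercive operators and resolvents\<close>

text \<open>A solution is a fixed point of x - \<theta> (B x - y). Expanding the square, coercivity
  gives the factor 1 - 2 \<theta> c + \<theta>^2 M^2 for squared distances, which is smallest at
  \<theta> = c / M^2.\<close>

lemma Lax_Milgram:
  fixes B :: "'a::{real_inner, complete_space} \<Rightarrow> 'a"
  assumes B: "bounded_linear B" and c: "c > 0"
    and coercive: "\<And>x. c * (norm x)\<^sup>2 \<le> inner (B x) x"
  shows "\<exists>x. B x = y"
proof -
  interpret bounded_linear B by fact
  obtain K where K: "K > 0" "\<And>x. norm (B x) \<le> norm x * K" using pos_bounded by blast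
  \<comment> \<open>Raising the operator bound to at least \<open>c\<close> makes \<open>q\<close>
    nonnegative, so that \<open>sqrt q\<close> is an admissible contraction constant.\<close>
  define M where "M = max K c"
  have M: "M > 0" "c \<le> M" "norm (B x) \<le> M * norm x" for x
    using K c mult_right_mono[of K M "norm x"] by (auto simp: M_def mult.commute intro: order_trans)
  define \<theta> where "\<theta> = c / M\<^sup>2"
  have \<theta>: "\<theta> > 0" using c M by (simp add: \<theta>_def)
  define q where "q = 1 - \<theta> * c"
  have "c\<^sup>2 \<le> M\<^sup>2" using M c by (intro power_mono) auto
  then have q: "0 \<le> q" "q < 1" using \<theta> c M by (auto simp: q_def \<theta>_def power2_eq_square field_simps)
  have contract: "norm (x - \<theta> *\<^sub>R B x) \<le> sqrt q * norm x" for x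
  proof -
    have "(norm (x - \<theta> *\<^sub>R B x))\<^sup>2 = (norm x)\<^sup>2 - 2 * \<theta> * inner (B x) x + \<theta>\<^sup>2 * (norm (B x))\<^sup>2"
      unfolding power2_norm_eq_inner
      by (simp add: inner_diff_left inner_diff_right inner_commute power2_eq_square right_diff_distrib)
    also have "\<dots> \<le> (norm x)\<^sup>2 - 2 * \<theta> * (c * (norm x)\<^sup>2) + \<theta>\<^sup>2 * (M * norm x)\<^sup>2"
      using coercive[of x] \<theta> M(3)[of x] by (intro add_mono diff_mono mult_left_mono power_mono) auto
    also have "\<dots> = q * (norm x)\<^sup>2"
      using M(1) by (simp add: q_def \<theta>_def power2_eq_square field_simps)
    also have "\<dots> = (sqrt q * norm x)\<^sup>2" using q by (simp add: power_mult_distrib)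
    finally show ?thesis by (rule power2_le_imp_le) (use q in auto)
  qed
  have "\<exists>!x. (x - \<theta> *\<^sub>R B x) + \<theta> *\<^sub>R y = x"
  proof (rule banach_fix_type[where c = "sqrt q"])
    show "\<forall>x z. dist (x - \<theta> *\<^sub>R B x + \<theta> *\<^sub>R y) (z - \<theta> *\<^sub>R B z + \<theta> *\<^sub>R y) \<le> sqrt q * dist x z"
    proof (intro allI)
      fix x z
      have "(x - \<theta> *\<^sub>R B x + \<theta> *\<^sub>R y) - (z - \<theta> *\<^sub>R B z + \<theta> *\<^sub>R y) = (x - z) - \<theta> *\<^sub>R B (x - z)"
        by (simp add: diff algebra_simps)
      then show "dist (x - \<theta> *\<^sub>R B x + \<theta> *\<^sub>R y) (z - \<theta> *\<^sub>R B z + \<theta> *\<^sub>R y) \<le> sqrt q * dist x z"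
        unfolding dist_norm by (simp only: contract)
    qed
  qed (use q in \<open>auto simp: real_sqrt_lt_1_iff\<close>)
  then obtain x where "(x - \<theta> *\<^sub>R B x) + \<theta> *\<^sub>R y = x" by blast
  then have "\<theta> *\<^sub>R B x = \<theta> *\<^sub>R y" by (auto simp: algebra_simps)
  then have "B x = y" using \<theta> by simp
  then show ?thesis by blast
qed

section \<open>Complex scalars and the two resolvent criteria\<close>

definition cscale :: "complex \<Rightarrow> l2 \<Rightarrow> l2" where
  "cscale z x = Re z *\<^sub>R x + Im z *\<^sub>R imul x"

lemmas imul_add = linear_add[OF bounded_linear.linear[OF bounded_linear_imul]]
lemmas imul_diff = linear_diff[OF bounded_linear.linear[OF bounded_linear_imul]]
lemmas imul_scaleR = linear_scale[OF bounded_linear.linear[OF bounded_linear_imul]]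

lemma cscale_cls: "f \<in> L2plus \<Longrightarrow> cscale z (cls f) = cls (\<lambda>t. z * f t)"
proof -
  assume f: "f \<in> L2plus"
  have "(\<lambda>t. z * f t) = (\<lambda>t. Re z *\<^sub>R f t + Im z *\<^sub>R (\<i> * f t))"
    by (auto simp: complex_eq_iff)
  then show ?thesis
    using f by (simp add: cscale_def imul_cls cls_scaleR cls_add L2plus_cmult L2plus_scaleR del: scaleR_conv_of_real)
qed

lemma bounded_linear_cscale: "bounded_linear (cscale z)"
  unfolding cscale_def
  by (intro bounded_linear_add bounded_linear_const_scaleR bounded_linear_ident bounded_linear_imul)

lemmas cscale_add = linear_add[OF bounded_linear.linear[OF bounded_linear_cscale]]
lemmas cscale_diff = linear_diff[OF bounded_linear.linear[OF bounded_linear_cscale]]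

lemma inner_imul_left: "inner (imul x) y = - inner x (imul y)"
  using inner_imul[of x "imul y"] by (simp add: imul_imul)

lemma inner_imul_self: "inner x (imul x) = 0" "inner (imul x) x = 0"
  using inner_imul_left[of x x] by (auto simp: inner_commute)

lemma norm_cscale: "norm (cscale z x) = cmod z * norm x"
proof -
  have "(norm (cscale z x))\<^sup>2 = ((Re z)\<^sup>2 + (Im z)\<^sup>2) * (norm x)\<^sup>2"
    unfolding power2_norm_eq_inner
    by (simp add: cscale_def inner_add_left inner_add_right inner_imul
        inner_imul_self power2_eq_square distrib_right)
  also have "\<dots> = (cmod z * norm x)\<^sup>2" by (simp add: cmod_power2 power_mult_distrib)
  finally show ?thesis by (simp add: power2_eq_iff_nonneg)
qed

lemma cscale_cscale: "cscale z (cscale w x) = cscale (z * w) x"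
  by (simp add: cscale_def imul_add imul_scaleR imul_imul algebra_simps)

text \<open>In the next lemma \<open>T\<^sup>2 = \<i> A / 2\<close> with \<open>0 \<le> A \<le> 1\<close>, so \<open>z\<^sup>2\<close> can be separated from the numerical range
  of \<open>T\<^sup>2\<close> by a line.\<close>

lemma
  fixes T :: "l2 \<Rightarrow> l2"
  assumes T: "bounded_linear T" and T_imul: "\<And>x. T (imul x) = imul (T x)"
    and real: "\<And>x. inner (T (T x)) x = 0"
    and pos: "\<And>x. 0 \<le> inner (T (T x)) (imul x)"
    and le: "\<And>x. inner (T (T x)) (imul x) \<le> (norm x)\<^sup>2 / 2"
    and z: "z\<^sup>2 \<notin> closed_segment 0 (\<i> / 2)"
  shows resolvent_surj: "\<exists>x. T x - cscale z x = y"
    and resolvent_bound: "\<exists>C. \<forall>x. norm x \<le> C * norm (T x - cscale z x)"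
proof -
  interpret T: bounded_linear T by fact
  \<comment> \<open>On the complex plane \<open>inner a w\<close> is the real part of
    \<open>cnj a * w\<close>. Multiplying the operator by \<open>cnj a\<close> therefore turns the
    separating line into coercivity.\<close>
  obtain a b where ab: "inner a (z\<^sup>2) < b" "\<forall>s\<in>closed_segment 0 (\<i> / 2). b < inner a s"
    using separating_hyperplane_closed_point[OF convex_closed_segment compact_imp_closed[OF compact_segment] z] by blast
  define c where "c = b - inner a (z\<^sup>2)"
  have c: "c > 0" using ab by (simp add: c_def)
  define R where "R x = T (T x) - cscale (z\<^sup>2) x" for x
  have T_cscale: "T (cscale w x) = cscale w (T x)" for w x
    by (simp add: cscale_def T.add T.scaleR T_imul)
  \<comment> \<open>Both orders of the factorisation are recorded: with T - z as the outer factor it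
    yields solvability, with T - z as the inner factor the lower bound.\<close>
  have R_plus: "T (T x + cscale z x) - cscale z (T x + cscale z x) = R x" for x
    by (simp add: R_def T.add T_cscale cscale_add cscale_cscale power2_eq_square)
  have R_minus: "R x = T (T x - cscale z x) + cscale z (T x - cscale z x)" for x
    by (simp add: R_def T.diff T_cscale cscale_diff cscale_cscale power2_eq_square)
  have R: "bounded_linear R"
    unfolding R_def
    by (intro bounded_linear_sub bounded_linear_compose[OF T T] bounded_linear_cscale)
  have coercive: "c * (norm x)\<^sup>2 \<le> inner (cscale (cnj a) (R x)) x" for x
  proof (cases "x = 0")
    case False
    then have x: "(norm x)\<^sup>2 > 0" by simp
    \<comment> \<open>The complex product of T^2 x and x is (\<i> / 2) \<alpha> times the squared
      norm of x, so \<alpha> names the point of the segment at which the separation inequality is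
      evaluated.\<close>
    define \<alpha> where "\<alpha> = 2 * inner (T (T x)) (imul x) / (norm x)\<^sup>2"
    have \<alpha>: "0 \<le> \<alpha>" "\<alpha> \<le> 1" "inner (T (T x)) (imul x) = \<alpha> / 2 * (norm x)\<^sup>2"
      using pos[of x] le[of x] x by (auto simp: \<alpha>_def)
    have "b < inner a (of_real \<alpha> * (\<i> / 2))"
      using ab(2) \<alpha> by (auto simp: closed_segment_def scaleR_conv_of_real)
    then have "c < inner a (of_real \<alpha> * (\<i> / 2)) - inner a (z\<^sup>2)" by (simp add: c_def)
    then have "c * (norm x)\<^sup>2 \<le> (inner a (of_real \<alpha> * (\<i> / 2)) - inner a (z\<^sup>2)) * (norm x)\<^sup>2"
      using x by simp
    also have "\<dots> = inner (cscale (cnj a) (R x)) x"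
      unfolding power2_norm_eq_inner
      by (simp add: R_def cscale_def inner_add_left inner_diff_left inner_imul_left real \<alpha>(3)[unfolded power2_norm_eq_inner]
          inner_complex_def imul_add imul_scaleR imul_imul imul_diff inner_imul_self
          algebra_simps power2_eq_square)
    finally show ?thesis .
  qed auto
  have bl: "bounded_linear (\<lambda>x. cscale (cnj a) (R x))"
    by (rule bounded_linear_compose[OF bounded_linear_cscale R])
  obtain x where "cscale (cnj a) (R x) = cscale (cnj a) y"
    using Lax_Milgram[OF bl c coercive] by blast
  then have "cscale (cnj a) (R x - y) = 0" by (simp add: cscale_diff)
  then have "cmod (cnj a) * norm (R x - y) = 0" using norm_cscale[of "cnj a" "R x - y"] by simp
  moreover have "a \<noteq> 0" using ab(1) ab(2) by auto
  ultimately have "R x = y" by simp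
  then show "\<exists>x. T x - cscale z x = y" using R_plus by blast
  obtain K where K: "K > 0" "\<And>x. norm (T x) \<le> norm x * K" using T.pos_bounded by blast
  have "norm x \<le> (cmod a * (K + cmod z) / c) * norm (T x - cscale z x)" for x
  proof (cases "x = 0")
    case False
    have "c * (norm x)\<^sup>2 \<le> norm (cscale (cnj a) (R x)) * norm x"
      using coercive[of x] Cauchy_Schwarz_ineq2[of "cscale (cnj a) (R x)" x] by linarith
    then have "c * norm x \<le> cmod a * norm (R x)"
      using False by (simp add: norm_cscale power2_eq_square)
    also have "\<dots> \<le> cmod a * ((K + cmod z) * norm (T x - cscale z x))"
    proof (rule mult_left_mono)
      have "norm (R x) \<le> norm (T (T x - cscale z x)) + norm (cscale z (T x - cscale z x))"
        unfolding R_minus by (rule norm_triangle_ineq)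
      also have "\<dots> \<le> (K + cmod z) * norm (T x - cscale z x)"
        using K(2)[of "T x - cscale z x"] by (simp add: norm_cscale algebra_simps)
      finally show "norm (R x) \<le> (K + cmod z) * norm (T x - cscale z x)" .
    qed simp
    finally show ?thesis using c by (simp add: field_simps)
  qed (use K c in simp)
  then show "\<exists>C. \<forall>x. norm x \<le> C * norm (T x - cscale z x)" by blast
qed

text \<open>Put f = (T + z) g. Then (T - z) f is bounded, so a lower bound for T - z would bound f.
  On the other hand |f|^2 contains |z g|^2, and the cross term 2 Re <T g, z g> is controlled by
  \<open>small\<close>, whose two parts bound the real and the imaginary part of <T g, g>. Without
  this control f could vanish, as it does when g is an eigenvector for -z.\<close>

lemma no_resolvent_bound:
  fixes T :: "l2 \<Rightarrow> l2"
  assumes T: "bounded_linear T" and T_imul: "\<And>x. T (imul x) = imul (T x)"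
    and z: "z \<noteq> 0"
    and g: "filterlim (\<lambda>n::nat. norm (g n)) at_top sequentially"
    and approx: "\<And>n. norm (T (T (g n)) - cscale (z\<^sup>2) (g n)) \<le> K"
    and small: "\<And>n. \<bar>inner (T (g n)) (g n)\<bar> \<le> K" "\<And>n. \<bar>inner (T (g n)) (imul (g n))\<bar> \<le> K"
  shows "\<not> (\<exists>C. \<forall>x. norm x \<le> C * norm (T x - cscale z x))"
proof
  assume "\<exists>C. \<forall>x. norm x \<le> C * norm (T x - cscale z x)"
  then obtain C where C: "\<And>x. norm x \<le> C * norm (T x - cscale z x)" by blast
  interpret T: bounded_linear T by fact
  have T_cscale: "T (cscale w x) = cscale w (T x)" for w x
    by (simp add: cscale_def T.add T.scaleR T_imul)
  define a where "a = cmod z"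
  have a: "a > 0" using z by (simp add: a_def)
  have K: "K \<ge> 0" using approx[of 0] norm_ge_zero order_trans by blast
  have "a\<^sup>2 * (norm (g n))\<^sup>2 \<le> (\<bar>C\<bar> * K)\<^sup>2 + 4 * a * K" for n
  proof -
    define f where "f = T (g n) + cscale z (g n)"
    have "T f - cscale z f = T (T (g n)) - cscale (z\<^sup>2) (g n)"
      by (simp add: f_def T.add T_cscale cscale_add cscale_cscale power2_eq_square)
    then have "norm f \<le> C * norm (T (T (g n)) - cscale (z\<^sup>2) (g n))" using C[of f] by simp
    also have "\<dots> \<le> \<bar>C\<bar> * K" using approx[of n] by (intro mult_mono) auto
    finally have f: "(norm f)\<^sup>2 \<le> (\<bar>C\<bar> * K)\<^sup>2" by (intro power_mono) auto
    have "\<bar>inner (T (g n)) (cscale z (g n))\<bar> \<le> \<bar>Re z\<bar> * K + \<bar>Im z\<bar> * K"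
      unfolding cscale_def inner_add_right inner_scaleR_right
      by (rule order_trans[OF abs_triangle_ineq]) (intro add_mono, simp_all add: abs_mult mult_left_mono small)
    also have "\<dots> \<le> a * K + a * K"
      using K by (intro add_mono mult_right_mono) (auto simp: a_def abs_Re_le_cmod abs_Im_le_cmod)
    finally have "- (2 * a * K) \<le> inner (T (g n)) (cscale z (g n))" by linarith
    moreover have "(norm f)\<^sup>2 = (norm (T (g n)))\<^sup>2 + 2 * inner (T (g n)) (cscale z (g n)) + (norm (cscale z (g n)))\<^sup>2"
      by (simp add: f_def power2_norm_eq_inner inner_add_left inner_add_right inner_commute)
    ultimately have "(norm (cscale z (g n)))\<^sup>2 \<le> (norm f)\<^sup>2 + 4 * a * K"
      using zero_le_power2[of "norm (T (g n))"] by linarith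
    then show ?thesis using f by (simp add: norm_cscale a_def power_mult_distrib)
  qed
  then have "(norm (g n))\<^sup>2 \<le> ((\<bar>C\<bar> * K)\<^sup>2 + 4 * a * K) / a\<^sup>2" for n
    using a by (simp add: pos_le_divide_eq mult.commute)
  then have b: "norm (g n) \<le> sqrt (((\<bar>C\<bar> * K)\<^sup>2 + 4 * a * K) / a\<^sup>2)" for n
    by (rule real_le_rsqrt)
  obtain n where "sqrt (((\<bar>C\<bar> * K)\<^sup>2 + 4 * a * K) / a\<^sup>2) + 1 \<le> norm (g n)"
    using g by (auto simp: filterlim_at_top eventually_sequentially)
  with b[of n] show False by linarith
qed

section \<open>Laplace integrals and the Fourier integral\<close>

lemma integral_FTC_nonneg:
  fixes f F :: "real \<Rightarrow> real" and a b :: ereal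
  assumes "a < b"
    and F: "\<And>x. a < ereal x \<Longrightarrow> ereal x < b \<Longrightarrow> (F has_real_derivative f x) (at x)"
    and f: "\<And>x. a < ereal x \<Longrightarrow> ereal x < b \<Longrightarrow> isCont f x"
    and nonneg: "\<And>x. a < ereal x \<Longrightarrow> ereal x < b \<Longrightarrow> 0 \<le> f x"
    and A: "((F \<circ> real_of_ereal) \<longlongrightarrow> A) (at_right a)"
    and B: "((F \<circ> real_of_ereal) \<longlongrightarrow> B) (at_left b)"
  shows "integrable lborel (\<lambda>x. indicator (einterval a b) x * f x)"
    and "(LINT x|lborel. indicator (einterval a b) x * f x) = B - A"
    and "(\<integral>\<^sup>+x. ennreal (indicator (einterval a b) x * f x) \<partial>lborel) = ennreal (B - A)"
proof -
  note * = interval_integral_FTC_nonneg[OF assms(1) F f _ A B]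
  show 1: "integrable lborel (\<lambda>x. indicator (einterval a b) x * f x)"
    using *(1) nonneg by (simp add: set_integrable_def)
  show 2: "(LINT x|lborel. indicator (einterval a b) x * f x) = B - A"
    using *(2) nonneg \<open>a < b\<close>
    by (simp add: interval_lebesgue_integral_def set_lebesgue_integral_def less_imp_le)
  show "(\<integral>\<^sup>+x. ennreal (indicator (einterval a b) x * f x) \<partial>lborel) = ennreal (B - A)"
    using nn_integral_eq_integral[OF 1] 2 nonneg by (simp add: indicator_def einterval_iff)
qed

lemma exp_halfline:
  fixes r :: real
  assumes r: "r > 0"
  shows "integrable lborel (\<lambda>t. indicator {0<..} t * exp (- (r * t)))"
    and "(LINT t|lborel. indicator {0<..} t * exp (- (r * t))) = 1 / r"
proof -
  have "((\<lambda>t. - exp (- (r * t)) / r) \<longlongrightarrow> - 0 / r) at_top"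
    using r by (intro tendsto_intros filterlim_compose[OF exp_at_bot] filterlim_uminus_at_bot_at_top
        filterlim_tendsto_pos_mult_at_top[OF tendsto_const] filterlim_compose[OF filterlim_uminus_at_bot_at_top]
        filterlim_ident) auto
  moreover have "((\<lambda>t. - exp (- (r * t)) / r) \<longlongrightarrow> - exp (- (r * 0)) / r) (at_right 0)"
    using r by (intro tendsto_intros) auto
  ultimately have "integrable lborel (\<lambda>x. indicator (einterval (ereal 0) \<infinity>) x * exp (- (r * x)))"
    "(LINT x|lborel. indicator (einterval (ereal 0) \<infinity>) x * exp (- (r * x))) = 0 - (- 1 / r)"
    by (intro integral_FTC_nonneg[where F="\<lambda>t. - exp (- (r * t)) / r"];
        use r in \<open>auto simp: ereal_tendsto_simps intro!: derivative_eq_intros continuous_intros\<close>)+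
  then show "integrable lborel (\<lambda>t. indicator {0<..} t * exp (- (r * t)))"
    "(LINT t|lborel. indicator {0<..} t * exp (- (r * t))) = 1 / r" by simp_all
qed

lemma complex_exp_halfline:
  fixes c :: complex
  assumes c: "Re c > 0"
  shows "integrable lborel (\<lambda>t. indicator {0<..} t *\<^sub>R exp (- (c * of_real t)))"
    and "(LINT t|lborel. indicator {0<..} t *\<^sub>R exp (- (c * of_real t))) = 1 / c"
proof -
  show 1: "integrable lborel (\<lambda>t. indicator {0<..} t *\<^sub>R exp (- (c * of_real t)))"
    by (rule Bochner_Integration.integrable_bound[OF exp_halfline(1)[OF c]])
       (auto simp: indicator_def)
  have lim: "((\<lambda>t. - exp (- (c * of_real t)) / c) \<longlongrightarrow> 0) at_top"
  proof (rule Lim_null_comparison)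
    show "\<forall>\<^sub>F t in at_top. norm (- exp (- (c * of_real t)) / c) \<le> exp (- (Re c * t)) / cmod c"
      by (auto simp: norm_divide)
    have "((\<lambda>t. exp (- (Re c * t)) / cmod c) \<longlongrightarrow> 0 / cmod c) at_top"
      using c by (intro tendsto_intros filterlim_compose[OF exp_at_bot]
        filterlim_tendsto_pos_mult_at_top[OF tendsto_const] filterlim_compose[OF filterlim_uminus_at_bot_at_top]
        filterlim_ident) auto
    then show "((\<lambda>t. exp (- (Re c * t)) / cmod c) \<longlongrightarrow> 0) at_top" by simp
  qed
  have lim0: "((\<lambda>t. - exp (- (c * of_real t)) / c) \<longlongrightarrow> - exp (- (c * of_real 0)) / c) (at_right 0)"
    using c by (intro tendsto_intros) auto
  have "(LBINT t=ereal 0..\<infinity>. exp (- (c * of_real t))) = 0 - (- exp (- (c * of_real 0)) / c)"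
  proof (rule interval_integral_FTC_integrable[where F="\<lambda>t. - exp (- (c * of_real t)) / c"])
    show "((\<lambda>t. - exp (- (c * of_real t)) / c) has_vector_derivative exp (- (c * of_real x))) (at x)" for x
      using c by (auto intro!: derivative_eq_intros has_vector_derivative_real_field)
    show "isCont (\<lambda>t. exp (- (c * of_real t))) x" for x :: real by (intro continuous_intros)
  qed (use 1 lim lim0 in \<open>auto simp: set_integrable_def ereal_tendsto_simps\<close>)
  then show "(LINT t|lborel. indicator {0<..} t *\<^sub>R exp (- (c * of_real t))) = 1 / c"
    by (simp add: interval_lebesgue_integral_def set_lebesgue_integral_def)
qed

text \<open>Integrating the modulus over t first leaves |F| / Re c, so \<open>int\<close> is exactly
  the Fubini condition. Positivity of Re c is asked only where F is nonzero: for the kernel 1 /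
  (\<xi> + \<eta>) it holds only on the positive quadrant, outside which F vanishes.\<close>

lemma Laplace_Fubini:
  fixes F c :: "real \<times> real \<Rightarrow> complex"
  assumes [measurable]: "F \<in> borel_measurable borel" "c \<in> borel_measurable borel"
    and pos: "\<And>p. F p \<noteq> 0 \<Longrightarrow> Re (c p) > 0"
    and int: "integrable lborel (\<lambda>p. cmod (F p) / Re (c p))"
  shows "integrable lborel (\<lambda>t. indicator {0<..} t *\<^sub>R (LINT p|lborel. F p * exp (- (c p * of_real t))))"
    and "(LINT t|lborel. indicator {0<..} t *\<^sub>R (LINT p|lborel. F p * exp (- (c p * of_real t))))
       = (LINT p|lborel. F p / c p)"
proof -
  define f where "f p t = F p * (indicator {0<..} t *\<^sub>R exp (- (c p * of_real t)))" for p t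
  have n: "norm (f p t) = cmod (F p) * (indicator {0<..} t * exp (- (Re (c p) * t)))" for p t
    by (auto simp: f_def norm_mult indicator_def)
  have int_p: "integrable lborel (f p)" for p
    using complex_exp_halfline(1)[OF pos[of p]] unfolding f_def
    by (cases "F p = 0") (auto simp del: mult_scaleR_right)
  have "(LINT t|lborel. norm (f p t)) = cmod (F p) / Re (c p)" for p
    using exp_halfline(2)[OF pos[of p]] unfolding n by (cases "F p = 0") auto
  then have "integrable lborel (\<lambda>p. LINT t|lborel. norm (f p t))"
    using int by simp
  then have f: "integrable (lborel \<Otimes>\<^sub>M lborel) (case_prod f)"
  proof (intro lborel_pair.Fubini_integrable)
    show "case_prod f \<in> borel_measurable (lborel \<Otimes>\<^sub>M lborel)"
      unfolding f_def split_beta' by measurable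
  qed (simp_all add: int_p)
  have eq: "indicator {0<..} t *\<^sub>R (LINT p|lborel. F p * exp (- (c p * of_real t))) = (LINT p|lborel. f p t)" for t
    by (simp add: f_def indicator_def)
  show "integrable lborel (\<lambda>t. indicator {0<..} t *\<^sub>R (LINT p|lborel. F p * exp (- (c p * of_real t))))"
    unfolding eq using lborel_pair.integrable_snd[OF f] by simp
  have "(LINT t|lborel. LINT p|lborel. f p t) = (LINT p|lborel. LINT t|lborel. f p t)"
    by (rule lborel_pair.Fubini_integral[OF f])
  also have "\<dots> = (LINT p|lborel. F p / c p)"
  proof (rule Bochner_Integration.integral_cong[OF refl])
    show "(LINT t|lborel. f p t) = F p / c p" for p
      using complex_exp_halfline(2)[OF pos[of p]]
      by (cases "F p = 0") (auto simp: f_def simp del: mult_scaleR_right)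
  qed
  finally show "(LINT t|lborel. indicator {0<..} t *\<^sub>R (LINT p|lborel. F p * exp (- (c p * of_real t))))
       = (LINT p|lborel. F p / c p)" unfolding eq .
qed

lemma integrable_tensor:
  fixes x y :: "real \<Rightarrow> complex"
  assumes x: "integrable lborel x" and y: "integrable lborel y"
  shows "integrable lborel (\<lambda>p. x (fst p) * y (snd p))"
    and "(LINT p|lborel. x (fst p) * y (snd p)) = (LINT t|lborel. x t) * (LINT t|lborel. y t)"
proof -
  note [measurable] = borel_measurable_integrable[OF x] borel_measurable_integrable[OF y]
  have *: "integrable (lborel \<Otimes>\<^sub>M lborel) (\<lambda>(s, t). x s * y t)"
    by (rule lborel_pair.Fubini_integrable)
       (use x y in \<open>auto simp: norm_mult intro!: integrable_norm\<close>)
  then show "integrable lborel (\<lambda>p. x (fst p) * y (snd p))"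
    by (simp add: lborel_prod split_beta')
  have "(LINT p|(lborel \<Otimes>\<^sub>M lborel). x (fst p) * y (snd p)) = (LINT s|lborel. LINT t|lborel. x s * y t)"
    using lborel_pair.integral_fst'[OF *] by (simp add: split_beta')
  then show "(LINT p|lborel. x (fst p) * y (snd p)) = (LINT t|lborel. x t) * (LINT t|lborel. y t)"
    by (simp add: lborel_prod)
qed

definition FT :: "(real \<Rightarrow> complex) \<Rightarrow> real \<Rightarrow> complex" where
  "FT x t = (LINT \<xi>|lborel. x \<xi> * exp (\<i> * of_real (t * \<xi>)))"

lemma integrable_FT:
  assumes x: "integrable lborel x"
  shows "integrable lborel (\<lambda>\<xi>. x \<xi> * exp (\<i> * of_real (t * \<xi>)))"
proof (rule Bochner_Integration.integrable_bound[OF x])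
  note [measurable] = borel_measurable_integrable[OF x]
  show "(\<lambda>\<xi>. x \<xi> * exp (\<i> * of_real (t * \<xi>))) \<in> borel_measurable lborel" by measurable
qed (simp add: norm_mult)

lemma FT_measurable [measurable]:
  assumes x: "integrable lborel x"
  shows "FT x \<in> borel_measurable borel"
proof -
  note [measurable] = borel_measurable_integrable[OF x]
  show ?thesis unfolding FT_def by measurable
qed

lemma norm_FT_le:
  "cmod (FT x t) \<le> (LINT \<xi>|lborel. cmod (x \<xi>))"
  unfolding FT_def by (rule order_trans[OF integral_norm_bound]) (simp add: norm_mult)

lemma FT_cnj: "FT (\<lambda>\<xi>. cnj (x \<xi>)) t = cnj (FT x (- t))"
proof -
  have "cnj (FT x (- t)) = (LINT \<xi>|lborel. cnj (x \<xi> * exp (\<i> * of_real (- t * \<xi>))))"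
    unfolding FT_def by (rule Bochner_Integration.integral_cnj[symmetric])
  then show ?thesis by (simp add: FT_def exp_cnj)
qed

text \<open>The scalings serve two purposes. With a = b = 1 the denominator tends to -\<i> (\<xi> +
  \<eta>), which leads to the Carleman kernel; with a = -b = 1 or -1 the two results add up to a
  Poisson kernel, which leads to Plancherel.\<close>

lemma Laplace_FT_product:
  fixes x y :: "real \<Rightarrow> complex" and a b \<epsilon> :: real
  assumes x: "integrable lborel x" and y: "integrable lborel y" and \<epsilon>: "\<epsilon> > 0"
  shows "integrable lborel (\<lambda>t. indicator {0<..} t *\<^sub>R (exp (- (of_real \<epsilon> * of_real t)) * (FT x (a * t) * FT y (b * t))))"
    and "(LINT t|lborel. indicator {0<..} t *\<^sub>R (exp (- (of_real \<epsilon> * of_real t)) * (FT x (a * t) * FT y (b * t))))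
      = (LINT p|lborel. x (fst p) * y (snd p) / (of_real \<epsilon> - \<i> * of_real (a * fst p + b * snd p)))"
proof -
  define F where "F p = x (fst p) * y (snd p)" for p
  define c :: "real \<times> real \<Rightarrow> complex" where "c p = of_real \<epsilon> - \<i> * of_real (a * fst p + b * snd p)" for p
  note [measurable] = borel_measurable_integrable[OF x] borel_measurable_integrable[OF y]
  have F [measurable]: "F \<in> borel_measurable borel" unfolding F_def borel_prod[symmetric] by measurable
  have c [measurable]: "c \<in> borel_measurable borel" unfolding c_def borel_prod[symmetric] by measurable
  have int: "integrable lborel (\<lambda>p. cmod (F p) / Re (c p))"
    using integrable_tensor(1)[OF x y] by (auto simp: F_def c_def)
  have eq: "exp (- (of_real \<epsilon> * of_real t)) * (FT x (a * t) * FT y (b * t)) = (LINT p|lborel. F p * exp (- (c p * of_real t)))" for t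
  proof -
    have "exp (- (of_real \<epsilon> * of_real t)) * (FT x (a * t) * FT y (b * t))
       = exp (- (of_real \<epsilon> * of_real t)) * (LINT p|lborel. (x (fst p) * exp (\<i> * of_real (a * t * fst p))) * (y (snd p) * exp (\<i> * of_real (b * t * snd p))))"
      unfolding FT_def integrable_tensor(2)[OF integrable_FT[OF x] integrable_FT[OF y]] ..
    also have "\<dots> = (LINT p|lborel. exp (- (of_real \<epsilon> * of_real t)) * ((x (fst p) * exp (\<i> * of_real (a * t * fst p))) * (y (snd p) * exp (\<i> * of_real (b * t * snd p)))))"
      by simp
    also have "\<dots> = (LINT p|lborel. F p * exp (- (c p * of_real t)))"
      by (intro Bochner_Integration.integral_cong refl)
         (simp add: F_def c_def exp_add[symmetric] exp_diff algebra_simps)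
    finally show ?thesis .
  qed
  show "integrable lborel (\<lambda>t. indicator {0<..} t *\<^sub>R (exp (- (of_real \<epsilon> * of_real t)) * (FT x (a * t) * FT y (b * t))))"
    unfolding eq by (rule Laplace_Fubini(1)[OF F c _ int]) (simp add: c_def \<epsilon>)
  show "(LINT t|lborel. indicator {0<..} t *\<^sub>R (exp (- (of_real \<epsilon> * of_real t)) * (FT x (a * t) * FT y (b * t))))
      = (LINT p|lborel. x (fst p) * y (snd p) / (of_real \<epsilon> - \<i> * of_real (a * fst p + b * snd p)))"
    unfolding eq Laplace_Fubini(2)[OF F c _ int, unfolded c_def, simplified \<epsilon>, simplified]
    by (subst Laplace_Fubini(2)[OF F c _ int]) (simp_all add: c_def \<epsilon> F_def)
qed

section \<open>Plancherel inequality\<close>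

lemma nn_integral_Poisson_kernel:
  assumes \<epsilon>: "\<epsilon> > 0"
  shows "(\<integral>\<^sup>+\<eta>. ennreal (\<epsilon> / (\<epsilon>\<^sup>2 + (\<xi> - \<eta>)\<^sup>2)) \<partial>lborel) = ennreal pi"
proof -
  let ?F = "\<lambda>\<eta>. arctan ((\<eta> - \<xi>) / \<epsilon>)"
  have nz: "\<epsilon>\<^sup>2 + (\<xi> - \<eta>)\<^sup>2 > 0" for \<eta> using \<epsilon> by (simp add: add_pos_nonneg)
  have der: "(?F has_real_derivative \<epsilon> / (\<epsilon>\<^sup>2 + (\<xi> - \<eta>)\<^sup>2)) (at \<eta>)" for \<eta>
  proof -
    have "(?F has_real_derivative inverse (1 + ((\<eta> - \<xi>) / \<epsilon>)\<^sup>2) * (1 / \<epsilon>)) (at \<eta>)"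
      using \<epsilon> by (auto intro!: derivative_eq_intros)
    moreover have "inverse (1 + ((\<eta> - \<xi>) / \<epsilon>)\<^sup>2) * (1 / \<epsilon>) = \<epsilon> / (\<epsilon>\<^sup>2 + (\<xi> - \<eta>)\<^sup>2)"
    proof -
      have "1 + ((\<eta> - \<xi>) / \<epsilon>)\<^sup>2 = (\<epsilon>\<^sup>2 + (\<xi> - \<eta>)\<^sup>2) / \<epsilon>\<^sup>2"
        using \<epsilon> by (simp add: power_divide add_divide_distrib power2_commute)
      then show ?thesis using \<epsilon> by (simp add: power2_eq_square)
    qed
    ultimately show ?thesis by simp
  qed
  have lim: "(?F \<longlongrightarrow> pi / 2) at_top" "(?F \<longlongrightarrow> - (pi / 2)) at_bot"
  proof -
    have "filterlim (\<lambda>\<eta>. (1 / \<epsilon>) * (- \<xi> + \<eta>)) at_top at_top"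
      using \<epsilon> by (intro filterlim_tendsto_pos_mult_at_top[OF tendsto_const]
          filterlim_tendsto_add_at_top[OF tendsto_const] filterlim_ident) auto
    then have "((\<lambda>\<eta>. arctan ((1 / \<epsilon>) * (- \<xi> + \<eta>))) \<longlongrightarrow> pi / 2) at_top"
      by (rule filterlim_compose[OF tendsto_arctan_at_top])
    then show "(?F \<longlongrightarrow> pi / 2) at_top" by simp
    have "filterlim (\<lambda>\<eta>. (1 / \<epsilon>) * (\<xi> + \<eta>)) at_top at_top"
      using \<epsilon> by (intro filterlim_tendsto_pos_mult_at_top[OF tendsto_const]
          filterlim_tendsto_add_at_top[OF tendsto_const] filterlim_ident) auto
    then have "((\<lambda>\<eta>. - arctan ((1 / \<epsilon>) * (\<xi> + \<eta>))) \<longlongrightarrow> - (pi / 2)) at_top"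
      by (intro tendsto_minus filterlim_compose[OF tendsto_arctan_at_top])
    moreover have "- arctan ((1 / \<epsilon>) * (\<xi> + \<eta>)) = ?F (- \<eta>)" for \<eta>
    proof -
      have "(- \<eta> - \<xi>) / \<epsilon> = - ((1 / \<epsilon>) * (\<xi> + \<eta>))" using \<epsilon> by (simp add: field_simps)
      then show ?thesis by (simp only: arctan_minus)
    qed
    ultimately show "(?F \<longlongrightarrow> - (pi / 2)) at_bot"
      by (simp add: filterlim_at_bot_mirror)
  qed
  have "(\<integral>\<^sup>+\<eta>. ennreal (indicator (einterval (-\<infinity>) \<infinity>) \<eta> * (\<epsilon> / (\<epsilon>\<^sup>2 + (\<xi> - \<eta>)\<^sup>2))) \<partial>lborel) = ennreal (pi / 2 - (- (pi / 2)))"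
  proof (rule integral_FTC_nonneg(3)[where F = ?F])
    show "isCont (\<lambda>\<eta>. \<epsilon> / (\<epsilon>\<^sup>2 + (\<xi> - \<eta>)\<^sup>2)) \<eta>" for \<eta>
      using nz[of \<eta>] by (intro continuous_intros) auto
  qed (use \<epsilon> der lim in \<open>auto simp: ereal_tendsto_simps\<close>)
  then show ?thesis by simp
qed

text \<open>The antiderivative 2 arctan (sqrt (\<eta> / \<xi>)) depends on the ratio alone, hence a
  value independent of \<xi>. It is the Schur constant of the Carleman kernel; for \<xi> = 1 it also
  supplies the integrable majorant and the value at 0 of the symbol.\<close>

lemma Hilbert_kernel_integral:
  assumes \<xi>: "\<xi> > 0"
  shows "integrable lborel (\<lambda>\<eta>. indicator {0<..} \<eta> * (sqrt \<xi> / (sqrt \<eta> * (\<xi> + \<eta>))))"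
    and "(LINT \<eta>|lborel. indicator {0<..} \<eta> * (sqrt \<xi> / (sqrt \<eta> * (\<xi> + \<eta>)))) = pi"
    and "(\<integral>\<^sup>+\<eta>. ennreal (indicator {0<..} \<eta> * (sqrt \<xi> / (sqrt \<eta> * (\<xi> + \<eta>)))) \<partial>lborel) = ennreal pi"
proof -
  let ?F = "\<lambda>\<eta>. 2 * arctan (sqrt (\<eta> / \<xi>))"
  have der: "(?F has_real_derivative sqrt \<xi> / (sqrt \<eta> * (\<xi> + \<eta>))) (at \<eta>)" if \<eta>: "\<eta> > 0" for \<eta>
  proof -
    have "(?F has_real_derivative 2 * (inverse (1 + (sqrt (\<eta> / \<xi>))\<^sup>2) * ((inverse (sqrt (\<eta> / \<xi>)) / 2) * (1 / \<xi>)))) (at \<eta>)"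
      using \<xi> \<eta> by (auto intro!: derivative_eq_intros simp: divide_less_0_iff)
    moreover have "2 * (inverse (1 + (sqrt (\<eta> / \<xi>))\<^sup>2) * ((inverse (sqrt (\<eta> / \<xi>)) / 2) * (1 / \<xi>)))
        = sqrt \<xi> / (sqrt \<eta> * (\<xi> + \<eta>))"
    proof -
      define S where "S = \<xi> + \<eta>"
      have S: "S > 0" using \<xi> \<eta> by (simp add: S_def)
      have "1 + (sqrt (\<eta> / \<xi>))\<^sup>2 = S / \<xi>"
        using \<xi> \<eta> by (simp add: field_simps S_def)
      then show ?thesis using \<xi> \<eta> S by (simp add: real_sqrt_divide field_simps flip: S_def)
    qed
    ultimately show ?thesis by simp
  qed
  have lim: "(?F \<longlongrightarrow> pi) at_top" "(?F \<longlongrightarrow> 0) (at_right 0)"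
  proof -
    have "filterlim (\<lambda>\<eta>. (1 / \<xi>) * \<eta>) at_top at_top"
      using \<xi> by (intro filterlim_tendsto_pos_mult_at_top[OF tendsto_const] filterlim_ident) auto
    then have "filterlim (\<lambda>\<eta>. sqrt ((1 / \<xi>) * \<eta>)) at_top at_top"
      by (rule filterlim_compose[OF sqrt_at_top])
    then have "((\<lambda>\<eta>. arctan (sqrt ((1 / \<xi>) * \<eta>))) \<longlongrightarrow> pi / 2) at_top"
      by (rule filterlim_compose[OF tendsto_arctan_at_top])
    from tendsto_mult[OF tendsto_const[of 2] this] show "(?F \<longlongrightarrow> pi) at_top" by simp
    have "(?F \<longlongrightarrow> 2 * arctan (sqrt (0 / \<xi>))) (at_right 0)"
      using \<xi> by (intro tendsto_intros) auto
    then show "(?F \<longlongrightarrow> 0) (at_right 0)" by simp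
  qed
  have cont: "isCont (\<lambda>\<eta>. sqrt \<xi> / (sqrt \<eta> * (\<xi> + \<eta>))) \<eta>" if "\<eta> > 0" for \<eta>
    using that \<xi> by (intro continuous_intros) auto
  show "integrable lborel (\<lambda>\<eta>. indicator {0<..} \<eta> * (sqrt \<xi> / (sqrt \<eta> * (\<xi> + \<eta>))))"
    "(LINT \<eta>|lborel. indicator {0<..} \<eta> * (sqrt \<xi> / (sqrt \<eta> * (\<xi> + \<eta>)))) = pi"
    "(\<integral>\<^sup>+\<eta>. ennreal (indicator {0<..} \<eta> * (sqrt \<xi> / (sqrt \<eta> * (\<xi> + \<eta>)))) \<partial>lborel) = ennreal pi"
    using integral_FTC_nonneg[of "ereal 0" \<infinity> ?F "\<lambda>\<eta>. sqrt \<xi> / (sqrt \<eta> * (\<xi> + \<eta>))" 0 pi] \<xi> der lim cont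
    by (simp_all add: ereal_tendsto_simps)
qed

text \<open>This is the Schur test after the product of the two functions has been split into
  squares; the split, which carries the choice of weight, is left to the caller. It serves the
  Poisson kernel and the Hilbert kernel alike.\<close>

lemma nn_integral_Schur:
  fixes a b :: "real \<Rightarrow> real" and k l :: "real \<Rightarrow> real \<Rightarrow> real"
  assumes [measurable]: "a \<in> borel_measurable borel" "b \<in> borel_measurable borel"
      "case_prod k \<in> borel_measurable (borel \<Otimes>\<^sub>M borel)" "case_prod l \<in> borel_measurable (borel \<Otimes>\<^sub>M borel)"
    and nonneg: "\<And>s t. 0 \<le> k s t" "\<And>s t. 0 \<le> l s t"
    and k: "\<And>s. (\<integral>\<^sup>+t. ennreal (k s t) \<partial>lborel) \<le> ennreal C"
    and l: "\<And>t. (\<integral>\<^sup>+s. ennreal (l s t) \<partial>lborel) \<le> ennreal C"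
  shows "(\<integral>\<^sup>+p. ennreal ((a (fst p))\<^sup>2 * k (fst p) (snd p) + (b (snd p))\<^sup>2 * l (fst p) (snd p)) \<partial>lborel)
      \<le> ennreal C * ((\<integral>\<^sup>+s. ennreal ((a s)\<^sup>2) \<partial>lborel) + (\<integral>\<^sup>+t. ennreal ((b t)\<^sup>2) \<partial>lborel))"
proof -
  have [measurable]: "(\<lambda>p. k (fst p) (snd p)) \<in> borel_measurable (borel \<Otimes>\<^sub>M borel)"
    "(\<lambda>p. l (fst p) (snd p)) \<in> borel_measurable (borel \<Otimes>\<^sub>M borel)"
    using assms(3,4) by (simp_all add: split_beta')
  have "(\<integral>\<^sup>+p. ennreal ((a (fst p))\<^sup>2 * k (fst p) (snd p) + (b (snd p))\<^sup>2 * l (fst p) (snd p)) \<partial>lborel)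
     = (\<integral>\<^sup>+p. ennreal ((a (fst p))\<^sup>2) * ennreal (k (fst p) (snd p)) \<partial>(lborel \<Otimes>\<^sub>M lborel))
      + (\<integral>\<^sup>+p. ennreal ((b (snd p))\<^sup>2) * ennreal (l (fst p) (snd p)) \<partial>(lborel \<Otimes>\<^sub>M lborel))"
    unfolding lborel_prod[symmetric]
    by (subst nn_integral_add[symmetric]) (auto simp: ennreal_mult nonneg intro!: nn_integral_cong)
  also have "(\<integral>\<^sup>+p. ennreal ((a (fst p))\<^sup>2) * ennreal (k (fst p) (snd p)) \<partial>(lborel \<Otimes>\<^sub>M lborel))
      = (\<integral>\<^sup>+s. ennreal ((a s)\<^sup>2) * (\<integral>\<^sup>+t. ennreal (k s t) \<partial>lborel) \<partial>lborel)"
    by (subst lborel.nn_integral_fst[symmetric]) (auto simp: nn_integral_cmult)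
  also have "\<dots> \<le> (\<integral>\<^sup>+s. ennreal ((a s)\<^sup>2) * ennreal C \<partial>lborel)"
    by (intro nn_integral_mono mult_left_mono k) auto
  also have "\<dots> = ennreal C * (\<integral>\<^sup>+s. ennreal ((a s)\<^sup>2) \<partial>lborel)"
    by (subst mult.commute, rule nn_integral_cmult) measurable
  also have "(\<integral>\<^sup>+p. ennreal ((b (snd p))\<^sup>2) * ennreal (l (fst p) (snd p)) \<partial>(lborel \<Otimes>\<^sub>M lborel))
      = (\<integral>\<^sup>+t. ennreal ((b t)\<^sup>2) * (\<integral>\<^sup>+s. ennreal (l s t) \<partial>lborel) \<partial>lborel)"
    by (subst lborel_pair.nn_integral_snd[symmetric]) (auto simp: nn_integral_cmult split_beta')
  also have "\<dots> \<le> (\<integral>\<^sup>+t. ennreal ((b t)\<^sup>2) * ennreal C \<partial>lborel)"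
    by (intro nn_integral_mono mult_left_mono l) auto
  also have "\<dots> = ennreal C * (\<integral>\<^sup>+t. ennreal ((b t)\<^sup>2) \<partial>lborel)"
    by (subst mult.commute, rule nn_integral_cmult) measurable
  finally show ?thesis by (simp add: distrib_left add_mono add_left_mono)
qed

lemma Poisson_sum:
  fixes \<epsilon> u :: real
  assumes "\<epsilon> > 0"
  shows "1 / (of_real \<epsilon> - \<i> * of_real u) + 1 / (of_real \<epsilon> + \<i> * of_real u)
    = (of_real (2 * (\<epsilon> / (\<epsilon>\<^sup>2 + u\<^sup>2))) :: complex)"
proof -
  have nz: "of_real \<epsilon> - \<i> * of_real u \<noteq> 0" "of_real \<epsilon> + \<i> * of_real u \<noteq> 0"
    using assms by (auto simp: complex_eq_iff)
  have "(of_real \<epsilon> - \<i> * of_real u) * (of_real \<epsilon> + \<i> * of_real u) = (of_real (\<epsilon>\<^sup>2 + u\<^sup>2) :: complex)"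
    by (simp add: algebra_simps power2_eq_square)
  then show ?thesis using nz by (simp add: add_frac_eq)
qed

text \<open>The damped integral of |FT x|^2 over t > 0 has the kernel 1 / (\<epsilon> - \<i> (\<xi>
  - \<eta>)), which is not absolutely integrable in \<eta>. Adding the mirror integral over t < 0,
  which is nonnegative, replaces it by twice the Poisson kernel of mass pi, to which the Schur test
  applies. Here \<open>G s\<close> with s = 1 and s = -1 are the two halves.\<close>

lemma Plancherel_regularised:
  fixes x :: "real \<Rightarrow> complex"
  assumes x: "integrable lborel x" and x2: "integrable lborel (\<lambda>t. (cmod (x t))\<^sup>2)" and \<epsilon>: "\<epsilon> > 0"
  shows "integrable lborel (\<lambda>t. indicator {0<..} t * (exp (- (\<epsilon> * t)) * (cmod (FT x t))\<^sup>2))"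
    and "(LINT t|lborel. indicator {0<..} t * (exp (- (\<epsilon> * t)) * (cmod (FT x t))\<^sup>2)) \<le> 2 * pi * (LINT t|lborel. (cmod (x t))\<^sup>2)"
proof -
  note [measurable] = borel_measurable_integrable[OF x]
  define y where "y t = cnj (x t)" for t
  have y: "integrable lborel y" using x by (simp add: y_def[abs_def])
  have FTy: "FT y (- t) = cnj (FT x t)" "FT y t = cnj (FT x (- t))" for t
    by (simp_all add: y_def[abs_def] FT_cnj)
  define G where "G s t = indicator {0<..} t * (exp (- (\<epsilon> * t)) * (cmod (FT x (s * t)))\<^sup>2)" for s t :: real
  define N where "N s p = x (fst p) * y (snd p) / (of_real \<epsilon> - \<i> * of_real (s * fst p + (- s) * snd p))" for s p
  have eq: "indicator {0<..} t *\<^sub>R (exp (- (of_real \<epsilon> * of_real t)) * (FT x (s * t) * FT y ((- s) * t))) = of_real (G s t)"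
    for s t
  proof -
    have "FT x (s * t) * FT y ((- s) * t) = of_real ((cmod (FT x (s * t)))\<^sup>2)"
      using FTy(1)[of "s * t"] by (simp only: complex_norm_square minus_mult_left[symmetric])
    moreover have "exp (- (of_real \<epsilon> * of_real t)) = complex_of_real (exp (- (\<epsilon> * t)))"
      by (simp only: exp_of_real[symmetric] of_real_minus of_real_mult)
    ultimately show ?thesis by (simp add: G_def scaleR_conv_of_real)
  qed
  have G: "integrable lborel (G s)" "of_real (LINT t|lborel. G s t) = (LINT p|lborel. N s p)" for s
  proof -
    have 1: "integrable lborel (\<lambda>t. complex_of_real (G s t))"
      using Laplace_FT_product(1)[OF x y \<epsilon>, of s "- s"] unfolding eq .
    then show "integrable lborel (G s)" by (simp add: complex_of_real_integrable_eq)
    show "of_real (LINT t|lborel. G s t) = (LINT p|lborel. N s p)"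
      using Laplace_FT_product(2)[OF x y \<epsilon>, of s "- s"] unfolding eq N_def
      by (simp only: integral_complex_of_real)
  qed
  have N_meas [measurable]: "N s \<in> borel_measurable borel" for s
    unfolding N_def y_def borel_prod[symmetric] by measurable
  have N: "integrable lborel (N s)" for s
  proof (rule Bochner_Integration.integrable_bound)
    show "integrable lborel (\<lambda>p. x (fst p) * y (snd p) / of_real \<epsilon>)"
      using integrable_tensor(1)[OF x y] by simp
    have "\<epsilon> \<le> cmod (of_real \<epsilon> - \<i> * of_real u)" for u
      using abs_Re_le_cmod[of "of_real \<epsilon> - \<i> * of_real u"] \<epsilon> by simp
    then show "AE p in lborel. norm (N s p) \<le> norm (x (fst p) * y (snd p) / of_real \<epsilon>)"
    proof (intro AE_I2)
      fix p
      let ?d = "of_real \<epsilon> - \<i> * of_real (s * fst p + (- s) * snd p)"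
      have "\<epsilon> \<le> cmod ?d" by fact
      then have "cmod (x (fst p) * y (snd p)) / cmod ?d \<le> cmod (x (fst p) * y (snd p)) / \<epsilon>"
        using \<epsilon> by (intro divide_left_mono mult_pos_pos) (simp_all del: of_real_add of_real_mult)
      then show "norm (N s p) \<le> norm (x (fst p) * y (snd p) / of_real \<epsilon>)"
        unfolding N_def norm_divide norm_of_real using \<epsilon> by simp
    qed
  qed simp
  have sum: "N 1 p + N (-1) p = x (fst p) * y (snd p) * of_real (2 * (\<epsilon> / (\<epsilon>\<^sup>2 + (fst p - snd p)\<^sup>2)))" for p
    using arg_cong[OF Poisson_sum[OF \<epsilon>, of "fst p - snd p"], of "\<lambda>z. x (fst p) * y (snd p) * z"]
    by (simp add: N_def distrib_left algebra_simps)
  have "(LINT t|lborel. G 1 t) \<le> (LINT t|lborel. G 1 t) + (LINT t|lborel. G (-1) t)"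
    by (simp add: G_def)
  also have "\<dots> \<le> cmod (of_real ((LINT t|lborel. G 1 t) + (LINT t|lborel. G (-1) t)))"
    unfolding norm_of_real by (rule abs_ge_self)
  also have "of_real ((LINT t|lborel. G 1 t) + (LINT t|lborel. G (-1) t)) = (LINT p|lborel. N 1 p + N (-1) p)"
    using N by (simp add: G)
  finally have "ennreal (LINT t|lborel. G 1 t) \<le> ennreal (cmod (LINT p|lborel. N 1 p + N (-1) p))"
    by (rule ennreal_leI)
  also have "\<dots> \<le> (\<integral>\<^sup>+p. norm (N 1 p + N (-1) p) \<partial>lborel)"
    by (rule integral_norm_bound_ennreal) (use N in simp)
  also have "\<dots> \<le> (\<integral>\<^sup>+p. ennreal ((cmod (x (fst p)))\<^sup>2 * (\<epsilon> / (\<epsilon>\<^sup>2 + (fst p - snd p)\<^sup>2))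
      + (cmod (x (snd p)))\<^sup>2 * (\<epsilon> / (\<epsilon>\<^sup>2 + (fst p - snd p)\<^sup>2))) \<partial>lborel)"
  proof (intro nn_integral_mono ennreal_leI)
    fix p :: "real \<times> real"
    have "0 \<le> \<epsilon> / (\<epsilon>\<^sup>2 + (fst p - snd p)\<^sup>2)" using \<epsilon> by simp
    from mult_right_mono[OF sum_squares_bound[of "cmod (x (fst p))" "cmod (x (snd p))"] this] 
    show "norm (N 1 p + N (-1) p) \<le> (cmod (x (fst p)))\<^sup>2 * (\<epsilon> / (\<epsilon>\<^sup>2 + (fst p - snd p)\<^sup>2))
      + (cmod (x (snd p)))\<^sup>2 * (\<epsilon> / (\<epsilon>\<^sup>2 + (fst p - snd p)\<^sup>2))"
      unfolding sum norm_mult norm_of_real using \<epsilon> by (simp add: y_def algebra_simps add_divide_distrib)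
  qed
  also have "\<dots> \<le> ennreal pi * ((\<integral>\<^sup>+s. ennreal ((cmod (x s))\<^sup>2) \<partial>lborel) + (\<integral>\<^sup>+t. ennreal ((cmod (x t))\<^sup>2) \<partial>lborel))"
    using \<epsilon> nn_integral_Poisson_kernel[OF \<epsilon>]
    by (intro nn_integral_Schur[where k = "\<lambda>s t. \<epsilon> / (\<epsilon>\<^sup>2 + (s - t)\<^sup>2)" and l = "\<lambda>s t. \<epsilon> / (\<epsilon>\<^sup>2 + (s - t)\<^sup>2)"])
       (auto simp: power2_commute)
  also have "\<dots> = ennreal (2 * pi * (LINT t|lborel. (cmod (x t))\<^sup>2))"
    using x2 by (simp add: nn_integral_eq_integral ennreal_mult[symmetric] ennreal_plus[symmetric] del: ennreal_plus)
  finally have "(LINT t|lborel. G 1 t) \<le> 2 * pi * (LINT t|lborel. (cmod (x t))\<^sup>2)"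
    by (subst (asm) ennreal_le_iff) auto
  then show "(LINT t|lborel. indicator {0<..} t * (exp (- (\<epsilon> * t)) * (cmod (FT x t))\<^sup>2)) \<le> 2 * pi * (LINT t|lborel. (cmod (x t))\<^sup>2)"
    by (simp add: G_def)
  show "integrable lborel (\<lambda>t. indicator {0<..} t * (exp (- (\<epsilon> * t)) * (cmod (FT x t))\<^sup>2))"
    using G(1)[of 1] by (simp add: G_def[abs_def])
qed

text \<open>The damped bound is uniform in \<epsilon>, so Fatou removes the damping.\<close>

lemma Plancherel_le:
  fixes x :: "real \<Rightarrow> complex"
  assumes x: "integrable lborel x" and x2: "integrable lborel (\<lambda>t. (cmod (x t))\<^sup>2)"
  shows "(\<integral>\<^sup>+t. ennreal (indicator {0<..} t * (cmod (FT x t))\<^sup>2) \<partial>lborel) \<le> ennreal (2 * pi * (LINT t|lborel. (cmod (x t))\<^sup>2))"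
proof -
  note [measurable] = borel_measurable_integrable[OF x] FT_measurable[OF x]
  define e where "e n = 1 / real (Suc n)" for n
  have e: "e n > 0" "e \<longlonglongrightarrow> 0" for n
    using LIMSEQ_inverse_real_of_nat by (simp_all add: e_def[abs_def] inverse_eq_divide)
  have "(\<integral>\<^sup>+t. ennreal (indicator {0<..} t * (cmod (FT x t))\<^sup>2) \<partial>lborel)
     = (\<integral>\<^sup>+t. liminf (\<lambda>n. ennreal (indicator {0<..} t * (exp (- (e n * t)) * (cmod (FT x t))\<^sup>2))) \<partial>lborel)"
  proof (rule nn_integral_cong)
    fix t
    have "(\<lambda>n. ennreal (indicator {0<..} t * (exp (- (e n * t)) * (cmod (FT x t))\<^sup>2)))
       \<longlonglongrightarrow> ennreal (indicator {0<..} t * (exp (- (0 * t)) * (cmod (FT x t))\<^sup>2))"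
      by (intro tendsto_intros e)
    from lim_imp_Liminf[OF sequentially_bot this]
    show "ennreal (indicator {0<..} t * (cmod (FT x t))\<^sup>2) = liminf (\<lambda>n. ennreal (indicator {0<..} t * (exp (- (e n * t)) * (cmod (FT x t))\<^sup>2)))"
      by simp
  qed
  also have "\<dots> \<le> liminf (\<lambda>n. \<integral>\<^sup>+t. ennreal (indicator {0<..} t * (exp (- (e n * t)) * (cmod (FT x t))\<^sup>2)) \<partial>lborel)"
    by (rule nn_integral_liminf) measurable
  also have "\<dots> \<le> ennreal (2 * pi * (LINT t|lborel. (cmod (x t))\<^sup>2))"
  proof (rule Liminf_le[OF _ always_eventually], simp, rule allI)
    fix n
    show "(\<integral>\<^sup>+t. ennreal (indicator {0<..} t * (exp (- (e n * t)) * (cmod (FT x t))\<^sup>2)) \<partial>lborel)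
        \<le> ennreal (2 * pi * (LINT t|lborel. (cmod (x t))\<^sup>2))"
      using Plancherel_regularised[OF x x2 e(1)[of n]]
      by (subst nn_integral_eq_integral) (auto intro: ennreal_leI)
  qed
  finally show ?thesis .
qed

section \<open>Hilbert's inequality and the Carleman form\<close>

text \<open>The bound is half the sum of squares rather than the product of the norms, because that
  is what the Schur test gives directly. It is applied to x and its conjugate, whose norms agree,
  and then reads pi times the squared norm.\<close>

lemma Hilbert_inequality:
  assumes x: "x \<in> L2plus" and y: "y \<in> L2plus"
  shows "integrable lborel (\<lambda>p. x (fst p) * y (snd p) / of_real (fst p + snd p))"
    and "cmod (LINT p|lborel. x (fst p) * y (snd p) / of_real (fst p + snd p))
      \<le> pi / 2 * ((L2norm x)\<^sup>2 + (L2norm y)\<^sup>2)"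
proof -
  note [measurable] = L2plus_D(1)[OF x] L2plus_D(1)[OF y]
  define f where "f p = x (fst p) * y (snd p) / of_real (fst p + snd p)" for p
  define k where "k s t = indicator {0<..} s * (indicator {0<..} t * (sqrt s / (sqrt t * (s + t))))" for s t :: real
  have k0: "0 \<le> k s t" for s t by (simp add: k_def indicator_def)
  have k: "(\<integral>\<^sup>+t. ennreal (k s t) \<partial>lborel) \<le> ennreal pi" for s
    using Hilbert_kernel_integral(3)[of s] by (cases "s > 0") (auto simp: k_def)
  have f_meas [measurable]: "f \<in> borel_measurable borel"
    unfolding f_def borel_prod[symmetric] by measurable
  have f_le: "2 * cmod (f p) \<le> (cmod (x (fst p)))\<^sup>2 * k (fst p) (snd p) + (cmod (y (snd p)))\<^sup>2 * k (snd p) (fst p)" for p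
  proof (cases "fst p > 0 \<and> snd p > 0")
    case True
    define s t where "s = sqrt (fst p)" and "t = sqrt (snd p)"
    define S where "S = fst p + snd p"
    have pos: "s > 0" "t > 0" "S > 0" using True by (auto simp: s_def t_def S_def)
    define a b where "a = cmod (x (fst p))" and "b = cmod (y (snd p))"
    \<comment> \<open>The weight enters here: after division by s t the product of moduli is split
      with the factors sqrt (\<xi> / \<eta>) and sqrt (\<eta> / \<xi>), which match \<open>k\<close>
      and its transpose.\<close>
    have "0 \<le> (a * s - b * t)\<^sup>2" by simp
    then have "2 * (a * b) * (s * t) \<le> (a * s)\<^sup>2 + (b * t)\<^sup>2"
      by (simp add: power2_diff algebra_simps)
    then have "2 * (a * b) \<le> ((a * s)\<^sup>2 + (b * t)\<^sup>2) / (s * t)"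
      using pos by (simp add: pos_le_divide_eq)
    also have "\<dots> = a\<^sup>2 * (s / t) + b\<^sup>2 * (t / s)"
      using pos by (simp add: field_simps power2_eq_square)
    finally have "2 * (a * b) / S \<le> (a\<^sup>2 * (s / t) + b\<^sup>2 * (t / s)) / S"
      using pos by (intro divide_right_mono) auto
    also have "\<dots> = a\<^sup>2 * (s / (t * S)) + b\<^sup>2 * (t / (s * S))"
      by (simp add: add_divide_distrib)
    finally have "2 * (a * b) / S \<le> a\<^sup>2 * (s / (t * S)) + b\<^sup>2 * (t / (s * S))" .
    moreover have "2 * cmod (f p) = 2 * (a * b) / S"
      using True by (simp add: f_def a_def b_def S_def norm_mult norm_divide del: of_real_add)
    moreover have "k (fst p) (snd p) = s / (t * S)" "k (snd p) (fst p) = t / (s * S)"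
      using True by (auto simp: k_def s_def t_def S_def add.commute)
    ultimately show ?thesis by (simp add: a_def b_def)
  next
    case False
    then have "f p = 0" using L2plus_D(2)[OF x] L2plus_D(2)[OF y] by (auto simp: f_def not_less)
    then show ?thesis using k0 by simp
  qed
  have "(\<integral>\<^sup>+p. ennreal (2 * cmod (f p)) \<partial>lborel)
     \<le> (\<integral>\<^sup>+p. ennreal ((cmod (x (fst p)))\<^sup>2 * k (fst p) (snd p) + (cmod (y (snd p)))\<^sup>2 * k (snd p) (fst p)) \<partial>lborel)"
    by (intro nn_integral_mono ennreal_leI f_le)
  also have "\<dots> \<le> ennreal pi * ((\<integral>\<^sup>+s. ennreal ((cmod (x s))\<^sup>2) \<partial>lborel) + (\<integral>\<^sup>+t. ennreal ((cmod (y t))\<^sup>2) \<partial>lborel))"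
    using k k0
    by (intro nn_integral_Schur[where k = k and l = "\<lambda>s t. k t s"]) (auto simp: k_def[abs_def])
  also have "\<dots> = ennreal (pi * ((L2norm x)\<^sup>2 + (L2norm y)\<^sup>2))"
    by (simp add: nn_integral_L2norm x y norm_cls ennreal_mult[symmetric] ennreal_plus[symmetric] del: ennreal_plus)
  finally have *: "(\<integral>\<^sup>+p. ennreal (2 * cmod (f p)) \<partial>lborel) \<le> ennreal (pi * ((L2norm x)\<^sup>2 + (L2norm y)\<^sup>2))" .
  have int2: "integrable lborel (\<lambda>p. 2 * cmod (f p))"
    by (rule integrableI_nonneg) (use * in \<open>auto intro: le_less_trans\<close>)
  then have "integrable lborel f"
    by (intro integrable_norm_cancel[of _ f]) auto
  then show "integrable lborel (\<lambda>p. x (fst p) * y (snd p) / of_real (fst p + snd p))"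
    by (simp add: f_def[abs_def])
  have "2 * cmod (LINT p|lborel. f p) \<le> 2 * (LINT p|lborel. cmod (f p))"
    by (intro mult_left_mono integral_norm_bound) auto
  also have "\<dots> = (LINT p|lborel. 2 * cmod (f p))" by simp
  also have "\<dots> \<le> pi * ((L2norm x)\<^sup>2 + (L2norm y)\<^sup>2)"
    using * nn_integral_eq_integral[OF int2] by (simp add: ennreal_le_iff)
  finally show "cmod (LINT p|lborel. x (fst p) * y (snd p) / of_real (fst p + snd p))
      \<le> pi / 2 * ((L2norm x)\<^sup>2 + (L2norm y)\<^sup>2)"
    by (simp add: f_def[abs_def])
qed

text \<open>The operator on integrable functions, where the Fourier integral converges absolutely;
  the extension to the whole space is \<open>FRop\<close>.\<close>

definition FRint :: "(real \<Rightarrow> complex) \<Rightarrow> real \<Rightarrow> complex" where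
  "FRint x t = of_real (indicator {0<..} t / sqrt (2 * pi)) * FT x t"

lemma FRint_L2plus:
  assumes x: "x \<in> L2plus" and x1: "integrable lborel x"
  shows "FRint x \<in> L2plus" "norm (cls (FRint x)) \<le> norm (cls x)"
proof -
  note [measurable] = FT_measurable[OF x1]
  have m: "FRint x \<in> borel_measurable borel" unfolding FRint_def[abs_def] by measurable
  have "(cmod (FRint x t))\<^sup>2 = 1 / (2 * pi) * (indicator {0<..} t * (cmod (FT x t))\<^sup>2)" for t
    by (simp add: FRint_def norm_mult norm_divide power_mult_distrib power_divide indicator_def)
  then have "ennreal ((cmod (FRint x t))\<^sup>2)
      = ennreal (1 / (2 * pi)) * ennreal (indicator {0<..} t * (cmod (FT x t))\<^sup>2)" for t
    by (simp only:) (rule ennreal_mult, auto)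
  then have "(\<integral>\<^sup>+t. ennreal ((cmod (FRint x t))\<^sup>2) \<partial>lborel)
    = (\<integral>\<^sup>+t. ennreal (1 / (2 * pi)) * ennreal (indicator {0<..} t * (cmod (FT x t))\<^sup>2) \<partial>lborel)"
    by (simp only:)
  also have "\<dots> = ennreal (1 / (2 * pi)) * (\<integral>\<^sup>+t. ennreal (indicator {0<..} t * (cmod (FT x t))\<^sup>2) \<partial>lborel)"
    by (rule nn_integral_cmult) measurable
  also have "\<dots> \<le> ennreal (1 / (2 * pi)) * ennreal (2 * pi * (LINT t|lborel. (cmod (x t))\<^sup>2))"
    by (intro mult_left_mono Plancherel_le x1 L2plus_D(3)[OF x]) auto
  also have "\<dots> = ennreal ((norm (cls x))\<^sup>2)"
    by (simp add: ennreal_mult[symmetric] norm_cls[OF x] L2norm_def)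
  finally have le: "(\<integral>\<^sup>+t. ennreal ((cmod (FRint x t))\<^sup>2) \<partial>lborel) \<le> ennreal ((norm (cls x))\<^sup>2)" .
  show "FRint x \<in> L2plus" "norm (cls (FRint x)) \<le> norm (cls x)"
    by (rule L2plus_nn_integral_bound[OF m _ le]; simp add: FRint_def)+
qed

text \<open>This bound from L1 to the supremum norm keeps <T g, g> bounded along the Weyl sequence,
  whose L1 norms stay bounded. The factor 1 / sqrt (2 * pi) is simply estimated by 1.\<close>

lemma norm_FRint_le: "cmod (FRint x t) \<le> (LINT \<xi>|lborel. cmod (x \<xi>))"
proof -
  have "1 \<le> sqrt (2 * pi)" using pi_ge_two by (intro real_le_rsqrt) simp
  then have "indicator {0<..} t / sqrt (2 * pi) \<le> (1::real)" by (simp add: indicator_def)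
  then have "cmod (FRint x t) \<le> 1 * cmod (FT x t)"
    unfolding FRint_def norm_mult norm_of_real by (intro mult_right_mono) auto
  then show ?thesis using norm_FT_le[of x t] by simp
qed

text \<open>No conjugate appears on either side: the kernel exp (\<i> t \<xi>) is symmetric but not
  Hermitian, so the operator equals its transpose, not its adjoint.\<close>

lemma FRint_symmetric:
  assumes x: "x \<in> L2plus" and x1: "integrable lborel x" and y: "y \<in> L2plus" and y1: "integrable lborel y"
  shows "(LINT t|lborel. FRint x t * y t) = (LINT t|lborel. x t * FRint y t)"
proof -
  define c where "c = complex_of_real (1 / sqrt (2 * pi))"
  note [measurable] = L2plus_D(1)[OF x] L2plus_D(1)[OF y]
  define f where "f s t = x s * y t * exp (\<i> * of_real (t * s))" for s t
  have "integrable (lborel \<Otimes>\<^sub>M lborel) (case_prod f)"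
  proof (rule Bochner_Integration.integrable_bound)
    show "integrable (lborel \<Otimes>\<^sub>M lborel) (\<lambda>p. x (fst p) * y (snd p))"
      unfolding lborel_prod by (rule integrable_tensor(1)[OF x1 y1])
    show "case_prod f \<in> borel_measurable (lborel \<Otimes>\<^sub>M lborel)"
      unfolding f_def split_beta' by measurable
  qed (simp add: f_def norm_mult split_beta')
  then have "(LINT t|lborel. LINT s|lborel. f s t) = (LINT s|lborel. LINT t|lborel. f s t)"
    by (rule lborel_pair.Fubini_integral)
  moreover have "FRint x t * y t = c * (LINT s|lborel. f s t)" for t
  proof -
    have "(LINT s|lborel. f s t) = (LINT s|lborel. x s * exp (\<i> * of_real (t * s)) * y t)"
      by (simp add: f_def mult_ac)
    also have "\<dots> = FT x t * y t" unfolding FT_def by (rule integral_mult_left_zero)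
    finally show ?thesis using L2plus_D(2)[OF y, of t]
      by (cases "t > 0") (auto simp: FRint_def c_def)
  qed
  moreover have "x s * FRint y s = c * (LINT t|lborel. f s t)" for s
  proof -
    have "(LINT t|lborel. f s t) = (LINT t|lborel. x s * (y t * exp (\<i> * of_real (s * t))))"
      by (simp add: f_def mult_ac)
    also have "\<dots> = x s * FT y s" unfolding FT_def by (rule integral_mult_right_zero)
    finally show ?thesis using L2plus_D(2)[OF x, of s]
      by (cases "s > 0") (auto simp: FRint_def c_def)
  qed
  ultimately show ?thesis by simp
qed

text \<open>The damping factor makes Fubini available and is then removed on both sides by dominated
  convergence. On the left the majorant is the product of two square-integrable functions, on the
  right it is the Hilbert kernel, and the damped kernel tends to 1 / (-\<i> (\<xi> + \<eta>)), the
  source of the factor \<i>.\<close>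

lemma FRint_form:
  assumes x: "x \<in> L2plus" and x1: "integrable lborel x" and y: "y \<in> L2plus" and y1: "integrable lborel y"
  shows "(LINT t|lborel. FRint x t * FRint y t)
    = \<i> / (2 * of_real pi) * (LINT p|lborel. x (fst p) * y (snd p) / of_real (fst p + snd p))"
proof -
  note [measurable] = L2plus_D(1)[OF x] L2plus_D(1)[OF y]
  have [measurable]: "FRint x \<in> borel_measurable borel" "FRint y \<in> borel_measurable borel"
    using FRint_L2plus[OF x x1] FRint_L2plus[OF y y1] by (auto simp: L2plus_D)
  define e where "e n = 1 / real (Suc n)" for n
  have e: "e n > 0" "e \<longlonglongrightarrow> 0" for n
    using LIMSEQ_inverse_real_of_nat by (simp_all add: e_def[abs_def] inverse_eq_divide)
  define c where "c = complex_of_real (1 / (2 * pi))"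
  define N where "N n p = x (fst p) * y (snd p) / (of_real (e n) - \<i> * of_real (fst p + snd p))" for n p
  define h where "h p = x (fst p) * y (snd p) / of_real (fst p + snd p)" for p
  have eq: "(LINT t|lborel. of_real (exp (- (e n * t))) * (FRint x t * FRint y t)) = c * (LINT p|lborel. N n p)" for n
  proof -
    have "of_real (exp (- (e n * t))) * (FRint x t * FRint y t)
      = c * (indicator {0<..} t *\<^sub>R (exp (- (of_real (e n) * of_real t)) * (FT x (1 * t) * FT y (1 * t))))" for t
    proof -
      have "complex_of_real (sqrt (2 * pi)) * complex_of_real (sqrt (2 * pi)) = of_real (2 * pi)"
        unfolding of_real_mult[symmetric] by (subst real_sqrt_mult_self) simp
      then have "FRint x t * FRint y t = c * (indicator {0<..} t *\<^sub>R (FT x t * FT y t))"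
        by (auto simp: FRint_def c_def indicator_def)
      moreover have "exp (- (of_real (e n) * of_real t)) = complex_of_real (exp (- (e n * t)))"
        by (simp only: exp_of_real[symmetric] of_real_minus of_real_mult)
      ultimately show ?thesis by (simp add: mult_ac)
    qed
    then have "(LINT t|lborel. of_real (exp (- (e n * t))) * (FRint x t * FRint y t))
       = c * (LINT t|lborel. indicator {0<..} t *\<^sub>R (exp (- (of_real (e n) * of_real t)) * (FT x (1 * t) * FT y (1 * t))))"
      by (simp only: integral_mult_right_zero)
    then show ?thesis unfolding Laplace_FT_product(2)[OF x1 y1 e(1)] N_def by simp
  qed
  have "(\<lambda>n. LINT t|lborel. of_real (exp (- (e n * t))) * (FRint x t * FRint y t)) \<longlonglongrightarrow> (LINT t|lborel. FRint x t * FRint y t)"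
  proof (rule integral_dominated_convergence)
    show "integrable lborel (\<lambda>t. norm (FRint x t * FRint y t))"
      by (intro integrable_norm L2plus_mult_integrable FRint_L2plus x x1 y y1)
    have "(\<lambda>n. of_real (exp (- (e n * t))) * (FRint x t * FRint y t)) \<longlonglongrightarrow> of_real (exp (- (0 * t))) * (FRint x t * FRint y t)" for t
      by (intro tendsto_intros e)
    then show "AE t in lborel. (\<lambda>n. of_real (exp (- (e n * t))) * (FRint x t * FRint y t)) \<longlonglongrightarrow> FRint x t * FRint y t" by simp
    show "AE t in lborel. norm (of_real (exp (- (e n * t))) * (FRint x t * FRint y t)) \<le> norm (FRint x t * FRint y t)" for n
    proof (rule AE_I2)
      fix t
      show "norm (of_real (exp (- (e n * t))) * (FRint x t * FRint y t)) \<le> norm (FRint x t * FRint y t)"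
      proof (cases "t > 0")
        case True
        then show ?thesis using e(1)[of n] unfolding norm_mult[of "of_real _"] norm_of_real
          by (intro mult_left_le_one_le) (auto simp: less_imp_le)
      qed (simp add: FRint_def)
    qed
  qed measurable
  moreover have "(\<lambda>n. LINT p|lborel. N n p) \<longlonglongrightarrow> (LINT p|lborel. \<i> * h p)"
  proof (rule integral_dominated_convergence)
    show "integrable lborel (\<lambda>p. norm (h p))"
      unfolding h_def by (intro integrable_norm Hilbert_inequality x y)
    show "(\<lambda>p. \<i> * h p) \<in> borel_measurable lborel" "N n \<in> borel_measurable lborel" for n
      unfolding h_def N_def lborel_prod[symmetric] by measurable
    show "AE p in lborel. (\<lambda>n. N n p) \<longlonglongrightarrow> \<i> * h p"
    proof (rule AE_I2)
      fix p :: "real \<times> real"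
      show "(\<lambda>n. N n p) \<longlonglongrightarrow> \<i> * h p"
      proof (cases "fst p > 0 \<and> snd p > 0")
        case True
        then have "of_real (fst p + snd p) \<noteq> (0::complex)" unfolding of_real_eq_0_iff by simp
        then have "(\<lambda>n. N n p) \<longlonglongrightarrow> x (fst p) * y (snd p) / (of_real 0 - \<i> * of_real (fst p + snd p))"
          unfolding N_def by (intro tendsto_intros e) (auto simp del: of_real_add)
        moreover have "x (fst p) * y (snd p) / (of_real 0 - \<i> * of_real (fst p + snd p)) = \<i> * h p"
          using \<open>of_real (fst p + snd p) \<noteq> (0::complex)\<close> by (simp add: h_def field_simps del: of_real_add)
        ultimately show ?thesis by simp
      next
        case False
        then have "x (fst p) * y (snd p) = 0" using L2plus_D(2)[OF x] L2plus_D(2)[OF y] by (auto simp: not_less)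
        then show ?thesis by (auto simp: N_def h_def)
      qed
    qed
    show "AE p in lborel. norm (N n p) \<le> norm (h p)" for n
    proof (rule AE_I2)
      fix p :: "real \<times> real"
      show "norm (N n p) \<le> norm (h p)"
      proof (cases "fst p > 0 \<and> snd p > 0")
        case True
        let ?d = "of_real (e n) - \<i> * of_real (fst p + snd p)"
        \<comment> \<open>The modulus of the damped denominator is at least that of its imaginary
          part, so the undamped kernel dominates uniformly in n.\<close>
        have d: "\<bar>fst p + snd p\<bar> \<le> cmod ?d"
          using abs_Im_le_cmod[of ?d] by simp
        have "cmod (x (fst p) * y (snd p)) / cmod ?d \<le> cmod (x (fst p) * y (snd p)) / \<bar>fst p + snd p\<bar>"
          using d True by (intro divide_left_mono mult_pos_pos) (auto simp del: of_real_add)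
        then show ?thesis unfolding N_def h_def norm_divide norm_of_real .
      next
        case False
        then have "x (fst p) * y (snd p) = 0" using L2plus_D(2)[OF x] L2plus_D(2)[OF y] by (auto simp: not_less)
        then show ?thesis by (auto simp: N_def h_def)
      qed
    qed
  qed
  then have "(\<lambda>n. c * (LINT p|lborel. N n p)) \<longlonglongrightarrow> c * (LINT p|lborel. \<i> * h p)"
    by (intro tendsto_intros)
  ultimately have "(LINT t|lborel. FRint x t * FRint y t) = c * (LINT p|lborel. \<i> * h p)"
    unfolding eq by (rule LIMSEQ_unique)
  then show ?thesis unfolding h_def integral_mult_right_zero by (simp add: c_def)
qed

text \<open>The real witness \<open>a\<close> carries two facts: the form is real, which places the
  numerical range of T^2 on the imaginary axis, and it is nonnegative, which selects the upper half
  of that axis. The value is the integral of |L t|^2 with \<open>L\<close> the Laplace transform of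
  x.\<close>

lemma Carleman_form_nonneg:
  assumes x: "x \<in> L2plus" and x1: "integrable lborel x"
  shows "\<exists>a\<ge>0. (LINT p|lborel. x (fst p) * cnj (x (snd p)) / of_real (fst p + snd p)) = of_real a"
proof -
  note [measurable] = L2plus_D(1)[OF x]
  define F where "F p = x (fst p) * cnj (x (snd p))" for p
  define c :: "real \<times> real \<Rightarrow> complex" where "c p = of_real (fst p + snd p)" for p
  have F [measurable]: "F \<in> borel_measurable borel" unfolding F_def borel_prod[symmetric] by measurable
  have c [measurable]: "c \<in> borel_measurable borel" unfolding c_def borel_prod[symmetric] by measurable
  have pos: "fst p > 0 \<and> snd p > 0" if "F p \<noteq> 0" for p
    using that L2plus_D(2)[OF x, of "fst p"] L2plus_D(2)[OF x, of "snd p"] by (auto simp: F_def not_le[symmetric])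
  have pos': "F p \<noteq> 0 \<Longrightarrow> Re (c p) > 0" for p using pos[of p] by (simp add: c_def)
  have "integrable lborel (\<lambda>p. norm (x (fst p) * cnj (x (snd p)) / of_real (fst p + snd p)))"
    by (intro integrable_norm Hilbert_inequality L2plus_cnj x)
  moreover have "norm (x (fst p) * cnj (x (snd p)) / of_real (fst p + snd p)) = cmod (F p) / Re (c p)" for p
    using pos[of p] unfolding norm_divide norm_of_real F_def c_def Re_complex_of_real
    by (cases "x (fst p) * cnj (x (snd p)) = 0") auto
  ultimately have int: "integrable lborel (\<lambda>p. cmod (F p) / Re (c p))" by simp
  define L where "L t = (LINT s|lborel. x s * of_real (exp (- (s * t))))" for t
  have eq: "indicator {0<..} t *\<^sub>R (LINT p|lborel. F p * exp (- (c p * of_real t)))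
      = complex_of_real (indicator {0<..} t * (cmod (L t))\<^sup>2)" for t
  proof (cases "t > 0")
    case True
    have 1: "integrable lborel (\<lambda>s. x s * of_real (exp (- (s * t))))"
    proof (rule Bochner_Integration.integrable_bound[OF x1])
      show "AE s in lborel. norm (x s * of_real (exp (- (s * t)))) \<le> norm (x s)"
      proof (rule AE_I2)
        show "norm (x s * of_real (exp (- (s * t)))) \<le> norm (x s)" for s
          using True L2plus_D(2)[OF x, of s] unfolding norm_mult norm_of_real
          by (cases "s > 0") (auto intro!: mult_right_le_one_le simp: less_imp_le)
      qed
    qed measurable
    have "(LINT p|lborel. F p * exp (- (c p * of_real t)))
      = (LINT p|lborel. (x (fst p) * of_real (exp (- (fst p * t)))) * cnj (x (snd p) * of_real (exp (- (snd p * t)))))"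
    proof (rule Bochner_Integration.integral_cong[OF refl])
      fix p
      have "- (c p * of_real t) = complex_of_real (- (fst p * t) + - (snd p * t))"
        by (simp add: c_def algebra_simps)
      then have "exp (- (c p * of_real t)) = of_real (exp (- (fst p * t)) * exp (- (snd p * t)))"
        by (simp only: exp_of_real exp_add)
      then show "F p * exp (- (c p * of_real t))
        = (x (fst p) * of_real (exp (- (fst p * t)))) * cnj (x (snd p) * of_real (exp (- (snd p * t))))"
        by (simp add: F_def)
    qed
    also have "\<dots> = L t * (LINT s|lborel. cnj (x s * of_real (exp (- (s * t)))))"
      unfolding L_def by (rule integrable_tensor(2)) (use 1 in \<open>auto simp del: complex_cnj_mult\<close>)
    also have "\<dots> = L t * cnj (L t)"
      unfolding L_def by (subst Bochner_Integration.integral_cnj) (rule refl)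
    finally show ?thesis using True by (simp add: complex_norm_square del: of_real_power)
  qed simp
  have "(LINT p|lborel. F p / c p)
      = (LINT t|lborel. indicator {0<..} t *\<^sub>R (LINT p|lborel. F p * exp (- (c p * of_real t))))"
    by (rule Laplace_Fubini(2)[OF F c pos' int, symmetric])
  also have "\<dots> = (LINT t|lborel. complex_of_real (indicator {0<..} t * (cmod (L t))\<^sup>2))"
    by (simp only: eq)
  also have "\<dots> = of_real (LINT t|lborel. indicator {0<..} t * (cmod (L t))\<^sup>2)"
    by (rule integral_complex_of_real)
  finally have "(LINT p|lborel. F p / c p) = of_real (LINT t|lborel. indicator {0<..} t * (cmod (L t))\<^sup>2)" .
  moreover have "0 \<le> (LINT t|lborel. indicator {0<..} t * (cmod (L t))\<^sup>2)" by simp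
  ultimately show ?thesis unfolding F_def c_def by blast
qed

section \<open>The truncated Fourier-Plancherel operator\<close>

lemma norm_cls_mult_le:
  assumes f: "f \<in> L2plus" and k: "k \<in> borel_measurable borel" "\<And>t. cmod (k t) \<le> 1"
  shows "norm (cls (\<lambda>t. k t * f t)) \<le> norm (cls f)"
proof -
  note kf = L2plus_mult_bounded[OF f k]
  have "L2norm (\<lambda>t. k t * f t) \<le> L2norm f"
    unfolding L2norm_def
  proof (intro real_sqrt_le_mono integral_mono L2plus_D f kf)
    show "(cmod (k t * f t))\<^sup>2 \<le> (cmod (f t))\<^sup>2" for t
      using k(2)[of t] by (intro power_mono) (auto simp: norm_mult mult_left_le_one_le)
  qed
  then show ?thesis by (simp add: norm_cls f kf)
qed

lemma norm_cutoff_diff_le: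
  assumes "f \<in> L2plus" "g \<in> L2plus"
  shows "norm (cls (cutoff N f) - cls (cutoff N g)) \<le> norm (cls f - cls g)"
  using norm_cls_mult_le[OF L2plus_diff[OF assms], of "\<lambda>t. indicator {0<..N} t"]
  unfolding cls_diff[OF assms] cls_diff[OF L2plus_cutoff[OF assms(1)] L2plus_cutoff[OF assms(2)]]
  by (simp add: cutoff_def right_diff_distrib indicator_def)

text \<open>On a bounded interval square integrability implies integrability: the indicator itself
  belongs to \<open>L2plus\<close>, and products of two members are integrable.\<close>

lemma cutoff_integrable:
  assumes "f \<in> L2plus"
  shows "integrable lborel (cutoff N f)"
proof -
  have "(\<lambda>t. indicator {0<..N} t :: complex) \<in> L2plus"
  proof (rule L2plus_I)
    have "integrable lborel (\<lambda>t. indicator {0<..N} t :: real)"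
      by (cases "0 \<le> N") auto
    then show "integrable lborel (\<lambda>t. (cmod (indicator {0<..N} t))\<^sup>2)"
      by (rule Bochner_Integration.integrable_cong[THEN iffD1, rotated 2]) (auto simp: indicator_def)
  qed auto
  from L2plus_mult_integrable[OF this assms] show ?thesis by (simp add: cutoff_def)
qed

lemma cutoff_tendsto:
  assumes f: "f \<in> L2plus"
  shows "((\<lambda>N. cls (cutoff N f)) \<longlongrightarrow> cls f) at_top"
proof -
  note [measurable] = L2plus_D(1)[OF f]
  have "((\<lambda>N. LINT t|lborel. (cmod (cutoff N f t - f t))\<^sup>2) \<longlongrightarrow> (LINT t|(lborel :: real measure). 0)) at_top"
  proof (rule integral_dominated_convergence_at_top[where w = "\<lambda>t. (cmod (f t))\<^sup>2"])
    show "\<forall>\<^sub>F N in at_top. AE t in lborel. norm ((cmod (cutoff N f t - f t))\<^sup>2) \<le> (cmod (f t))\<^sup>2"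
      by (intro always_eventually allI AE_I2) (auto simp: cutoff_def indicator_def)
    show "AE t in lborel. ((\<lambda>N. (cmod (cutoff N f t - f t))\<^sup>2) \<longlongrightarrow> 0) at_top"
    proof (rule AE_I2)
      fix t
      have "\<forall>\<^sub>F N in at_top. (cmod (cutoff N f t - f t))\<^sup>2 = 0"
        using eventually_ge_at_top[of t]
        by eventually_elim (use L2plus_D(2)[OF f, of t] in \<open>auto simp: cutoff_def indicator_def\<close>)
      then show "((\<lambda>N. (cmod (cutoff N f t - f t))\<^sup>2) \<longlongrightarrow> 0) at_top" by (rule tendsto_eventually)
    qed
  qed (use L2plus_D(3)[OF f] in \<open>auto simp: cutoff_def\<close>)
  from tendsto_real_sqrt[OF this] have "((\<lambda>N. norm (cls (cutoff N f) - cls f)) \<longlongrightarrow> 0) at_top"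
    by (simp add: cls_diff L2plus_cutoff f norm_cls L2plus_diff L2norm_def)
  then show ?thesis by (simp only: tendsto_norm_zero_iff Lim_null[symmetric])
qed

lemma FRint_add:
  assumes "integrable lborel x" "integrable lborel y"
  shows "FRint (\<lambda>t. x t + y t) = (\<lambda>t. FRint x t + FRint y t)"
proof -
  have "FT (\<lambda>t. x t + y t) t = FT x t + FT y t" for t
    unfolding FT_def distrib_right
    by (rule Bochner_Integration.integral_add[OF integrable_FT integrable_FT]) fact+
  then show ?thesis by (simp add: FRint_def fun_eq_iff distrib_left add_divide_distrib)
qed

lemma FRint_diff:
  assumes "integrable lborel x" "integrable lborel y"
  shows "FRint (\<lambda>t. x t - y t) = (\<lambda>t. FRint x t - FRint y t)"
proof -
  have "FT (\<lambda>t. x t - y t) t = FT x t - FT y t" for t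
    unfolding FT_def left_diff_distrib
    by (rule Bochner_Integration.integral_diff[OF integrable_FT integrable_FT]) fact+
  then show ?thesis by (simp add: FRint_def fun_eq_iff right_diff_distrib diff_divide_distrib)
qed

lemma FRint_cmult: "FRint (\<lambda>t. c * x t) = (\<lambda>t. c * FRint x t)"
  by (simp add: FRint_def FT_def mult.assoc fun_eq_iff)

lemma norm_FRint_diff_le:
  assumes "x \<in> L2plus" "integrable lborel x" "y \<in> L2plus" "integrable lborel y"
  shows "norm (cls (FRint x) - cls (FRint y)) \<le> norm (cls x - cls y)"
  using FRint_L2plus(2)[of "\<lambda>t. x t - y t"] assms
  by (simp add: cls_diff FRint_L2plus FRint_diff L2plus_diff)

lemma FRint_cutoff_L2plus: "f \<in> L2plus \<Longrightarrow> FRint (cutoff N f) \<in> L2plus"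
  by (intro FRint_L2plus L2plus_cutoff cutoff_integrable)

text \<open>\<open>FRint\<close> is a contraction in the L2 norm, so the images inherit the Cauchy
  property from the truncations.\<close>

lemma FRint_cutoff_convergent:
  assumes f: "f \<in> L2plus"
  shows "\<exists>v. ((\<lambda>N. cls (FRint (cutoff N f))) \<longlongrightarrow> v) at_top"
proof -
  have le: "norm (cls (FRint (cutoff N f)) - cls (FRint (cutoff M f))) \<le> norm (cls (cutoff N f) - cls (cutoff M f))" for N M
    by (intro norm_FRint_diff_le L2plus_cutoff cutoff_integrable f)
  have lim: "(\<lambda>n. cls (cutoff (real n) f)) \<longlonglongrightarrow> cls f"
    by (rule filterlim_compose[OF cutoff_tendsto[OF f] filterlim_real_sequentially])
  then have "Cauchy (\<lambda>n. cls (cutoff (real n) f))" by (rule LIMSEQ_imp_Cauchy)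
  then have "Cauchy (\<lambda>n. cls (FRint (cutoff (real n) f)))"
    unfolding Cauchy_def dist_norm using le by (meson le_less_trans)
  then obtain v where v: "(\<lambda>n. cls (FRint (cutoff (real n) f))) \<longlonglongrightarrow> v"
    by (auto simp: Cauchy_convergent_iff convergent_def)
  \<comment> \<open>Letting the second index run to infinity through the integers in the contraction
    estimate shows that the limit along integers is also the limit along real N.\<close>
  have "norm (cls (FRint (cutoff N f)) - v) \<le> norm (cls (cutoff N f) - cls f)" for N
    by (rule tendsto_le[OF sequentially_bot
          tendsto_norm[OF tendsto_diff[OF tendsto_const lim]] tendsto_norm[OF tendsto_diff[OF tendsto_const v]]])
       (auto intro!: always_eventually le)
  moreover have "((\<lambda>N. norm (cls (cutoff N f) - cls f)) \<longlongrightarrow> 0) at_top"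
    using cutoff_tendsto[OF f] by (simp only: tendsto_norm_zero_iff Lim_null[symmetric])
  ultimately have "((\<lambda>N. cls (FRint (cutoff N f)) - v) \<longlongrightarrow> 0) at_top"
    by (rule Lim_null_comparison[OF always_eventually[OF allI]])
  then have "((\<lambda>N. cls (FRint (cutoff N f))) \<longlongrightarrow> v) at_top"
    by (simp only: Lim_null[symmetric])
  then show ?thesis by blast
qed

text \<open>Quantifying over every representative makes the value a function of the class. Existence
  and independence of the representative are both settled in \<open>FRop_tendsto\<close>.\<close>

definition FRop :: "l2 \<Rightarrow> l2" where
  "FRop u = (THE v. \<forall>f\<in>L2plus. cls f = u \<longrightarrow> ((\<lambda>N. cls (FRint (cutoff N f))) \<longlongrightarrow> v) at_top)"

lemma FRop_tendsto:
  assumes f: "f \<in> L2plus"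
  shows "((\<lambda>N. cls (FRint (cutoff N f))) \<longlongrightarrow> FRop (cls f)) at_top"
proof -
  obtain v where v: "((\<lambda>N. cls (FRint (cutoff N f))) \<longlongrightarrow> v) at_top"
    using FRint_cutoff_convergent[OF f] by blast
  have eq: "cls (FRint (cutoff N g)) = cls (FRint (cutoff N f))" if g: "g \<in> L2plus" and "cls g = cls f" for g N
  proof -
    have "norm (cls (FRint (cutoff N g)) - cls (FRint (cutoff N f))) \<le> norm (cls (cutoff N g) - cls (cutoff N f))"
      by (intro norm_FRint_diff_le L2plus_cutoff cutoff_integrable f g)
    also have "\<dots> \<le> norm (cls g - cls f)" by (rule norm_cutoff_diff_le[OF g f])
    finally show ?thesis using that by simp
  qed
  have "\<forall>g\<in>L2plus. cls g = cls f \<longrightarrow> ((\<lambda>N. cls (FRint (cutoff N g))) \<longlongrightarrow> FRop (cls f)) at_top"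
    unfolding FRop_def
  proof (rule theI[where a = v])
    show "\<forall>g\<in>L2plus. cls g = cls f \<longrightarrow> ((\<lambda>N. cls (FRint (cutoff N g))) \<longlongrightarrow> v) at_top"
      using v eq by simp
    show "w = v" if "\<forall>g\<in>L2plus. cls g = cls f \<longrightarrow> ((\<lambda>N. cls (FRint (cutoff N g))) \<longlongrightarrow> w) at_top" for w
      using that f v tendsto_unique[OF trivial_limit_at_top_linorder, of _ w v] by blast
  qed
  then show ?thesis using f by blast
qed

lemma FRop_unique:
  assumes "f \<in> L2plus" "((\<lambda>N. cls (FRint (cutoff N f))) \<longlongrightarrow> v) at_top"
  shows "FRop (cls f) = v"
  using tendsto_unique[OF trivial_limit_at_top_linorder FRop_tendsto[OF assms(1)] assms(2)] .

text \<open>This bridge replaces the relational graph by a bounded operator on classes. Its core is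
  that truncating the integral and truncating the function are the same thing.\<close>

lemma FRplus_iff: "FRplus x y \<longleftrightarrow> x \<in> L2plus \<and> y \<in> L2plus \<and> FRop (cls x) = cls y"
proof -
  have tr: "FRplus_trunc N x = FRint (cutoff N x)" for N
    by (auto simp: FRplus_trunc_def FRint_def FT_def cutoff_def scaleR_conv_of_real mult.assoc indicator_def fun_eq_iff
        intro!: Bochner_Integration.integral_cong)
  have "L2norm (\<lambda>t. FRplus_trunc N x t - y t) = norm (cls (FRint (cutoff N x)) - cls y)"
    if "x \<in> L2plus" "y \<in> L2plus" for N
    using that by (simp add: tr cls_diff FRint_cutoff_L2plus norm_cls L2plus_diff)
  then have "((\<lambda>N. L2norm (\<lambda>t. FRplus_trunc N x t - y t)) \<longlongrightarrow> 0) at_top \<longleftrightarrow> FRop (cls x) = cls y"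
    if "x \<in> L2plus" "y \<in> L2plus"
    using that FRop_unique[of x "cls y"] FRop_tendsto[of x]
    by (auto simp only: tendsto_norm_zero_iff Lim_null[symmetric])
  then show ?thesis unfolding FRplus_def by blast
qed

lemma FRop_cls:
  assumes "x \<in> L2plus" "integrable lborel x"
  shows "FRop (cls x) = cls (FRint x)"
proof (rule FRop_unique[OF assms(1)])
  have "((\<lambda>N. norm (cls (cutoff N x) - cls x)) \<longlongrightarrow> 0) at_top"
    using cutoff_tendsto[OF assms(1)] by (simp only: tendsto_norm_zero_iff Lim_null[symmetric])
  then have "((\<lambda>N. cls (FRint (cutoff N x)) - cls (FRint x)) \<longlongrightarrow> 0) at_top"
    by (rule Lim_null_comparison[rotated])
       (intro always_eventually allI norm_FRint_diff_le L2plus_cutoff cutoff_integrable assms)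
  then show "((\<lambda>N. cls (FRint (cutoff N x))) \<longlongrightarrow> cls (FRint x)) at_top"
    by (simp only: Lim_null[symmetric])
qed

lemma FRop_imul: "FRop (imul u) = imul (FRop u)"
proof (rule cls_cases[of u])
  fix f assume f: "f \<in> L2plus" "u = cls f"
  have "cutoff N (\<lambda>t. \<i> * f t) = (\<lambda>t. \<i> * cutoff N f t)" for N
    by (simp add: cutoff_def mult.left_commute)
  then have "cls (FRint (cutoff N (\<lambda>t. \<i> * f t))) = imul (cls (FRint (cutoff N f)))" for N
    by (simp add: FRint_cmult imul_cls FRint_cutoff_L2plus f)
  then show ?thesis
    using bounded_linear.tendsto[OF bounded_linear_imul FRop_tendsto[OF f(1)]]
    by (simp add: f imul_cls FRop_unique L2plus_cmult)
qed

lemma bounded_linear_FRop: "bounded_linear FRop"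
proof (rule bounded_linear_intro[where K=1])
  fix u v :: l2 and r :: real
  obtain f where f: "f \<in> L2plus" "u = cls f" by (rule cls_cases)
  obtain g where g: "g \<in> L2plus" "v = cls g" by (rule cls_cases)
  have "cutoff N (\<lambda>t. f t + g t) = (\<lambda>t. cutoff N f t + cutoff N g t)" for N
    by (simp add: cutoff_def distrib_left)
  then have "cls (FRint (cutoff N (\<lambda>t. f t + g t))) = cls (FRint (cutoff N f)) + cls (FRint (cutoff N g))" for N
    by (simp add: FRint_add cutoff_integrable f g cls_add FRint_cutoff_L2plus)
  then show "FRop (u + v) = FRop u + FRop v"
    using tendsto_add[OF FRop_tendsto[OF f(1)] FRop_tendsto[OF g(1)]]
    by (simp add: f g cls_add FRop_unique L2plus_add)
  have "cutoff N (\<lambda>t. r *\<^sub>R f t) = (\<lambda>t. of_real r * cutoff N f t)" for N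
    by (simp add: cutoff_def scaleR_conv_of_real mult.left_commute)
  then have "cls (FRint (cutoff N (\<lambda>t. r *\<^sub>R f t))) = r *\<^sub>R cls (FRint (cutoff N f))" for N
    by (simp add: FRint_cmult cls_scaleR FRint_cutoff_L2plus f scaleR_conv_of_real)
  then show "FRop (r *\<^sub>R u) = r *\<^sub>R FRop u"
    using tendsto_scaleR[OF tendsto_const FRop_tendsto[OF f(1)], of r]
    by (simp add: f cls_scaleR FRop_unique L2plus_scaleR del: scaleR_conv_of_real)
  have "norm (cls (FRint (cutoff N f))) \<le> norm (cls (cutoff N f))" for N
    by (intro FRint_L2plus L2plus_cutoff cutoff_integrable f)
  then show "norm (FRop u) \<le> norm u * 1"
    using tendsto_le[OF trivial_limit_at_top_linorder tendsto_norm[OF cutoff_tendsto[OF f(1)]] tendsto_norm[OF FRop_tendsto[OF f(1)]]]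
    by (simp add: f)
qed

section \<open>Conjugation, the bilinear form and the square of the operator\<close>

lift_definition conj_l2 :: "l2 \<Rightarrow> l2" is "\<lambda>f t. cnj (f t)"
  by (auto simp: L2rel_def L2plus_cnj)

lemma conj_l2_cls: "f \<in> L2plus \<Longrightarrow> conj_l2 (cls f) = cls (\<lambda>t. cnj (f t))"
  by (simp add: conj_l2.abs_eq L2rel_def)

lemma inner_conj_l2: "inner (conj_l2 x) (conj_l2 y) = inner x y"
proof (rule cls_cases[of x], rule cls_cases[of y])
  fix f g assume f: "f \<in> L2plus" "x = cls f" and g: "g \<in> L2plus" "y = cls g"
  have "inner (conj_l2 x) (conj_l2 y) = Re (LINT t|lborel. cnj (f t * cnj (g t)))"
    by (simp add: f g conj_l2_cls inner_cls L2plus_cnj)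
  also have "\<dots> = Re (cnj (LINT t|lborel. f t * cnj (g t)))"
    by (subst Bochner_Integration.integral_cnj) (rule refl)
  finally show ?thesis by (simp add: f g inner_cls)
qed

lemma norm_conj_l2: "norm (conj_l2 x) = norm x"
  by (simp add: norm_eq_sqrt_inner inner_conj_l2)

lemma bounded_linear_conj_l2: "bounded_linear conj_l2"
proof (rule bounded_linear_intro[where K=1])
  show "conj_l2 (x + y) = conj_l2 x + conj_l2 y" for x y
    by transfer (auto simp: L2rel_def L2plus_add L2plus_cnj)
  show "conj_l2 (r *\<^sub>R x) = r *\<^sub>R conj_l2 x" for r x
    by transfer (auto simp: L2rel_def L2plus_scaleR L2plus_cnj simp del: scaleR_conv_of_real)
qed (simp add: norm_conj_l2)

lemma inner_cls_conj: "f \<in> L2plus \<Longrightarrow> g \<in> L2plus \<Longrightarrow>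
    inner (cls f) (conj_l2 (cls g)) = Re (LINT t|lborel. f t * g t)"
  by (simp add: conj_l2_cls inner_cls L2plus_cnj)

text \<open>Pairing with a conjugated vector turns the sesquilinear product into the bilinear one,
  for which the operator is its own transpose. The identity passes from truncated functions to all
  vectors by continuity.\<close>

lemma FRop_symmetric: "inner (FRop u) (conj_l2 v) = inner u (conj_l2 (FRop v))"
proof (rule cls_cases[of u], rule cls_cases[of v])
  fix f g assume f: "f \<in> L2plus" "u = cls f" and g: "g \<in> L2plus" "v = cls g"
  note lim = bounded_linear.tendsto[OF bounded_linear_conj_l2] bounded_linear.tendsto[OF bounded_linear_FRop]
  have eq: "inner (FRop (cls (cutoff N f))) (conj_l2 (cls (cutoff N g)))
    = inner (cls (cutoff N f)) (conj_l2 (FRop (cls (cutoff N g))))" for N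
    by (simp add: FRop_cls inner_cls_conj L2plus_cutoff cutoff_integrable FRint_cutoff_L2plus f g FRint_symmetric)
  have "((\<lambda>N. inner (FRop (cls (cutoff N f))) (conj_l2 (cls (cutoff N g)))) \<longlongrightarrow> inner (FRop u) (conj_l2 v)) at_top"
    unfolding f g by (intro tendsto_inner lim cutoff_tendsto f g)
  moreover have "((\<lambda>N. inner (FRop (cls (cutoff N f))) (conj_l2 (cls (cutoff N g)))) \<longlongrightarrow> inner u (conj_l2 (FRop v))) at_top"
    unfolding eq unfolding f g by (intro tendsto_inner lim cutoff_tendsto f g)
  ultimately show ?thesis by (rule tendsto_unique[OF trivial_limit_at_top_linorder])
qed

text \<open>Since \<open>FRint x\<close> need not be integrable, the outer application is not
  evaluated as an integral; transposition moves it onto y, and both factors become Fourier integrals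
  of integrable functions.\<close>

lemma FRop_FRop_form:
  assumes x: "x \<in> L2plus" "integrable lborel x" and y: "y \<in> L2plus" "integrable lborel y"
  shows "inner (FRop (FRop (cls x))) (cls y)
    = Re (\<i> / (2 * of_real pi) * (LINT p|lborel. x (fst p) * cnj (y (snd p)) / of_real (fst p + snd p)))"
proof -
  have y': "(\<lambda>t. cnj (y t)) \<in> L2plus" "integrable lborel (\<lambda>t. cnj (y t))"
    using y L2plus_cnj by auto
  have "inner (FRop (FRop (cls x))) (cls y) = inner (FRop (FRop (cls x))) (conj_l2 (cls (\<lambda>t. cnj (y t))))"
    by (simp add: conj_l2_cls y')
  also have "\<dots> = inner (cls (FRint x)) (conj_l2 (cls (FRint (\<lambda>t. cnj (y t)))))"
    by (subst FRop_symmetric) (simp only: FRop_cls[OF x] FRop_cls[OF y'])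
  also have "\<dots> = Re (LINT t|lborel. FRint x t * FRint (\<lambda>t. cnj (y t)) t)"
    by (rule inner_cls_conj[OF FRint_L2plus(1)[OF x] FRint_L2plus(1)[OF y']])
  finally show ?thesis by (simp add: FRint_form[OF x y'])
qed

text \<open>For integrable u the complex product is \<i> a / (2 pi) with a between 0 and pi times
  the squared norm. The three parts give its real part and the two bounds on its imaginary part,
  extended to all u by truncation.\<close>

lemma FRop_FRop_numerical_range:
  shows "inner (FRop (FRop u)) u = 0"
    and "0 \<le> inner (FRop (FRop u)) (imul u)"
    and "inner (FRop (FRop u)) (imul u) \<le> (norm u)\<^sup>2 / 2"
proof -
  obtain f where f: "f \<in> L2plus" "u = cls f" by (rule cls_cases)
  have *: "inner (FRop (FRop (cls x))) (cls x) = 0"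
    "0 \<le> inner (FRop (FRop (cls x))) (imul (cls x))"
    "inner (FRop (FRop (cls x))) (imul (cls x)) \<le> (norm (cls x))\<^sup>2 / 2"
    if x: "x \<in> L2plus" "integrable lborel x" for x
  proof -
    obtain a where a: "a \<ge> 0" "(LINT p|lborel. x (fst p) * cnj (x (snd p)) / of_real (fst p + snd p)) = of_real a"
      using Carleman_form_nonneg[OF x] by blast
    have "L2norm (\<lambda>t. cnj (x t)) = L2norm x" by (simp add: L2norm_def)
    then have "cmod (of_real a) \<le> pi / 2 * ((L2norm x)\<^sup>2 + (L2norm x)\<^sup>2)"
      using Hilbert_inequality(2)[OF x(1) L2plus_cnj[OF x(1)]] by (simp only: a(2))
    then have a_le: "a \<le> pi * (norm (cls x))\<^sup>2" using a(1) by (simp add: norm_cls x)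
    show "inner (FRop (FRop (cls x))) (cls x) = 0"
      unfolding FRop_FRop_form[OF x x] a(2) by simp
    \<comment> \<open>Conjugating the unit inside gives the factor -\<i>, which cancels the \<i> of
      the form and exposes the imaginary part a / (2 pi).\<close>
    have "(LINT p|lborel. x (fst p) * cnj (\<i> * x (snd p)) / of_real (fst p + snd p))
      = (LINT p|lborel. (- \<i>) * (x (fst p) * cnj (x (snd p)) / of_real (fst p + snd p)))"
      by (simp add: mult_ac)
    also have "\<dots> = - \<i> * of_real a" unfolding a(2)[symmetric] by (rule integral_mult_right_zero)
    finally have eq: "inner (FRop (FRop (cls x))) (imul (cls x)) = a / (2 * pi)"
      using FRop_FRop_form[OF x, of "\<lambda>t. \<i> * x t"] x by (simp add: imul_cls L2plus_cmult)
    show "0 \<le> inner (FRop (FRop (cls x))) (imul (cls x))"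
      "inner (FRop (FRop (cls x))) (imul (cls x)) \<le> (norm (cls x))\<^sup>2 / 2"
      unfolding eq using a a_le by (simp_all add: field_simps)
  qed
  note lim = cutoff_tendsto[OF f(1)] bounded_linear.tendsto[OF bounded_linear_FRop]
    bounded_linear.tendsto[OF bounded_linear_imul]
  note ** = *[OF L2plus_cutoff[OF f(1)] cutoff_integrable[OF f(1)]]
  have 1: "((\<lambda>N. inner (FRop (FRop (cls (cutoff N f)))) (cls (cutoff N f))) \<longlongrightarrow> inner (FRop (FRop u)) u) at_top"
    unfolding f(2) by (intro tendsto_inner lim)
  have 2: "((\<lambda>N. inner (FRop (FRop (cls (cutoff N f)))) (imul (cls (cutoff N f)))) \<longlongrightarrow> inner (FRop (FRop u)) (imul u)) at_top"
    unfolding f(2) by (intro tendsto_inner lim)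
  have 3: "((\<lambda>N. (norm (cls (cutoff N f)))\<^sup>2 / 2) \<longlongrightarrow> (norm u)\<^sup>2 / 2) at_top"
    unfolding f(2) by (intro tendsto_divide tendsto_power tendsto_norm tendsto_const lim) simp
  show "inner (FRop (FRop u)) u = 0"
    using 1 unfolding **(1) by (simp add: tendsto_const_iff)
  show "0 \<le> inner (FRop (FRop u)) (imul u)"
    by (rule tendsto_lowerbound[OF 2 always_eventually[OF allI[OF **(2)]] trivial_limit_at_top_linorder])
  show "inner (FRop (FRop u)) (imul u) \<le> (norm u)\<^sup>2 / 2"
    by (rule tendsto_le[OF trivial_limit_at_top_linorder 3 2 always_eventually[OF allI[OF **(3)]]])
qed

text \<open>Integrable functions are exactly what \<open>FRop_FRop_form\<close> accepts as test
  vectors; they contain all truncations and are therefore dense.\<close>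

lemma l2_eq_0_test:
  assumes "\<And>y. y \<in> L2plus \<Longrightarrow> integrable lborel y \<Longrightarrow> inner v (cls y) = 0"
  shows "v = 0"
proof (rule cls_cases[of v])
  fix f assume f: "f \<in> L2plus" "v = cls f"
  have "((\<lambda>N. inner v (cls (cutoff N f))) \<longlongrightarrow> inner v v) at_top"
    unfolding f by (intro tendsto_intros cutoff_tendsto f)
  moreover have "inner v (cls (cutoff N f)) = 0" for N
    by (intro assms L2plus_cutoff cutoff_integrable f)
  ultimately show ?thesis by (simp add: tendsto_const_iff)
qed

section \<open>The symbol of the Carleman operator\<close>

text \<open>The power of u with exponent -1/2 + \<i> \<mu> on the half-line, written so that its
  modulus and its multiplicativity can be read off.\<close>

definition mellin_fun :: "real \<Rightarrow> real \<Rightarrow> complex" where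
  "mellin_fun \<mu> u = of_real (indicator {0<..} u / sqrt u) * cis (\<mu> * ln u)"

lemma mellin_fun_measurable [measurable]: "mellin_fun \<mu> \<in> borel_measurable borel"
proof -
  have [measurable]: "cis \<in> borel_measurable borel"
    by (intro borel_measurable_continuous_onI continuous_intros)
  show ?thesis unfolding mellin_fun_def[abs_def] by measurable
qed

lemma norm_mellin_fun: "cmod (mellin_fun \<mu> u) = indicator {0<..} u / sqrt u"
  by (simp add: mellin_fun_def norm_mult norm_divide indicator_def)

lemma mellin_fun_mult: "s > 0 \<Longrightarrow> t > 0 \<Longrightarrow> mellin_fun \<mu> (s * t) = mellin_fun \<mu> s * mellin_fun \<mu> t"
  by (simp add: mellin_fun_def real_sqrt_mult ln_mult distrib_left cis_mult[symmetric])

section \<open>Elementary power integrals for the error estimates\<close>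

lemma integrable_inverse_sqrt:
  assumes "0 \<le> a" "a < b"
  shows "integrable lborel (\<lambda>u. indicator {a<..<b} u * (1 / sqrt u))"
    and "(LINT u|lborel. indicator {a<..<b} u * (1 / sqrt u)) = 2 * sqrt b - 2 * sqrt a"
proof -
  have "((\<lambda>u. 2 * sqrt u) \<longlongrightarrow> 2 * sqrt a) (at_right a)" "((\<lambda>u. 2 * sqrt u) \<longlongrightarrow> 2 * sqrt b) (at_left b)"
    by (intro tendsto_intros)+
  then have "integrable lborel (\<lambda>u. indicator (einterval (ereal a) (ereal b)) u * (1 / sqrt u))"
    "(LINT u|lborel. indicator (einterval (ereal a) (ereal b)) u * (1 / sqrt u)) = 2 * sqrt b - 2 * sqrt a"
    by (intro integral_FTC_nonneg[where F="\<lambda>u. 2 * sqrt u" and A="2 * sqrt a" and B="2 * sqrt b"];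
        use assms in \<open>auto simp: ereal_tendsto_simps inverse_eq_divide intro!: derivative_eq_intros continuous_intros\<close>)+
  then show "integrable lborel (\<lambda>u. indicator {a<..<b} u * (1 / sqrt u))"
    "(LINT u|lborel. indicator {a<..<b} u * (1 / sqrt u)) = 2 * sqrt b - 2 * sqrt a" by simp_all
qed

lemma integrable_inverse_u_sqrt:
  assumes a: "0 < a"
  shows "integrable lborel (\<lambda>u. indicator {a<..} u * (1 / (u * sqrt u)))"
    and "(LINT u|lborel. indicator {a<..} u * (1 / (u * sqrt u))) = 2 / sqrt a"
proof -
  have "((\<lambda>u. - 2 / sqrt u) \<longlongrightarrow> - 2 / sqrt a) (at_right a)" using a by (intro tendsto_intros) auto
  moreover have "((\<lambda>u. - 2 / sqrt u) \<longlongrightarrow> 0) at_top"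
    by (intro real_tendsto_divide_at_top[OF tendsto_const] sqrt_at_top)
  moreover have "((\<lambda>u. - 2 / sqrt u) has_real_derivative 1 / (u * sqrt u)) (at u)" if "a < u" for u
    using that a by (auto intro!: derivative_eq_intros simp: field_simps)
  ultimately have "integrable lborel (\<lambda>u. indicator (einterval (ereal a) \<infinity>) u * (1 / (u * sqrt u)))"
    "(LINT u|lborel. indicator (einterval (ereal a) \<infinity>) u * (1 / (u * sqrt u))) = 0 - (- 2 / sqrt a)"
    by (intro integral_FTC_nonneg[where F="\<lambda>u. - 2 / sqrt u"];
        use a in \<open>auto simp: ereal_tendsto_simps intro!: continuous_intros\<close>)+
  then show "integrable lborel (\<lambda>u. indicator {a<..} u * (1 / (u * sqrt u)))"
    "(LINT u|lborel. indicator {a<..} u * (1 / (u * sqrt u))) = 2 / sqrt a" by simp_all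
qed

lemma integrable_inverse_square:
  assumes a: "0 < (a::real)"
  shows "integrable lborel (\<lambda>u. indicator {a<..} u * (1 / u\<^sup>2))"
    and "(LINT u|lborel. indicator {a<..} u * (1 / u\<^sup>2)) = 1 / a"
proof -
  have "((\<lambda>u. - 1 / u) \<longlongrightarrow> - 1 / a) (at_right a)" using a by (intro tendsto_intros) auto
  moreover have "((\<lambda>u::real. - 1 / u) \<longlongrightarrow> 0) at_top"
    by (intro real_tendsto_divide_at_top[OF tendsto_const] filterlim_ident)
  moreover have "((\<lambda>u. - 1 / u) has_real_derivative 1 / u\<^sup>2) (at u)" if "a < u" for u
    using that a by (auto intro!: derivative_eq_intros simp: field_simps power2_eq_square)
  ultimately have "integrable lborel (\<lambda>u. indicator (einterval (ereal a) \<infinity>) u * (1 / u\<^sup>2))"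
    "(LINT u|lborel. indicator (einterval (ereal a) \<infinity>) u * (1 / u\<^sup>2)) = 0 - (- 1 / a)"
    by (intro integral_FTC_nonneg[where F="\<lambda>u. - 1 / u"];
        use a in \<open>auto simp: ereal_tendsto_simps intro!: continuous_intros\<close>)+
  then show "integrable lborel (\<lambda>u. indicator {a<..} u * (1 / u\<^sup>2))"
    "(LINT u|lborel. indicator {a<..} u * (1 / u\<^sup>2)) = 1 / a" by simp_all
qed

lemma integral_inverse_interval:
  assumes "0 < a" "a < b"
  shows "integrable lborel (\<lambda>u. indicator {a<..<b} u * (1 / u))"
    and "(LINT u|lborel. indicator {a<..<b} u * (1 / u)) = ln b - ln (a::real)"
proof -
  have "(ln \<longlongrightarrow> ln a) (at_right a)" "(ln \<longlongrightarrow> ln b) (at_left b)"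
    using assms by (intro tendsto_intros; simp)+
  then have "integrable lborel (\<lambda>u. indicator (einterval (ereal a) (ereal b)) u * (1 / u))"
    "(LINT u|lborel. indicator (einterval (ereal a) (ereal b)) u * (1 / u)) = ln b - ln a"
    by (intro integral_FTC_nonneg[where F=ln];
        use assms in \<open>auto simp: ereal_tendsto_simps field_simps intro!: derivative_eq_intros continuous_intros\<close>)+
  then show "integrable lborel (\<lambda>u. indicator {a<..<b} u * (1 / u))"
    "(LINT u|lborel. indicator {a<..<b} u * (1 / u)) = ln b - ln a" by simp_all
qed

text \<open>The Mellin transform of 1 / (1 + u) on the critical line, divided by pi; in closed form
  it is 1 / cosh (pi \<mu>). The argument runs on its continuity, its value at 0, its decay and its
  being real.\<close>

definition carleman_symbol :: "real \<Rightarrow> complex" where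
  "carleman_symbol \<mu> = (LINT u|lborel. mellin_fun \<mu> u / of_real (1 + u)) / of_real pi"

lemma mellin_fun_kernel_integrable:
  assumes t: "t > 0"
  shows "integrable lborel (\<lambda>u. mellin_fun \<mu> u / of_real (t + u))"
proof (rule Bochner_Integration.integrable_bound)
  show "integrable lborel (\<lambda>u. 1 / sqrt t * (indicator {0<..} u * (sqrt t / (sqrt u * (t + u)))))"
    by (intro integrable_mult_right Hilbert_kernel_integral t)
  show "AE u in lborel. norm (mellin_fun \<mu> u / of_real (t + u)) \<le> norm (1 / sqrt t * (indicator {0<..} u * (sqrt t / (sqrt u * (t + u)))))"
    unfolding norm_divide norm_of_real norm_mellin_fun using t by (intro AE_I2) (auto simp: indicator_def)
qed measurable

text \<open>Substituting t u for u: the kernel is homogeneous of degree -1 and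
  \<open>mellin_fun\<close> is multiplicative, so t factors out of the integral.\<close>

lemma mellin_fun_kernel_integral:
  assumes t: "t > 0"
  shows "(LINT u|lborel. mellin_fun \<mu> u / of_real (t + u)) = of_real pi * carleman_symbol \<mu> * mellin_fun \<mu> t"
proof -
  have "(LINT u|lborel. mellin_fun \<mu> u / of_real (t + u)) = \<bar>t\<bar> *\<^sub>R (LINT u|lborel. mellin_fun \<mu> (0 + t * u) / of_real (t + (0 + t * u)))"
    using t by (intro lborel_integral_real_affine) simp
  also have "(\<lambda>u. mellin_fun \<mu> (0 + t * u) / of_real (t + (0 + t * u))) = (\<lambda>u. (mellin_fun \<mu> t / of_real t) * (mellin_fun \<mu> u / of_real (1 + u)))"
  proof
    fix u
    show "mellin_fun \<mu> (0 + t * u) / of_real (t + (0 + t * u)) = (mellin_fun \<mu> t / of_real t) * (mellin_fun \<mu> u / of_real (1 + u))"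
    proof (cases "u > 0")
      case True
      have "t + t * u = t * (1 + u)" by (simp add: distrib_left)
      then show ?thesis using t True by (simp only: mellin_fun_mult of_real_mult add_0_left times_divide_times_eq)
    next
      case False
      then have "t * u \<le> 0" using t by (simp add: mult_nonneg_nonpos not_less)
      then show ?thesis using False by (simp add: mellin_fun_def)
    qed
  qed
  also have "\<bar>t\<bar> *\<^sub>R (LINT u|lborel. (mellin_fun \<mu> t / of_real t) * (mellin_fun \<mu> u / of_real (1 + u)))
    = \<bar>t\<bar> *\<^sub>R ((mellin_fun \<mu> t / of_real t) * (LINT u|lborel. mellin_fun \<mu> u / of_real (1 + u)))"
    by (simp only: integral_mult_right_zero)
  finally show ?thesis using t by (simp add: carleman_symbol_def scaleR_conv_of_real)
qed

lemma carleman_symbol_0: "carleman_symbol 0 = 1"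
proof -
  have "(LINT u|lborel. mellin_fun 0 u / of_real (1 + u)) = (LINT u|lborel. complex_of_real (indicator {0<..} u * (sqrt 1 / (sqrt u * (1 + u)))))"
    by (intro Bochner_Integration.integral_cong) (auto simp: mellin_fun_def)
  also have "\<dots> = of_real pi"
    using Hilbert_kernel_integral(2)[of 1] by (simp only: integral_complex_of_real)
  finally show ?thesis by (simp add: carleman_symbol_def)
qed

lemma continuous_carleman_symbol: "continuous_on UNIV carleman_symbol"
proof -
  have "(\<lambda>n. LINT u|lborel. mellin_fun (x n) u / of_real (1 + u)) \<longlonglongrightarrow> (LINT u|lborel. mellin_fun a u / of_real (1 + u))"
    if x: "x \<longlonglongrightarrow> a" for x a
  proof (rule integral_dominated_convergence)
    show "integrable lborel (\<lambda>u. indicator {0<..} u * (sqrt 1 / (sqrt u * (1 + u))))"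
      by (rule Hilbert_kernel_integral) simp
    show "AE u in lborel. (\<lambda>n. mellin_fun (x n) u / of_real (1 + u)) \<longlonglongrightarrow> mellin_fun a u / of_real (1 + u)"
    proof (rule AE_I2)
      fix u :: real
      have cis: "(\<lambda>n. cis (x n * ln u)) \<longlonglongrightarrow> cis (a * ln u)"
        unfolding cis_conv_exp by (intro tendsto_intros x)
      then show "(\<lambda>n. mellin_fun (x n) u / of_real (1 + u)) \<longlonglongrightarrow> mellin_fun a u / of_real (1 + u)"
        unfolding mellin_fun_def divide_inverse[of _ "of_real (1 + u)"] by (intro tendsto_mult tendsto_const cis)
    qed
    show "AE u in lborel. norm (mellin_fun (x n) u / of_real (1 + u)) \<le> indicator {0<..} u * (sqrt 1 / (sqrt u * (1 + u)))" for n
      unfolding norm_divide norm_of_real norm_mellin_fun by (intro AE_I2) (auto simp: indicator_def)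
  qed measurable
  then have "(\<lambda>n. carleman_symbol (x n)) \<longlonglongrightarrow> carleman_symbol a" if "x \<longlonglongrightarrow> a" for x a
    unfolding carleman_symbol_def using that by (intro tendsto_divide tendsto_const) auto
  then show ?thesis unfolding continuous_on_sequentially comp_def by blast
qed

text \<open>Integration by parts. With s = 1/2 + \<i> \<mu>, the function u^s / (1 + u) vanishes at
  0 and at infinity, and its derivative is s u^(s-1) / (1 + u) - u^s / (1 + u)^2. Hence s times the
  defining integral equals the integral of the second term, \<open>k\<close>, whose modulus is at
  most the Hilbert kernel with integral pi.\<close>

lemma carleman_symbol_decay:
  assumes \<mu>: "\<mu> \<noteq> 0"
  shows "cmod (carleman_symbol \<mu>) \<le> 1 / \<bar>\<mu>\<bar>"
proof -
  define s where "s = Complex (1/2) \<mu>"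
  define F where "F u = complex_of_real (sqrt u / (1 + u)) * exp (\<i> * of_real (\<mu> * ln u))" for u
  define k where "k u = of_real (u / (1 + u)) * (mellin_fun \<mu> u / of_real (1 + u))" for u
  define f where "f u = s * (mellin_fun \<mu> u / of_real (1 + u)) - k u" for u
  have F': "(F has_vector_derivative f u) (at u)" if u: "u > 0" for u
  proof -
    have 1: "((\<lambda>u. sqrt u / (1 + u)) has_real_derivative (inverse (sqrt u) / 2 * (1 + u) - sqrt u * 1) / ((1 + u) * (1 + u))) (at u)"
      using u by (auto intro!: derivative_eq_intros)
    have 0: "((\<lambda>u. \<i> * of_real (\<mu> * ln u)) has_vector_derivative \<i> * of_real (\<mu> * (1 / u))) (at u)"
      using u by (intro has_vector_derivative_mult_right has_vector_derivative_of_real)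
        (auto intro!: derivative_eq_intros simp flip: has_real_derivative_iff_has_vector_derivative)
    have 2: "((\<lambda>u. exp (\<i> * of_real (\<mu> * ln u))) has_vector_derivative (\<i> * of_real (\<mu> * (1 / u))) * exp (\<i> * of_real (\<mu> * ln u))) (at u)"
      using field_vector_diff_chain_at[OF 0 DERIV_exp] by (simp only: comp_def)
    have "(F has_vector_derivative complex_of_real (sqrt u / (1 + u)) * ((\<i> * of_real (\<mu> * (1 / u))) * exp (\<i> * of_real (\<mu> * ln u)))
        + of_real ((inverse (sqrt u) / 2 * (1 + u) - sqrt u * 1) / ((1 + u) * (1 + u))) * exp (\<i> * of_real (\<mu> * ln u))) (at u)"
      unfolding F_def
      by (intro has_vector_derivative_mult 2 has_vector_derivative_of_real 1)
    moreover have "complex_of_real (sqrt u / (1 + u)) * ((\<i> * of_real (\<mu> * (1 / u))) * exp (\<i> * of_real (\<mu> * ln u)))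
        + of_real ((inverse (sqrt u) / 2 * (1 + u) - sqrt u * 1) / ((1 + u) * (1 + u))) * exp (\<i> * of_real (\<mu> * ln u)) = f u"
    proof -
      \<comment> \<open>With u = q^2 the identity concerns rational functions of q, and its real and
        imaginary parts can be cleared of denominators.\<close>
      define q where "q = sqrt u"
      have q: "q > 0" "u = q * q" using u by (auto simp: q_def)
      have nz: "1 + q * q > 0" by (simp add: add_pos_nonneg)
      have p: "mellin_fun \<mu> u = of_real (1 / q) * exp (\<i> * of_real (\<mu> * ln u))"
        using u by (simp add: mellin_fun_def q_def cis_conv_exp)
      have a: "complex_of_real (q / (1 + q * q)) * (\<i> * of_real (\<mu> * (1 / (q * q)))) + of_real ((inverse q / 2 * (1 + q * q) - q * 1) / ((1 + q * q) * (1 + q * q)))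
        = s * (of_real (1 / q) / of_real (1 + q * q)) - of_real (q * q / (1 + q * q)) * (of_real (1 / q) / of_real (1 + q * q))"
      proof (rule complex_eqI)
        show "Re (complex_of_real (q / (1 + q * q)) * (\<i> * of_real (\<mu> * (1 / (q * q)))) + of_real ((inverse q / 2 * (1 + q * q) - q * 1) / ((1 + q * q) * (1 + q * q))))
         = Re (s * (of_real (1 / q) / of_real (1 + q * q)) - of_real (q * q / (1 + q * q)) * (of_real (1 / q) / of_real (1 + q * q)))"
          unfolding of_real_divide[symmetric] of_real_mult[symmetric]
          using q nz by (simp add: s_def divide_simps del: of_real_divide of_real_mult)
        show "Im (complex_of_real (q / (1 + q * q)) * (\<i> * of_real (\<mu> * (1 / (q * q)))) + of_real ((inverse q / 2 * (1 + q * q) - q * 1) / ((1 + q * q) * (1 + q * q))))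
         = Im (s * (of_real (1 / q) / of_real (1 + q * q)) - of_real (q * q / (1 + q * q)) * (of_real (1 / q) / of_real (1 + q * q)))"
          unfolding of_real_divide[symmetric] of_real_mult[symmetric]
          using q nz by (simp add: s_def divide_simps del: of_real_divide of_real_mult)
      qed
      show ?thesis
        using arg_cong[OF a, of "\<lambda>z. z * exp (\<i> * of_real (\<mu> * ln u))"]
        unfolding f_def k_def p q_def[symmetric] by (simp only: q(2)[symmetric]) (simp add: algebra_simps)
    qed
    ultimately show ?thesis by simp
  qed
  have phi: "integrable lborel (\<lambda>u. mellin_fun \<mu> u / of_real (1 + u))"
    by (rule mellin_fun_kernel_integrable) simp
  have k_le: "cmod (k u) \<le> indicator {0<..} u * (sqrt 1 / (sqrt u * (1 + u)))" for u
  proof (cases "u > 0")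
    case True
    then have "cmod (k u) = u / (1 + u) * (1 / (sqrt u * (1 + u)))"
      unfolding k_def norm_mult norm_divide norm_of_real norm_mellin_fun by simp
    also have "\<dots> \<le> 1 * (1 / (sqrt u * (1 + u)))"
      using True by (intro mult_right_mono) auto
    finally show ?thesis using True by simp
  qed (simp add: k_def mellin_fun_def)
  have int1: "integrable lborel (\<lambda>u. indicator {0<..} u * (sqrt 1 / (sqrt u * (1 + u))))"
    by (rule Hilbert_kernel_integral) simp
  have k: "integrable lborel k"
  proof (rule Bochner_Integration.integrable_bound[OF int1])
    show "k \<in> borel_measurable lborel" unfolding k_def by measurable
    show "AE u in lborel. norm (k u) \<le> norm (indicator {0<..} u * (sqrt 1 / (sqrt u * (1 + u))))"
      unfolding real_norm_def by (intro AE_I2 order_trans[OF k_le abs_ge_self])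
  qed
  have f: "integrable lborel f"
    unfolding f_def[abs_def] by (intro Bochner_Integration.integrable_diff integrable_mult_right phi k)
  have norm_F: "cmod (F u) \<le> sqrt u / (1 + u)" if "u > 0" for u
    using that by (simp add: F_def norm_mult norm_divide del: of_real_add)
  have "(LBINT u=ereal 0..\<infinity>. f u) = 0 - 0"
  proof (rule interval_integral_FTC_integrable[where F=F])
    show "isCont f u" if "ereal 0 < ereal u" for u
    proof -
      have u: "u > 0" using that by simp
      have c: "of_real (1 + u) \<noteq> (0::complex)" using u by (simp del: of_real_add)
      have "isCont (\<lambda>u. s * ((of_real (1 / sqrt u) * cis (\<mu> * ln u)) / of_real (1 + u))
        - of_real (u / (1 + u)) * ((of_real (1 / sqrt u) * cis (\<mu> * ln u)) / of_real (1 + u))) u"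
        unfolding cis_conv_exp using u c by (intro continuous_intros) auto
      moreover have "\<forall>\<^sub>F v in nhds u. f v = s * ((of_real (1 / sqrt v) * cis (\<mu> * ln v)) / of_real (1 + v))
        - of_real (v / (1 + v)) * ((of_real (1 / sqrt v) * cis (\<mu> * ln v)) / of_real (1 + v))"
        using eventually_nhds_in_open[of "{0<..}" u] u
        by (auto elim!: eventually_mono simp: f_def k_def mellin_fun_def)
      ultimately show ?thesis by (simp only: isCont_cong)
    qed
    show "set_integrable lborel (einterval (ereal 0) \<infinity>) f"
      unfolding set_integrable_def by (rule integrable_mult_indicator[OF _ f]) simp
    have "((\<lambda>u. sqrt u / (1 + u)) \<longlongrightarrow> sqrt 0 / (1 + 0)) (at_right 0)"
      by (intro tendsto_intros) auto
    then have "(F \<longlongrightarrow> 0) (at_right 0)"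
      by (intro Lim_null_comparison[of F]) (use norm_F in \<open>auto simp: eventually_at_right_less elim: eventually_mono[OF eventually_at_right_less]\<close>)
    then show "((F \<circ> real_of_ereal) \<longlongrightarrow> 0) (at_right (ereal 0))" by (simp add: ereal_tendsto_simps)
    have "((\<lambda>u. 1 / sqrt u) \<longlongrightarrow> 0) at_top"
      by (intro real_tendsto_divide_at_top[OF tendsto_const] sqrt_at_top)
    moreover have "cmod (F u) \<le> 1 / sqrt u" if "u > 0" for u
    proof -
      have "sqrt u / (1 + u) \<le> 1 / sqrt u" using that by (simp add: divide_simps)
      then show ?thesis using norm_F[OF that] by linarith
    qed
    ultimately have "(F \<longlongrightarrow> 0) at_top"
      by (intro Lim_null_comparison[of F "\<lambda>u. 1 / sqrt u"]) (auto elim: eventually_mono[OF eventually_gt_at_top[of 0]])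
    then show "((F \<circ> real_of_ereal) \<longlongrightarrow> 0) (at_left \<infinity>)" by (simp add: ereal_tendsto_simps)
  qed (use F' in auto)
  moreover have "(LBINT u=ereal 0..\<infinity>. f u) = (LINT u|lborel. f u)"
    by (auto simp: interval_lebesgue_integral_def set_lebesgue_integral_def f_def k_def mellin_fun_def indicator_def intro!: Bochner_Integration.integral_cong)
  ultimately have "s * (LINT u|lborel. mellin_fun \<mu> u / of_real (1 + u)) = (LINT u|lborel. k u)"
    unfolding f_def
    using Bochner_Integration.integral_diff[OF integrable_mult_right[OF phi, of s] k]
    by (simp only: integral_mult_right_zero right_minus_eq diff_zero)
  moreover have "cmod (LINT u|lborel. k u) \<le> pi"
    using Bochner_Integration.integral_norm_bound_integral[OF k int1 k_le] Hilbert_kernel_integral(2)[of 1] by simp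
  ultimately have "cmod s * (pi * cmod (carleman_symbol \<mu>)) \<le> pi"
    by (simp add: carleman_symbol_def norm_divide norm_mult[symmetric])
  then have "cmod s * cmod (carleman_symbol \<mu>) \<le> 1" by simp
  moreover have "\<bar>\<mu>\<bar> \<le> cmod s" using abs_Im_le_cmod[of s] by (simp add: s_def)
  ultimately have "\<bar>\<mu>\<bar> * cmod (carleman_symbol \<mu>) \<le> 1"
    by (meson mult_right_mono norm_ge_zero order_trans)
  then show ?thesis using \<mu> by (simp add: field_simps)
qed

section \<open>Weyl sequences and the spectrum\<close>

text \<open>Only the singularity at 0 is approached; stopping at 1 keeps the L1 norm at most 2,
  while the squared L2 norm -ln \<delta> diverges.\<close>

definition weyl_fun :: "real \<Rightarrow> real \<Rightarrow> real \<Rightarrow> complex" where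
  "weyl_fun \<delta> \<mu> u = of_real (indicator {\<delta><..<1} u) * mellin_fun \<mu> u"

lemma weyl_fun_measurable [measurable]: "weyl_fun \<delta> \<mu> \<in> borel_measurable borel"
  unfolding weyl_fun_def[abs_def] by measurable

lemma norm_weyl_fun: "0 \<le> \<delta> \<Longrightarrow> cmod (weyl_fun \<delta> \<mu> u) = indicator {\<delta><..<1} u * (1 / sqrt u)"
  by (auto simp: weyl_fun_def norm_mult norm_mellin_fun indicator_def)

lemma weyl_fun_L2plus:
  assumes \<delta>: "0 < \<delta>" "\<delta> < 1"
  shows "weyl_fun \<delta> \<mu> \<in> L2plus" "(norm (cls (weyl_fun \<delta> \<mu>)))\<^sup>2 = - ln \<delta>"
proof -
  have eq: "(cmod (weyl_fun \<delta> \<mu> u))\<^sup>2 = indicator {\<delta><..<1} u * (1 / u)" for u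
    using \<delta> by (auto simp: norm_weyl_fun power_divide indicator_def)
  show L2: "weyl_fun \<delta> \<mu> \<in> L2plus"
  proof (rule L2plus_I)
    show "integrable lborel (\<lambda>t. (cmod (weyl_fun \<delta> \<mu> t))\<^sup>2)"
      unfolding eq by (rule integral_inverse_interval) fact+
  qed (use \<delta> in \<open>auto simp: weyl_fun_def\<close>)
  have "0 \<le> (LINT t|lborel. (cmod (weyl_fun \<delta> \<mu> t))\<^sup>2)" by simp
  then show "(norm (cls (weyl_fun \<delta> \<mu>)))\<^sup>2 = - ln \<delta>"
    unfolding norm_cls[OF L2] L2norm_def
    by (simp only: real_sqrt_pow2) (simp add: eq integral_inverse_interval(2)[OF \<delta>] del: times_divide_eq_right)
qed

lemma weyl_fun_integrable:
  assumes \<delta>: "0 < \<delta>" "\<delta> < 1"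
  shows "integrable lborel (weyl_fun \<delta> \<mu>)" "(LINT u|lborel. cmod (weyl_fun \<delta> \<mu> u)) \<le> 2"
proof -
  have eq: "cmod (weyl_fun \<delta> \<mu> u) = indicator {\<delta><..<1} u * (1 / sqrt u)" for u
    using \<delta> by (simp add: norm_weyl_fun)
  have "integrable lborel (\<lambda>u. cmod (weyl_fun \<delta> \<mu> u))"
    unfolding eq using \<delta> by (intro integrable_inverse_sqrt) auto
  then show "integrable lborel (weyl_fun \<delta> \<mu>)" by (rule integrable_norm_cancel) measurable
  show "(LINT u|lborel. cmod (weyl_fun \<delta> \<mu> u)) \<le> 2"
    unfolding eq using \<delta> by (subst integrable_inverse_sqrt(2)) auto
qed

text \<open>The Carleman operator applied to \<open>weyl_fun\<close>, as a pointwise integral; it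
  has this meaning for t > 0, and \<open>weyl_error\<close> restricts to that range.\<close>

definition carleman_weyl :: "real \<Rightarrow> real \<Rightarrow> real \<Rightarrow> complex" where
  "carleman_weyl \<delta> \<mu> t = (LINT u|lborel. weyl_fun \<delta> \<mu> u / of_real (t + u))"

lemma carleman_weyl_measurable [measurable]: "carleman_weyl \<delta> \<mu> \<in> borel_measurable borel"
  unfolding carleman_weyl_def[abs_def] by measurable

lemma weyl_fun_kernel_integrable:
  assumes t: "t > 0"
  shows "integrable lborel (\<lambda>u. weyl_fun \<delta> \<mu> u / of_real (t + u))"
  by (rule Bochner_Integration.integrable_bound[OF mellin_fun_kernel_integrable[OF t, of \<mu>]])
     (auto simp: weyl_fun_def norm_divide norm_mult indicator_def simp del: of_real_add)

text \<open>The first bound replaces t + u by t and is meant for t beyond 1; the second replaces it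
  by u and is meant for t up to \<delta>.\<close>

lemma carleman_weyl_le:
  assumes \<delta>: "0 < \<delta>" "\<delta> < 1" and t: "t > 0"
  shows "cmod (carleman_weyl \<delta> \<mu> t) \<le> 2 / t" "cmod (carleman_weyl \<delta> \<mu> t) \<le> 2 / sqrt \<delta>"
proof -
  have n: "norm (weyl_fun \<delta> \<mu> u / of_real (t + u)) = indicator {\<delta><..<1} u * (1 / (sqrt u * (t + u)))" for u
    using \<delta> t unfolding norm_divide norm_of_real by (auto simp: norm_weyl_fun indicator_def)
  have "cmod (carleman_weyl \<delta> \<mu> t) \<le> (LINT u|lborel. 1 / t * (indicator {0<..<1} u * (1 / sqrt u)))"
    unfolding carleman_weyl_def
  proof (rule Bochner_Integration.integral_norm_bound_integral)
    show "norm (weyl_fun \<delta> \<mu> u / of_real (t + u)) \<le> 1 / t * (indicator {0<..<1} u * (1 / sqrt u))" for u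
      unfolding n using \<delta> t by (auto simp: indicator_def divide_simps mult_left_mono mult_less_0_iff)
  qed (intro weyl_fun_kernel_integrable integrable_mult_right integrable_inverse_sqrt t; simp)+
  also have "\<dots> = 1 / t * (2 * sqrt 1 - 2 * sqrt 0)"
    unfolding integral_mult_right_zero by (subst integrable_inverse_sqrt(2)) auto
  also have "\<dots> = 2 / t" by simp
  finally show "cmod (carleman_weyl \<delta> \<mu> t) \<le> 2 / t" .
  have "cmod (carleman_weyl \<delta> \<mu> t) \<le> (LINT u|lborel. indicator {\<delta><..} u * (1 / (u * sqrt u)))"
    unfolding carleman_weyl_def
  proof (rule Bochner_Integration.integral_norm_bound_integral)
    show "norm (weyl_fun \<delta> \<mu> u / of_real (t + u)) \<le> indicator {\<delta><..} u * (1 / (u * sqrt u))" for u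
      unfolding n using \<delta> t by (auto simp: indicator_def divide_simps mult_less_0_iff)
  qed (intro weyl_fun_kernel_integrable integrable_inverse_u_sqrt t \<delta>)+
  also have "\<dots> = 2 / sqrt \<delta>" by (rule integrable_inverse_u_sqrt) fact
  finally show "cmod (carleman_weyl \<delta> \<mu> t) \<le> 2 / sqrt \<delta>" .
qed

text \<open>The full power is an exact eigenfunction, so the error comes from the two missing tails:
  on the lower one t + u is replaced by t, on the upper one by u. The estimate is used for t between
  \<delta> and 1.\<close>

lemma carleman_weyl_approx:
  assumes \<delta>: "0 < \<delta>" "\<delta> < 1" and t: "t > 0"
  shows "cmod (carleman_weyl \<delta> \<mu> t - of_real pi * carleman_symbol \<mu> * mellin_fun \<mu> t) \<le> 4 * sqrt \<delta> / t + 4"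
proof -
  \<comment> \<open>The tails are enlarged to the open intervals up to 4 \<delta> and from 1/4,
    which contain the endpoints \<delta> and 1 and have convenient square roots.\<close>
  have n: "norm ((weyl_fun \<delta> \<mu> u - mellin_fun \<mu> u) / of_real (t + u)) \<le> 1 / t * (indicator {0<..<4 * \<delta>} u * (1 / sqrt u))
        + indicator {1 / 4<..} u * (1 / (u * sqrt u))" for u
  proof -
    consider "u \<le> 0" | "0 < u" "u \<le> \<delta>" | "\<delta> < u" "u < 1" | "1 \<le> u" by linarith
    then show ?thesis
    proof cases
      case 1
      then show ?thesis using \<delta> by (auto simp: weyl_fun_def mellin_fun_def indicator_def)
    next
      case 2
      have "norm ((weyl_fun \<delta> \<mu> u - mellin_fun \<mu> u) / of_real (t + u)) = 1 / (sqrt u * (t + u))"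
        unfolding norm_divide norm_of_real using 2 t \<delta> by (simp add: weyl_fun_def norm_mellin_fun)
      also have "\<dots> \<le> 1 / t * (1 / sqrt u)"
        using 2 t by (simp add: divide_simps)
      also have "\<dots> \<le> 1 / t * (indicator {0<..<4 * \<delta>} u * (1 / sqrt u)) + indicator {1 / 4<..} u * (1 / (u * sqrt u))"
        using 2 \<delta> by (simp add: indicator_def)
      finally show ?thesis .
    next
      case 3
      then show ?thesis using \<delta> t by (auto simp: weyl_fun_def indicator_def)
    next
      case 4
      have "norm ((weyl_fun \<delta> \<mu> u - mellin_fun \<mu> u) / of_real (t + u)) = 1 / (sqrt u * (t + u))"
        unfolding norm_divide norm_of_real using 4 t \<delta> by (simp add: weyl_fun_def norm_mellin_fun)
      also have "\<dots> \<le> 1 / (u * sqrt u)"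
        using 4 t by (simp add: divide_simps)
      also have "\<dots> \<le> 1 / t * (indicator {0<..<4 * \<delta>} u * (1 / sqrt u)) + indicator {1 / 4<..} u * (1 / (u * sqrt u))"
        using 4 \<delta> t by (simp add: indicator_def)
      finally show ?thesis .
    qed
  qed
  have int: "integrable lborel (\<lambda>u. 1 / t * (indicator {0<..<4 * \<delta>} u * (1 / sqrt u)))"
    "integrable lborel (\<lambda>u. indicator {1 / 4<..} u * (1 / (u * sqrt u)))"
    using \<delta> by (intro integrable_mult_right integrable_inverse_sqrt integrable_inverse_u_sqrt; simp)+
  have eq: "carleman_weyl \<delta> \<mu> t - of_real pi * carleman_symbol \<mu> * mellin_fun \<mu> t = (LINT u|lborel. (weyl_fun \<delta> \<mu> u - mellin_fun \<mu> u) / of_real (t + u))"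
    unfolding carleman_weyl_def mellin_fun_kernel_integral[OF t, symmetric] diff_divide_distrib
    by (rule Bochner_Integration.integral_diff[symmetric]; intro weyl_fun_kernel_integrable mellin_fun_kernel_integrable t)
  have "cmod (carleman_weyl \<delta> \<mu> t - of_real pi * carleman_symbol \<mu> * mellin_fun \<mu> t) \<le> (LINT u|lborel. 1 / t * (indicator {0<..<4 * \<delta>} u * (1 / sqrt u)) + indicator {1 / 4<..} u * (1 / (u * sqrt u)))"
    unfolding eq
  proof (rule Bochner_Integration.integral_norm_bound_integral[OF _ _ n])
    show "integrable lborel (\<lambda>u. (weyl_fun \<delta> \<mu> u - mellin_fun \<mu> u) / of_real (t + u))"
      unfolding diff_divide_distrib
      by (intro Bochner_Integration.integrable_diff weyl_fun_kernel_integrable mellin_fun_kernel_integrable t)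
    show "integrable lborel (\<lambda>u. 1 / t * (indicator {0<..<4 * \<delta>} u * (1 / sqrt u)) + indicator {1 / 4<..} u * (1 / (u * sqrt u)))"
      by (rule Bochner_Integration.integrable_add[OF int])
  qed
  also have "\<dots> = 1 / t * (2 * sqrt (4 * \<delta>) - 2 * sqrt 0) + 2 / sqrt (1 / 4)"
  proof -
    have a: "(LINT u|lborel. indicator {0<..<4 * \<delta>} u * (1 / sqrt u)) = 2 * sqrt (4 * \<delta>) - 2 * sqrt 0"
      by (rule integrable_inverse_sqrt(2)) (use \<delta> in auto)
    have b: "(LINT u|lborel. indicator {1 / 4<..} u * (1 / (u * sqrt u))) = 2 / sqrt (1 / 4)"
      by (rule integrable_inverse_u_sqrt(2)) simp
    show ?thesis
      unfolding Bochner_Integration.integral_add[OF int] integral_mult_right_zero a b by (rule refl)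
  qed
  also have "\<dots> = 4 * sqrt \<delta> / t + 4"
  proof -
    have "sqrt (4 * \<delta>) = 2 * sqrt \<delta>" "sqrt (1 / 4) = (1 / 2 :: real)"
      by (simp_all add: real_sqrt_mult real_sqrt_divide)
    then show ?thesis by (simp only:) simp
  qed
  finally show ?thesis .
qed

definition weyl_error :: "real \<Rightarrow> real \<Rightarrow> real \<Rightarrow> complex" where
  "weyl_error \<delta> \<mu> t = of_real (indicator {0<..} t) * (carleman_weyl \<delta> \<mu> t - of_real pi * carleman_symbol \<mu> * weyl_fun \<delta> \<mu> t)"

text \<open>The point is uniformity in \<delta>: the error stays bounded while
  \<open>weyl_fun\<close> grows. Each of the three ranges of t contributes a bounded amount although
  the pointwise bounds blow up with \<delta>.\<close>

lemma weyl_error_L2plus: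
  assumes \<delta>: "0 < \<delta>" "\<delta> < 1"
  shows "weyl_error \<delta> \<mu> \<in> L2plus" "norm (cls (weyl_error \<delta> \<mu>)) \<le> 9"
proof -
  \<comment> \<open>The first two terms come from (4 sqrt \<delta> / t + 4)^2 <= 32 \<delta> / t^2 +
    32 in the middle range, the others from squaring 2 / t and 2 / sqrt \<delta>. The integrals 32,
    32, 4 and 4 add up to 72, below 9^2.\<close>
  define D where "D t = 32 * \<delta> * (indicator {\<delta><..} t * (1 / t\<^sup>2)) + 32 * indicator {0..1} t
    + 4 * (indicator {1<..} t * (1 / t\<^sup>2)) + 4 / \<delta> * indicator {0..\<delta>} t" for t :: real
  have int: "integrable lborel (\<lambda>t. 32 * \<delta> * (indicator {\<delta><..} t * (1 / t\<^sup>2)))"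
    "integrable lborel (\<lambda>t. 32 * indicator {0..1::real} t :: real)"
    "integrable lborel (\<lambda>t::real. 4 * (indicator {1<..} t * (1 / t\<^sup>2)))"
    "integrable lborel (\<lambda>t. 4 / \<delta> * indicator {0..\<delta>} t)"
    using \<delta> by (intro integrable_mult_right integrable_inverse_square integrable_real_indicator; simp)+
  have D: "integrable lborel D"
    unfolding D_def[abs_def] by (intro Bochner_Integration.integrable_add int)
  have vals: "(LINT t|lborel. indicator {\<delta><..} t * (1 / t\<^sup>2)) = 1 / \<delta>"
    "(LINT t|lborel. indicator {1<..} t * (1 / t\<^sup>2)) = (1 / 1 :: real)"
    "(LINT t|lborel. indicator {0..1::real} t) = (1 :: real)" "(LINT t|lborel. indicator {0..\<delta>} t) = \<delta>"
    using \<delta> integrable_inverse_square(2)[of \<delta>] integrable_inverse_square(2)[of 1] by simp_all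
  have "(LINT t|lborel. D t) = 32 * \<delta> * (1 / \<delta>) + 32 * 1 + 4 * (1 / 1) + 4 / \<delta> * \<delta>"
    unfolding D_def
    by (simp only: Bochner_Integration.integral_add Bochner_Integration.integrable_add int
        integral_mult_right_zero vals)
  then have D72: "(LINT t|lborel. D t) = 72" using \<delta> by simp
  have E_le: "(cmod (weyl_error \<delta> \<mu> t))\<^sup>2 \<le> D t" for t
  proof -
    have nn: "0 \<le> 32 * \<delta> * (indicator {\<delta><..} t * (1 / t\<^sup>2))" "(0::real) \<le> 32 * indicator {0..1} t"
      "0 \<le> 4 * (indicator {1<..} t * (1 / t\<^sup>2))" "0 \<le> 4 / \<delta> * indicator {0..\<delta>} t"
      using \<delta> by auto
    consider "t \<le> 0" | "0 < t" "t \<le> \<delta>" | "\<delta> < t" "t < 1" | "1 \<le> t" by linarith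
    then show ?thesis
    proof cases
      case 1
      then have "weyl_error \<delta> \<mu> t = 0" by (simp add: weyl_error_def)
      then show ?thesis using nn by (simp add: D_def)
    next
      case 2
      then have "weyl_error \<delta> \<mu> t = carleman_weyl \<delta> \<mu> t" by (simp add: weyl_error_def weyl_fun_def)
      then have "(cmod (weyl_error \<delta> \<mu> t))\<^sup>2 \<le> (2 / sqrt \<delta>)\<^sup>2"
        using carleman_weyl_le(2)[OF \<delta> 2(1), of \<mu>] by (simp add: power_mono)
      also have "\<dots> = 4 / \<delta> * indicator {0..\<delta>} t" using 2 \<delta> by (simp add: power_divide)
      also have "\<dots> \<le> D t" using nn by (simp add: D_def)
      finally show ?thesis .
    next
      case 3
      then have t: "t > 0" using \<delta> by simp
      have "weyl_error \<delta> \<mu> t = carleman_weyl \<delta> \<mu> t - of_real pi * carleman_symbol \<mu> * mellin_fun \<mu> t"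
        using 3 t by (simp add: weyl_error_def weyl_fun_def)
      then have "(cmod (weyl_error \<delta> \<mu> t))\<^sup>2 \<le> (4 * sqrt \<delta> / t + 4)\<^sup>2"
        using carleman_weyl_approx[OF \<delta> t, of \<mu>] by (simp add: power_mono)
      also have "\<dots> \<le> 2 * (4 * sqrt \<delta> / t)\<^sup>2 + 2 * 4\<^sup>2"
        using sum_squares_bound[of "4 * sqrt \<delta> / t" 4] unfolding power2_sum by linarith
      also have "\<dots> = 32 * \<delta> * (indicator {\<delta><..} t * (1 / t\<^sup>2)) + 32 * indicator {0..1} t"
        using 3 t \<delta> by (simp add: power_divide power_mult_distrib)
      also have "\<dots> \<le> D t" using nn by (simp add: D_def)
      finally show ?thesis .
    next
      case 4
      then have t: "t > 0" by simp
      have "weyl_error \<delta> \<mu> t = carleman_weyl \<delta> \<mu> t" using 4 by (simp add: weyl_error_def weyl_fun_def)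
      then have "(cmod (weyl_error \<delta> \<mu> t))\<^sup>2 \<le> (2 / t)\<^sup>2"
        using carleman_weyl_le(1)[OF \<delta> t, of \<mu>] by (simp add: power_mono)
      \<comment> \<open>The point t = 1 lies outside \<open>{1<..}\<close> and is absorbed by the
        constant on \<open>{0..1}\<close>.\<close>
      also have "\<dots> \<le> 4 * (indicator {1<..} t * (1 / t\<^sup>2)) + 32 * indicator {0..1} t"
        using 4 by (cases "t = 1") (simp_all add: power_divide)
      also have "\<dots> \<le> D t" using nn by (simp add: D_def)
      finally show ?thesis .
    qed
  qed
  show L2: "weyl_error \<delta> \<mu> \<in> L2plus"
  proof (rule L2plus_dominated[OF _ _ D E_le])
    show "weyl_error \<delta> \<mu> \<in> borel_measurable borel" unfolding weyl_error_def[abs_def] by measurable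
  qed (simp add: weyl_error_def)
  have "(LINT t|lborel. (cmod (weyl_error \<delta> \<mu> t))\<^sup>2) \<le> 9\<^sup>2"
    using integral_mono[OF L2plus_D(3)[OF L2] D E_le] D72 by simp
  then show "norm (cls (weyl_error \<delta> \<mu>)) \<le> 9"
    unfolding norm_cls[OF L2] L2norm_def by (intro real_le_lsqrt) auto
qed

lemma inner_cscale_cls:
  assumes "f \<in> L2plus" "g \<in> L2plus"
  shows "inner (cscale c (cls f)) (cls g) = Re (c * (LINT t|lborel. f t * cnj (g t)))"
  by (simp add: cscale_cls inner_cls L2plus_cmult assms mult.assoc)

text \<open>The square is known through its form, so the identity is tested against integrable y.
  Fubini turns the double integral into a pairing of y with \<open>carleman_weyl\<close>, which
  \<open>weyl_error\<close> splits into the eigenvalue part and the error.\<close>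

lemma FRop_FRop_weyl_fun:
  assumes \<delta>: "0 < \<delta>" "\<delta> < 1"
  shows "FRop (FRop (cls (weyl_fun \<delta> \<mu>))) - cscale (\<i> / 2 * carleman_symbol \<mu>) (cls (weyl_fun \<delta> \<mu>))
    = cscale (\<i> / (2 * of_real pi)) (cls (weyl_error \<delta> \<mu>))"
proof -
  note g = weyl_fun_L2plus(1)[OF \<delta>, of \<mu>] weyl_fun_integrable(1)[OF \<delta>, of \<mu>]
  note E = weyl_error_L2plus(1)[OF \<delta>, of \<mu>]
  define v where "v = FRop (FRop (cls (weyl_fun \<delta> \<mu>))) - cscale (\<i> / 2 * carleman_symbol \<mu>) (cls (weyl_fun \<delta> \<mu>))
    - cscale (\<i> / (2 * of_real pi)) (cls (weyl_error \<delta> \<mu>))"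
  have "v = 0"
  proof (rule l2_eq_0_test)
    fix y assume y: "y \<in> L2plus" "integrable lborel y"
    let ?g = "weyl_fun \<delta> \<mu>" and ?E = "weyl_error \<delta> \<mu>"
    have "integrable (lborel \<Otimes>\<^sub>M lborel) (\<lambda>(u, t). ?g u * cnj (y t) / of_real (u + t))"
      using Hilbert_inequality(1)[OF g(1) L2plus_cnj[OF y(1)]] by (simp add: lborel_prod split_beta')
    from lborel_pair.integral_snd[OF this]
    have "(LINT p|lborel. ?g (fst p) * cnj (y (snd p)) / of_real (fst p + snd p))
      = (LINT t|lborel. LINT u|lborel. ?g u * cnj (y t) / of_real (u + t))"
      by (simp add: lborel_prod split_beta')
    also have "\<dots> = (LINT t|lborel. ?E t * cnj (y t) + of_real pi * carleman_symbol \<mu> * (?g t * cnj (y t)))"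
    proof (rule Bochner_Integration.integral_cong[OF refl])
      fix t
      have "(LINT u|lborel. ?g u * cnj (y t) / of_real (u + t)) = (LINT u|lborel. ?g u / of_real (t + u) * cnj (y t))"
        by (simp add: add.commute)
      also have "\<dots> = carleman_weyl \<delta> \<mu> t * cnj (y t)" unfolding carleman_weyl_def by (rule integral_mult_left_zero)
      also have "\<dots> = ?E t * cnj (y t) + of_real pi * carleman_symbol \<mu> * (?g t * cnj (y t))"
        using L2plus_D(2)[OF y(1), of t] by (cases "t > 0") (auto simp: weyl_error_def algebra_simps)
      finally show "(LINT u|lborel. ?g u * cnj (y t) / of_real (u + t)) = ?E t * cnj (y t) + of_real pi * carleman_symbol \<mu> * (?g t * cnj (y t))" .
    qed
    also have "\<dots> = (LINT t|lborel. ?E t * cnj (y t)) + of_real pi * carleman_symbol \<mu> * (LINT t|lborel. ?g t * cnj (y t))"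
      using L2plus_mult_cnj_integrable[OF E y(1)] L2plus_mult_cnj_integrable[OF g(1) y(1)] by simp
    finally have "inner (FRop (FRop (cls ?g))) (cls y) = Re (\<i> / (2 * of_real pi) * ((LINT t|lborel. ?E t * cnj (y t))
        + of_real pi * carleman_symbol \<mu> * (LINT t|lborel. ?g t * cnj (y t))))"
      unfolding FRop_FRop_form[OF g y] by (simp only:)
    also have "\<i> / (2 * of_real pi) * ((LINT t|lborel. ?E t * cnj (y t)) + of_real pi * carleman_symbol \<mu> * (LINT t|lborel. ?g t * cnj (y t)))
      = \<i> / (2 * of_real pi) * (LINT t|lborel. ?E t * cnj (y t)) + \<i> / 2 * carleman_symbol \<mu> * (LINT t|lborel. ?g t * cnj (y t))"
      by (simp add: distrib_left)
    finally show "inner v (cls y) = 0"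
      unfolding v_def inner_diff_left inner_cscale_cls[OF g(1) y(1)] inner_cscale_cls[OF E y(1)]
      by (simp only: plus_complex.simps)
  qed
  then show ?thesis by (simp add: v_def)
qed

text \<open>Exponential cutoffs make the squared norm the integer n + 1; the successor keeps the
  cutoff strictly below 1.\<close>

definition weyl_vec :: "real \<Rightarrow> nat \<Rightarrow> l2" where
  "weyl_vec \<mu> n = cls (weyl_fun (exp (- real (Suc n))) \<mu>)"

lemma norm_weyl_vec: "(norm (weyl_vec \<mu> n))\<^sup>2 = real (Suc n)"
  using weyl_fun_L2plus(2)[of "exp (- real (Suc n))" \<mu>] by (simp add: weyl_vec_def)

lemma norm_weyl_vec_at_top: "filterlim (\<lambda>n. norm (weyl_vec \<mu> n)) at_top sequentially"
proof -
  have "norm (weyl_vec \<mu> n) = sqrt (real (Suc n))" for n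
    using norm_weyl_vec[of \<mu> n] by (metis norm_ge_zero real_sqrt_unique)
  moreover have "filterlim (\<lambda>n. sqrt (real (Suc n))) at_top sequentially"
    by (intro filterlim_compose[OF sqrt_at_top] filterlim_compose[OF filterlim_real_sequentially] filterlim_Suc)
  ultimately show ?thesis by simp
qed

lemma FRop_FRop_weyl_vec: "norm (FRop (FRop (weyl_vec \<mu> n)) - cscale (\<i> / 2 * carleman_symbol \<mu>) (weyl_vec \<mu> n)) \<le> 4"
proof -
  let ?\<delta> = "exp (- real (Suc n))"
  have \<delta>: "0 < ?\<delta>" "?\<delta> < 1" by auto
  have "norm (FRop (FRop (weyl_vec \<mu> n)) - cscale (\<i> / 2 * carleman_symbol \<mu>) (weyl_vec \<mu> n)) = 1 / (2 * pi) * norm (cls (weyl_error ?\<delta> \<mu>))"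
    unfolding weyl_vec_def FRop_FRop_weyl_fun[OF \<delta>] norm_cscale by (simp add: norm_divide norm_mult)
  also have "\<dots> \<le> 1 / (2 * pi) * 9"
    using weyl_error_L2plus(2)[OF \<delta>, of \<mu>] by (intro mult_left_mono) auto
  \<comment> \<open>Already 9/4 would do; 4 matches the bound on <T g, g>, so that one constant
    serves all hypotheses of \<open>no_resolvent_bound\<close>.\<close>
  also have "\<dots> \<le> 4" using pi_ge_two by (simp add: divide_simps)
  finally show ?thesis .
qed

text \<open>The numerical range of T^2 is purely imaginary. A nonzero imaginary part of the symbol
  would give (T^2 - \<i> w / 2) g a real product with g that is quadratic in the norm of g, whereas
  the bounded error allows only linear growth.\<close>

lemma carleman_symbol_real: "Im (carleman_symbol \<mu>) = 0"
proof (rule ccontr)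
  assume nz: "Im (carleman_symbol \<mu>) \<noteq> 0"
  have "\<bar>Im (carleman_symbol \<mu>)\<bar> * norm (weyl_vec \<mu> n) \<le> 8" for n
  proof -
    let ?g = "weyl_vec \<mu> n"
    have pos: "norm ?g > 0" using norm_weyl_vec[of \<mu> n] by (cases "?g = 0") auto
    have "inner (cscale (\<i> / 2 * carleman_symbol \<mu>) ?g) ?g = - (Im (carleman_symbol \<mu>) / 2) * (norm ?g)\<^sup>2"
      by (simp add: cscale_def inner_add_left inner_diff_left inner_imul_self power2_norm_eq_inner)
    then have "inner (FRop (FRop ?g) - cscale (\<i> / 2 * carleman_symbol \<mu>) ?g) ?g = Im (carleman_symbol \<mu>) / 2 * (norm ?g)\<^sup>2"
      by (simp add: inner_diff_left FRop_FRop_numerical_range(1))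
    moreover have "\<bar>inner (FRop (FRop ?g) - cscale (\<i> / 2 * carleman_symbol \<mu>) ?g) ?g\<bar> \<le> 4 * norm ?g"
      by (rule order_trans[OF Cauchy_Schwarz_ineq2]) (intro mult_right_mono FRop_FRop_weyl_vec norm_ge_zero)
    ultimately have "\<bar>Im (carleman_symbol \<mu>)\<bar> / 2 * (norm ?g)\<^sup>2 \<le> 4 * norm ?g" by (simp add: abs_mult)
    then show ?thesis using pos by (simp add: power2_eq_square)
  qed
  then have "norm (weyl_vec \<mu> n) \<le> 8 / \<bar>Im (carleman_symbol \<mu>)\<bar>" for n
    using nz by (simp add: pos_le_divide_eq mult.commute)
  moreover obtain n where "8 / \<bar>Im (carleman_symbol \<mu>)\<bar> + 1 \<le> norm (weyl_vec \<mu> n)"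
    using norm_weyl_vec_at_top[of \<mu>] by (auto simp: filterlim_at_top eventually_sequentially)
  ultimately show False by (metis add_le_same_cancel1 not_one_le_zero order_trans)
qed

lemma carleman_symbol_surj:
  assumes \<alpha>: "0 < \<alpha>" "\<alpha> \<le> 1"
  shows "\<exists>\<mu>. carleman_symbol \<mu> = of_real \<alpha>"
proof -
  \<comment> \<open>The decay estimate at \<mu> = 1 / \<alpha> pushes the symbol down to \<alpha>,
    which gives the second endpoint for the intermediate value theorem.\<close>
  have "\<bar>Re (carleman_symbol (1 / \<alpha>))\<bar> \<le> \<alpha>"
    using carleman_symbol_decay[of "1 / \<alpha>"] abs_Re_le_cmod[of "carleman_symbol (1 / \<alpha>)"] \<alpha> by simp
  moreover have "continuous_on {0..1 / \<alpha>} (\<lambda>\<mu>. Re (carleman_symbol \<mu>))"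
    by (intro continuous_on_Re continuous_on_subset[OF continuous_carleman_symbol]) auto
  ultimately obtain \<mu> where "Re (carleman_symbol \<mu>) = \<alpha>"
    using IVT2'[of "\<lambda>\<mu>. Re (carleman_symbol \<mu>)" "1 / \<alpha>" \<alpha> 0] \<alpha> by (force simp: carleman_symbol_0 abs_le_iff)
  then show ?thesis using carleman_symbol_real[of \<mu>] by (auto simp: complex_eq_iff)
qed

text \<open>The L1 norm at most 2 is used twice, for the supremum of the Fourier integral and for
  the pairing. The unimodular factor c = 1 or \<i> yields both parts of the complex product.\<close>

lemma FRop_weyl_vec_inner:
  "\<bar>inner (FRop (weyl_vec \<mu> n)) (weyl_vec \<mu> n)\<bar> \<le> 4" "\<bar>inner (FRop (weyl_vec \<mu> n)) (imul (weyl_vec \<mu> n))\<bar> \<le> 4"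
proof -
  let ?\<delta> = "exp (- real (Suc n))"
  let ?g = "weyl_fun ?\<delta> \<mu>"
  have \<delta>: "0 < ?\<delta>" "?\<delta> < 1" by auto
  note g = weyl_fun_L2plus(1)[OF \<delta>, of \<mu>] weyl_fun_integrable[OF \<delta>, of \<mu>]
  have *: "\<bar>inner (FRop (cls ?g)) (cls (\<lambda>t. c * ?g t))\<bar> \<le> 4" if c: "cmod c = 1" for c
  proof -
    have cg: "(\<lambda>t. c * ?g t) \<in> L2plus" by (intro L2plus_cmult g)
    have "\<bar>inner (FRop (cls ?g)) (cls (\<lambda>t. c * ?g t))\<bar> \<le> cmod (LINT t|lborel. FRint ?g t * cnj (c * ?g t))"
      unfolding FRop_cls[OF g(1,2)] inner_cls[OF FRint_L2plus(1)[OF g(1,2)] cg] by (rule abs_Re_le_cmod)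
    also have "\<dots> \<le> (LINT t|lborel. 2 * cmod (?g t))"
    proof (rule Bochner_Integration.integral_norm_bound_integral)
      show "integrable lborel (\<lambda>t. FRint ?g t * cnj (c * ?g t))"
        by (intro L2plus_mult_cnj_integrable FRint_L2plus g cg)
      show "integrable lborel (\<lambda>t. 2 * cmod (?g t))"
        by (intro integrable_mult_right integrable_norm g)
      show "norm (FRint ?g t * cnj (c * ?g t)) \<le> 2 * cmod (?g t)" for t
        unfolding norm_mult complex_mod_cnj c
        using order_trans[OF norm_FRint_le[of ?g t] g(3)] by (simp add: mult_right_mono)
    qed
    also have "\<dots> = 2 * (LINT t|lborel. cmod (?g t))" by simp
    also have "\<dots> \<le> 4" using g(3) by simp
    finally show ?thesis .
  qed
  show "\<bar>inner (FRop (weyl_vec \<mu> n)) (weyl_vec \<mu> n)\<bar> \<le> 4"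
    using *[of 1] by (simp add: weyl_vec_def)
  show "\<bar>inner (FRop (weyl_vec \<mu> n)) (imul (weyl_vec \<mu> n))\<bar> \<le> 4"
    using *[of \<i>] unfolding weyl_vec_def imul_cls[OF g(1)] by simp
qed

text \<open>Both square roots are covered at once, since z enters the Weyl estimates through z^2
  alone.\<close>

lemma no_bound_nonzero:
  assumes "0 < \<alpha>" "\<alpha> \<le> 1" "z\<^sup>2 = \<i> / 2 * of_real \<alpha>"
  shows "\<not> (\<exists>C. \<forall>x. norm x \<le> C * norm (FRop x - cscale z x))"
proof -
  obtain \<mu> where \<mu>: "carleman_symbol \<mu> = of_real \<alpha>" using carleman_symbol_surj assms by blast
  have "z \<noteq> 0" using assms by auto
  then show ?thesis
  proof (rule no_resolvent_bound[OF bounded_linear_FRop FRop_imul _ norm_weyl_vec_at_top[of \<mu>] _ FRop_weyl_vec_inner])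
    show "norm (FRop (FRop (weyl_vec \<mu> n)) - cscale (z\<^sup>2) (weyl_vec \<mu> n)) \<le> 4" for n
      using FRop_FRop_weyl_vec[of \<mu> n] by (simp only: assms(3) \<mu>)
  qed
qed

section \<open>The point zero and the identification of the segment\<close>

lemma exp_i_pi_4_sq: "(exp (\<i> * of_real (pi / 4)))\<^sup>2 = \<i>"
proof -
  have "(exp (\<i> * of_real (pi / 4)))\<^sup>2 = cis (pi / 2)"
    by (simp add: power2_eq_square exp_add[symmetric] cis_conv_exp)
  then show ?thesis by simp
qed

text \<open>A lower bound at 0 survives a small perturbation, so it would hold at nonzero points of
  the segment close to 0, where it has been excluded.\<close>

lemma no_bound_zero:
  shows "\<not> (\<exists>C. \<forall>x. norm x \<le> C * norm (FRop x))"
proof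
  assume "\<exists>C. \<forall>x. norm x \<le> C * norm (FRop x)"
  then obtain C where C: "\<And>x. norm x \<le> C * norm (FRop x)" by blast
  \<comment> \<open>The size is chosen so that |C| \<rho> <= 1/2 lets the perturbation be absorbed
    and 2 \<rho>^2 <= 1 keeps z on the segment; the added 1 covers C = 0.\<close>
  define \<rho> where "\<rho> = 1 / (2 * (\<bar>C\<bar> + 1))"
  have \<rho>: "0 < \<rho>" "\<rho> \<le> 1 / 2" "\<bar>C\<bar> * \<rho> \<le> 1 / 2" by (auto simp: \<rho>_def divide_simps)
  define z where "z = of_real \<rho> * exp (\<i> * of_real (pi / 4))"
  have z2: "z\<^sup>2 = \<i> / 2 * of_real (2 * \<rho>\<^sup>2)"
    unfolding z_def power_mult_distrib exp_i_pi_4_sq by simp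
  have z_norm: "cmod z = \<rho>" using \<rho> by (simp add: z_def norm_mult)
  have "\<rho>\<^sup>2 \<le> (1 / 2)\<^sup>2" using \<rho> by (intro power_mono) auto
  then have "0 < 2 * \<rho>\<^sup>2" "2 * \<rho>\<^sup>2 \<le> 1" using \<rho> by (auto simp: power2_eq_square)
  moreover have "norm x \<le> (2 * \<bar>C\<bar>) * norm (FRop x - cscale z x)" for x
  proof -
    have "norm x \<le> \<bar>C\<bar> * norm (FRop x)"
      using C[of x] by (rule order_trans) (intro mult_right_mono; simp)
    also have "\<dots> \<le> \<bar>C\<bar> * (norm (FRop x - cscale z x) + \<rho> * norm x)"
      using norm_triangle_ineq[of "FRop x - cscale z x" "cscale z x"]
      by (intro mult_left_mono) (auto simp: norm_cscale z_norm)
    also have "\<dots> = \<bar>C\<bar> * norm (FRop x - cscale z x) + (\<bar>C\<bar> * \<rho>) * norm x"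
      by (simp add: distrib_left)
    also have "\<dots> \<le> \<bar>C\<bar> * norm (FRop x - cscale z x) + 1 / 2 * norm x"
      using \<rho> by (intro add_left_mono mult_right_mono) auto
    finally show ?thesis by simp
  qed
  ultimately show False using no_bound_nonzero[OF _ _ z2] by blast
qed

text \<open>The segment consists of the multiples s e with s between -1 and 1, where s = 2 u - 1 in
  terms of the convex parameter u, and e^2 = \<i> / 2. Conversely both roots of a (\<i> / 2) have
  this form, with s = sqrt a or its negative.\<close>

lemma segment_iff_square:
  fixes z :: complex
  defines "e \<equiv> exp (\<i> * of_real (pi / 4)) / of_real (sqrt 2)"
  shows "z \<in> closed_segment (- e) e \<longleftrightarrow> z\<^sup>2 \<in> closed_segment 0 (\<i> / 2)"
proof -
  have e2: "e\<^sup>2 = \<i> / 2"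
    unfolding e_def power_divide exp_i_pi_4_sq by (simp only: of_real_power[symmetric]) simp
  show ?thesis
  proof
    assume "z \<in> closed_segment (- e) e"
    then obtain u where u: "0 \<le> u" "u \<le> 1" "z = (1 - u) *\<^sub>R (- e) + u *\<^sub>R e"
      by (auto simp: closed_segment_def)
    then have "z = of_real (2 * u - 1) * e" by (simp add: scaleR_conv_of_real algebra_simps)
    then have "z\<^sup>2 = (2 * u - 1)\<^sup>2 *\<^sub>R (\<i> / 2)"
      by (simp add: power_mult_distrib e2 scaleR_conv_of_real)
    moreover have "(2 * u - 1)\<^sup>2 \<le> 1" using u by (simp add: abs_square_le_1)
    ultimately show "z\<^sup>2 \<in> closed_segment 0 (\<i> / 2)"
      by (auto simp: closed_segment_def intro!: exI[of _ "(2 * u - 1)\<^sup>2"] simp del: scaleR_conv_of_real)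
  next
    assume "z\<^sup>2 \<in> closed_segment 0 (\<i> / 2)"
    then obtain a where a: "0 \<le> a" "a \<le> 1" "z\<^sup>2 = a *\<^sub>R (\<i> / 2)"
      by (auto simp: closed_segment_def)
    have "(complex_of_real (sqrt a))\<^sup>2 = of_real a"
      using a by (simp only: of_real_power[symmetric]) simp
    then have "z\<^sup>2 = (of_real (sqrt a) * e)\<^sup>2"
      using a by (simp add: power_mult_distrib e2 scaleR_conv_of_real)
    then consider "z = of_real (sqrt a) * e" | "z = - (of_real (sqrt a) * e)"
      by (auto simp: power2_eq_iff)
    then obtain s where s: "\<bar>s\<bar> \<le> 1" "z = of_real s * e"
      using a by cases (auto intro: that[of "sqrt a"] that[of "- sqrt a"])
    then have "z = (1 - (1 + s) / 2) *\<^sub>R (- e) + ((1 + s) / 2) *\<^sub>R e"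
      by (simp add: scaleR_conv_of_real field_simps)
    then show "z \<in> closed_segment (- e) e"
      using s(1) unfolding closed_segment_def by (auto intro!: exI[of _ "(1 + s) / 2"])
  qed
qed

text \<open>On the segment the norm estimate in the definition of the resolvent set fails, by the
  Weyl vectors or by perturbation at 0. Off the segment solvability comes from
  \<open>resolvent_surj\<close>, and the norm estimate from \<open>resolvent_bound\<close> also
  gives uniqueness.\<close>

lemma FRplus_resolvent_iff:
  "z \<in> FRplus_resolvent \<longleftrightarrow> z\<^sup>2 \<notin> closed_segment 0 (\<i> / 2)"
proof
  assume "z \<in> FRplus_resolvent"
  then obtain C where C: "\<And>f y. FRplus f y \<Longrightarrow> L2norm f \<le> C * L2norm (\<lambda>t. y t - z * f t)"
    unfolding FRplus_resolvent_def by blast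
  have bound: "norm x \<le> C * norm (FRop x - cscale z x)" for x
  proof -
    obtain f where f: "f \<in> L2plus" "x = cls f" by (rule cls_cases)
    obtain y where y: "y \<in> L2plus" "FRop x = cls y" by (rule cls_cases)
    have "FRplus f y" using f y by (simp add: FRplus_iff)
    from C[OF this] show ?thesis
      using f y by (simp add: norm_cls cscale_cls cls_diff L2plus_cmult L2plus_diff)
  qed
  show "z\<^sup>2 \<notin> closed_segment 0 (\<i> / 2)"
  proof
    assume "z\<^sup>2 \<in> closed_segment 0 (\<i> / 2)"
    then obtain a where a: "0 \<le> a" "a \<le> 1" "z\<^sup>2 = \<i> / 2 * of_real a"
      by (auto simp: closed_segment_def scaleR_conv_of_real mult.commute)
    show False
    proof (cases "a = 0")
      case True
      then have "z = 0" using a by simp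
      then show False using bound no_bound_zero by (auto simp: cscale_def)
    next
      case False
      then show False using no_bound_nonzero[of a z] a bound by auto
    qed
  qed
next
  assume z: "z\<^sup>2 \<notin> closed_segment 0 (\<i> / 2)"
  note res = bounded_linear_FRop FRop_imul FRop_FRop_numerical_range z
  obtain C where C: "\<And>x. norm x \<le> C * norm (FRop x - cscale z x)"
    using resolvent_bound[OF res] by blast
  have graph: "FRop (cls f) - cscale z (cls f) = cls (\<lambda>t. y t - z * f t)" "(\<lambda>t. y t - z * f t) \<in> L2plus" "f \<in> L2plus"
    if "FRplus f y" for f y
    using that by (auto simp: FRplus_iff cscale_cls cls_diff L2plus_cmult L2plus_diff)
  have zero: "cls (\<lambda>_. 0) = 0" by (simp add: zero_l2.abs_eq)
  show "z \<in> FRplus_resolvent"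
    unfolding FRplus_resolvent_def
  proof (intro CollectI conjI ballI allI impI)
    fix g assume g: "g \<in> L2plus"
    obtain x where x: "FRop x - cscale z x = cls g" using resolvent_surj[OF res] by blast
    obtain f where f: "f \<in> L2plus" "x = cls f" by (rule cls_cases)
    obtain y where y: "y \<in> L2plus" "FRop x = cls y" by (rule cls_cases)
    have "FRplus f y" using f y by (simp add: FRplus_iff)
    moreover have "AE t in lborel. y t - z * f t = g t"
      using graph(1,2)[OF calculation] x f(2) g by (simp add: cls_eq_iff)
    ultimately show "\<exists>f y. FRplus f y \<and> (AE t in lborel. y t - z * f t = g t)" by blast
  next
    fix f y assume a: "FRplus f y \<and> (AE t in lborel. y t - z * f t = 0)"
    then have "cls (\<lambda>t. y t - z * f t) = cls (\<lambda>_. 0)"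
      using graph(2)[of f y] L2plus_zero by (simp add: cls_eq_iff)
    then have "norm (cls f) \<le> 0" using C[of "cls f"] graph(1)[of f y] a by (simp add: zero)
    then have "cls f = cls (\<lambda>_. 0)" by (simp add: zero)
    then show "AE t in lborel. f t = 0" using graph(3)[of f y] a L2plus_zero by (simp add: cls_eq_iff)
  next
    show "\<exists>C. \<forall>f y. FRplus f y \<longrightarrow> L2norm f \<le> C * L2norm (\<lambda>t. y t - z * f t)"
    proof (intro exI allI impI)
      fix f y assume a: "FRplus f y"
      show "L2norm f \<le> C * L2norm (\<lambda>t. y t - z * f t)"
        using C[of "cls f"] graph[OF a] by (simp add: norm_cls)
    qed
  qed
qed

theorem theorem4p4:
  shows "FRplus_spectrum =
    closed_segment (- (exp (\<i> * of_real (pi / 4)) / of_real (sqrt 2)))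
                   (exp (\<i> * of_real (pi / 4)) / of_real (sqrt 2))"
  unfolding FRplus_spectrum_def
  using FRplus_resolvent_iff segment_iff_square by blast

end
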